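(* There exist uncountably many unions of bands $Y$ of thin type such that the union of two-ended leaves has full measure in $Y$.
   Context: **Unions of bands.** A band is a rectangle $B=[a,b]\times[0,1]\subset\mathbb R^2$, $a\le b$, with the form $dx$ ($x$ is the first coordinate); it is degenerate if $a=b$; its bases are $[a,b]\times\{0\}$ and $[a,b]\times\{1\}$. A union of bands is a $2$-complex $Y$ with closed $1$-form $dx$ obtained from a finite union $D$ of pairwise disjoint closed (possibly degenerate) intervals of $\mathbb R$ (the support multi-interval) and finitely many pairwise disjoint bands by gluing each base of every band isometrically and preserving orientation to a closed subinterval of $D$. The leaves of the foliation $\mathcal F_{dx}$ are the maximal path-connected subsets $L\subset Y$ such that $dx|_\alpha\equiv 0$ for every arc $\alpha\subset L$; each is a $1$-dimensional complex composed of vertical arcs $\{c\}\times[0,1]$ of bands. Measure on $Y$ is the two-dimensional Lebesgue measure on the bands. $Y$ is annulus-free if there is no embedded annulus $A\subset Y$ such that $(A,dx|_A)$ is foliated by circles. **Thin type.** A free arc of a union of bands $Y$ is a maximal open interval $J\subset D$ that is covered by one of the bases of bands while all other bases are disjoint from $J$. If $B=[a,b]\times[0,1]$ is the band one of whose bases covers $J$ and $(c,d)\subset[a,b]$ corresponds to $J$, the collapse from $J$ removes $J$ from $D$ and $(c,d)\times[0,1]$ from $B$, replacing $B$ by the bands $[a,c]\times[0,1]$ and $[d,b]\times[0,1]$ with restricted attaching maps; if this produces an isolated point of $D$ with only one degenerate band attached to it, that point and that band are removed. An annulus-free union of bands $Y$ is of thin type if every leaf of $\mathcal F_{dx}$ is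 everywhere dense in $Y$ and there is an infinite sequence $Y_0=Y,Y_1,Y_2,\dots$ in which every $Y_i$ is obtained from $Y_{i-1}$ by a collapse from a free arc. A leaf is two-ended if it is a tree with exactly two topological ends (equivalently, $2$ is the maximal number of pairwise disjoint rays in it). *)

theory Defs
  imports "HOL-Analysis.Analysis"
begin

section \<open>Unions of bands\<close>

text \<open>An isometric, orientation preserving gluing of a base of the band
  \<open>[lo, hi] \<times> [0,1]\<close> to a subinterval of the real line is a translation. The base at height \<open>0\<close> is
  translated by \<open>shift B False\<close>, the base at height \<open>1\<close> by \<open>shift B True\<close>.\<close>

record band =
  lo :: real
  hi :: real
  shift :: "bool \<Rightarrow> real"

record band_union =
  support :: "real set"
  bands :: "band set"

definition rect :: "band \<Rightarrow> (real \<times> real) set" where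
  "rect B = {lo B..hi B} \<times> {0..1}"

definition base :: "band \<Rightarrow> bool \<Rightarrow> real set" where
  "base B e = {lo B + shift B e..hi B + shift B e}"

definition degenerate :: "band \<Rightarrow> bool" where
  "degenerate B \<longleftrightarrow> lo B = hi B"

definition multi_interval :: "real set \<Rightarrow> bool" where
  "multi_interval D \<longleftrightarrow>
     (\<exists>F. finite F \<and> (\<forall>I\<in>F. \<exists>u v. u \<le> v \<and> I = {u..v}) \<and> disjoint F \<and> D = \<Union>F)"

definition union_of_bands :: "band_union \<Rightarrow> bool" where
  "union_of_bands Y \<longleftrightarrow>
     multi_interval (support Y) \<and> finite (bands Y) \<and>
     (\<forall>B\<in>bands Y. lo B \<le> hi B) \<and>
     pairwise (\<lambda>B B'. disjnt (rect B) (rect B')) (bands Y) \<and>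
     (\<forall>B\<in>bands Y. \<forall>e. base B e \<subseteq> support Y)"


section \<open>The 2-complex\<close>

text \<open>The quotient of the disjoint union of \<open>D\<close> and the bands is represented by normal forms:
  \<open>Inl x\<close> for a point \<open>x\<close> of \<open>D\<close>, and \<open>Inr (x, y)\<close> with \<open>0 < y < 1\<close> for a point of a band that is
  not on a base. The quotient map is \<open>Inl\<close> on \<open>D\<close> and \<open>glue B\<close> on the band \<open>B\<close>.\<close>

type_synonym point = "real + real \<times> real"

definition glue :: "band \<Rightarrow> real \<times> real \<Rightarrow> point" where
  "glue B p =
     (if snd p = 0 then Inl (fst p + shift B False)
      else if snd p = 1 then Inl (fst p + shift B True)
      else Inr p)"

definition points :: "band_union \<Rightarrow> point set" where
  "points Y = Inl ` support Y \<union> (\<Union>B\<in>bands Y. glue B ` rect B)"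

definition space_of :: "band_union \<Rightarrow> point topology" where
  "space_of Y = topology (\<lambda>U. U \<subseteq> points Y \<and>
     openin (top_of_set (support Y)) {x \<in> support Y. Inl x \<in> U} \<and>
     (\<forall>B\<in>bands Y. openin (top_of_set (rect B)) {p \<in> rect B. glue B p \<in> U}))"

lemma istopology_preimages:
  "istopology (\<lambda>U. U \<subseteq> P \<and> (\<forall>i\<in>I. openin (T i) {x \<in> topspace (T i). f i x \<in> U}))"
  unfolding istopology_def
proof (intro conjI allI impI ballI)
  fix S S' i
  assume "S \<subseteq> P \<and> (\<forall>i\<in>I. openin (T i) {x \<in> topspace (T i). f i x \<in> S})"
    and "S' \<subseteq> P \<and> (\<forall>i\<in>I. openin (T i) {x \<in> topspace (T i). f i x \<in> S'})"
    and i: "i \<in> I"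
  then have "openin (T i) ({x \<in> topspace (T i). f i x \<in> S} \<inter> {x \<in> topspace (T i). f i x \<in> S'})"
    by (intro openin_Int) auto
  also have "{x \<in> topspace (T i). f i x \<in> S} \<inter> {x \<in> topspace (T i). f i x \<in> S'}
    = {x \<in> topspace (T i). f i x \<in> S \<inter> S'}"
    by auto
  finally show "openin (T i) {x \<in> topspace (T i). f i x \<in> S \<inter> S'}" .
next
  fix \<K> i
  assume *: "\<forall>K\<in>\<K>. K \<subseteq> P \<and> (\<forall>i\<in>I. openin (T i) {x \<in> topspace (T i). f i x \<in> K})"
    and i: "i \<in> I"
  then have "openin (T i) (\<Union>K\<in>\<K>. {x \<in> topspace (T i). f i x \<in> K})"
    by (intro openin_Union) auto
  also have "(\<Union>K\<in>\<K>. {x \<in> topspace (T i). f i x \<in> K}) = {x \<in> topspace (T i). f i x \<in> \<Union>\<K>}"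
    by auto
  finally show "openin (T i) {x \<in> topspace (T i). f i x \<in> \<Union>\<K>}" .
qed auto

lemma istopology_conj:
  assumes "istopology P" "istopology Q"
  shows "istopology (\<lambda>U. P U \<and> Q U)"
proof -
  have "P (S \<inter> T)" "Q (S \<inter> T)" if "P S \<and> Q S" "P T \<and> Q T" for S T
    using assms that by (simp_all add: istopology_def)
  moreover have "P (\<Union>\<K>)" "Q (\<Union>\<K>)" if "\<forall>K\<in>\<K>. P K \<and> Q K" for \<K>
    using assms that by (simp_all add: istopology_def)
  ultimately show ?thesis
    by (simp add: istopology_def)
qed

lemma openin_space_of:
  "openin (space_of Y) U \<longleftrightarrow> U \<subseteq> points Y \<and>
     openin (top_of_set (support Y)) {x \<in> support Y. Inl x \<in> U} \<and>
     (\<forall>B\<in>bands Y. openin (top_of_set (rect B)) {p \<in> rect B. glue B p \<in> U})"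
proof -
  let ?P = "\<lambda>U. U \<subseteq> points Y \<and> openin (top_of_set (support Y)) {x \<in> support Y. Inl x \<in> U}"
  let ?Q = "\<lambda>U. U \<subseteq> points Y \<and>
      (\<forall>B\<in>bands Y. openin (top_of_set (rect B)) {p \<in> rect B. glue B p \<in> U})"
  have 1: "istopology ?P"
    using istopology_preimages[of "points Y" "UNIV :: unit set" "\<lambda>_. top_of_set (support Y)" "\<lambda>_. Inl"]
    by (simp only: topspace_euclidean_subtopology ball_UNIV simp_thms)
  have 2: "istopology ?Q"
    using istopology_preimages[of "points Y" "bands Y" "\<lambda>B. top_of_set (rect B)" glue]
    by (simp only: topspace_euclidean_subtopology)
  have "istopology (\<lambda>U. ?P U \<and> ?Q U)"
    by (rule istopology_conj[OF 1 2])
  then have "openin (topology (\<lambda>U. ?P U \<and> ?Q U)) U \<longleftrightarrow> ?P U \<and> ?Q U"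
    by (simp only: topology_inverse')
  moreover have "space_of Y = topology (\<lambda>U. ?P U \<and> ?Q U)"
    unfolding space_of_def by (rule arg_cong[where f = topology]) (intro ext iffI; elim conjE; intro conjI; assumption)
  ultimately show ?thesis
    by (simp only: conj_ac) argo
qed

lemma topspace_space_of:
  assumes "union_of_bands Y"
  shows "topspace (space_of Y) = points Y"
proof
  show "topspace (space_of Y) \<subseteq> points Y"
    using openin_space_of openin_topspace by blast
  have "{x \<in> support Y. Inl x \<in> points Y} = support Y"
    by (auto simp: points_def)
  moreover have "{p \<in> rect B. glue B p \<in> points Y} = rect B" if "B \<in> bands Y" for B
    using that by (auto simp: points_def)
  ultimately have "openin (space_of Y) (points Y)"
    by (simp add: openin_space_of)
  then show "points Y \<subseteq> topspace (space_of Y)"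
    by (rule openin_subset)
qed


section \<open>The closed 1-form and its foliation\<close>

definition locally_constant_on :: "'a::topological_space set \<Rightarrow> ('a \<Rightarrow> real) \<Rightarrow> bool" where
  "locally_constant_on S f \<longleftrightarrow> (\<forall>p\<in>S. \<forall>\<^sub>F q in at p within S. f q = f p)"

text \<open>The form \<open>dx\<close> is handled through its primitives on open subsets of the complex: functions whose
  pullbacks to \<open>D\<close> and to every band differ from the first coordinate by a locally constant
  function. Every point has a neighbourhood on which a primitive exists.\<close>

definition dx_primitive :: "band_union \<Rightarrow> point set \<Rightarrow> (point \<Rightarrow> real) \<Rightarrow> bool" where
  "dx_primitive Y U f \<longleftrightarrow> openin (space_of Y) U \<and>
     locally_constant_on {x \<in> support Y. Inl x \<in> U} (\<lambda>x. f (Inl x) - x) \<and>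
     (\<forall>B\<in>bands Y. locally_constant_on {p \<in> rect B. glue B p \<in> U} (\<lambda>p. f (glue B p) - fst p))"

definition dx_zero_along :: "band_union \<Rightarrow> (real \<Rightarrow> point) \<Rightarrow> bool" where
  "dx_zero_along Y g \<longleftrightarrow>
     (\<forall>U f. dx_primitive Y U f \<longrightarrow> locally_constant_on {t \<in> {0..1}. g t \<in> U} (f \<circ> g))"

definition vertical :: "band_union \<Rightarrow> point set \<Rightarrow> bool" where
  "vertical Y L \<longleftrightarrow> path_connectedin (space_of Y) L \<and>
     (\<forall>g. pathin (space_of Y) g \<and> inj_on g {0..1} \<and> g ` {0..1} \<subseteq> L \<longrightarrow> dx_zero_along Y g)"

text \<open>The leaves of the foliation of a subset \<open>A\<close> defined by the restriction of \<open>dx\<close> to \<open>A\<close>.\<close>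

definition leaves_in :: "band_union \<Rightarrow> point set \<Rightarrow> point set set" where
  "leaves_in Y A = {L. L \<subseteq> A \<and> vertical Y L \<and> (\<forall>L'. L' \<subseteq> A \<and> vertical Y L' \<and> L \<subseteq> L' \<longrightarrow> L' = L)}"

abbreviation leaves :: "band_union \<Rightarrow> point set set" where
  "leaves Y \<equiv> leaves_in Y (points Y)"

abbreviation circle :: "complex set" where
  "circle \<equiv> sphere 0 1"

definition annulus_free :: "band_union \<Rightarrow> bool" where
  "annulus_free Y \<longleftrightarrow>
     \<not> (\<exists>A\<subseteq>points Y.
          subtopology (space_of Y) A homeomorphic_space top_of_set (circle \<times> {0..1::real}) \<and>
          (\<forall>L\<in>leaves_in Y A. subtopology (space_of Y) L homeomorphic_space top_of_set circle))"


section \<open>Thin type\<close>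

definition covered_once :: "band_union \<Rightarrow> real set \<Rightarrow> band \<Rightarrow> bool \<Rightarrow> bool" where
  "covered_once Y J B e \<longleftrightarrow>
     (\<exists>u v. u < v \<and> J = {u<..<v}) \<and> J \<subseteq> support Y \<and> B \<in> bands Y \<and> J \<subseteq> base B e \<and>
     (\<forall>B'\<in>bands Y. \<forall>e'. (B', e') \<noteq> (B, e) \<longrightarrow> disjnt (base B' e') J)"

text \<open>\<open>J\<close> is a free arc, and \<open>base B e\<close> is the base covering it.\<close>

definition free_arc :: "band_union \<Rightarrow> real set \<Rightarrow> band \<Rightarrow> bool \<Rightarrow> bool" where
  "free_arc Y J B e \<longleftrightarrow> covered_once Y J B e \<and>
     (\<forall>J' B' e'. covered_once Y J' B' e' \<and> J \<subseteq> J' \<longrightarrow> J' = J)"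

text \<open>Only the endpoints \<open>u\<close>, \<open>v\<close> of the free arc can become isolated points of the support
  during the collapse; \<open>Z\<close> is the set of those that have to be removed.\<close>

definition collapse :: "band_union \<Rightarrow> band_union \<Rightarrow> bool" where
  "collapse Y Y' \<longleftrightarrow>
     (\<exists>u v B e. u < v \<and> free_arc Y {u<..<v} B e \<and>
       (let D = support Y - {u<..<v};
            \<B> = (bands Y - {B}) \<union> {B\<lparr>hi := u - shift B e\<rparr>, B\<lparr>lo := v - shift B e\<rparr>};
            att = (\<lambda>z. {B' \<in> \<B>. \<exists>e'. z \<in> base B' e'});
            Z = {z \<in> {u, v}. z isolated_in D \<and> (\<exists>B'. att z = {B'} \<and> degenerate B')}
        in support Y' = D - Z \<and> bands Y' = \<B> - (\<Union>z\<in>Z. att z)))"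

definition thin_type :: "band_union \<Rightarrow> bool" where
  "thin_type Y \<longleftrightarrow> union_of_bands Y \<and> annulus_free Y \<and>
     (\<forall>L\<in>leaves Y. space_of Y closure_of L = points Y) \<and>
     (\<exists>Ys. Ys 0 = Y \<and> (\<forall>i::nat. collapse (Ys i) (Ys (Suc i))))"


section \<open>Two-ended leaves\<close>

text \<open>The topology of a leaf as a 1-dimensional complex, i.e. the weak topology with respect to its
  vertical arcs. It is in general strictly finer than the topology induced from the 2-complex.\<close>

definition leaf_space :: "band_union \<Rightarrow> point set \<Rightarrow> point topology" where
  "leaf_space Y L = topology (\<lambda>U. U \<subseteq> L \<and>
     (\<forall>B\<in>bands Y. \<forall>x\<in>{lo B..hi B}. openin (top_of_set {0..1}) {y \<in> {0..1}. glue B (x, y) \<in> U}))"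

lemma openin_leaf_space:
  "openin (leaf_space Y L) U \<longleftrightarrow> U \<subseteq> L \<and>
     (\<forall>B\<in>bands Y. \<forall>x\<in>{lo B..hi B}. openin (top_of_set {0..1}) {y \<in> {0..1}. glue B (x, y) \<in> U})"
proof -
  have "istopology (\<lambda>U. U \<subseteq> L \<and>
     (\<forall>B\<in>bands Y. \<forall>x\<in>{lo B..hi B}. openin (top_of_set {0..1}) {y \<in> {0..1}. glue B (x, y) \<in> U}))"
    using istopology_preimages[of L "SIGMA B:bands Y. {lo B..hi B}" "\<lambda>_. top_of_set {0..1}"
        "\<lambda>(B, x) y. glue B (x, y)"]
    by (simp only: split_paired_Ball_Sigma prod.case topspace_euclidean_subtopology)
  then show ?thesis
    unfolding leaf_space_def by (simp only: topology_inverse')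
qed

text \<open>For a 1-dimensional complex, absence of cycles means absence of embedded circles.\<close>

definition is_tree :: "'a topology \<Rightarrow> bool" where
  "is_tree X \<longleftrightarrow> connected_space X \<and>
     \<not> (\<exists>C\<subseteq>topspace X. subtopology X C homeomorphic_space top_of_set circle)"

text \<open>Topological (Freudenthal) ends: the inverse limit, over the compact sets \<open>K\<close>, of the sets
  of connected components of the complement of \<open>K\<close>.\<close>

definition ends :: "'a topology \<Rightarrow> ('a set \<Rightarrow> 'a set) set" where
  "ends X = {\<epsilon> \<in> (\<Pi>\<^sub>E K\<in>{K. compactin X K}.
                   connected_components_of (subtopology X (topspace X - K))).
               \<forall>K K'. compactin X K \<and> compactin X K' \<and> K \<subseteq> K' \<longrightarrow> \<epsilon> K' \<subseteq> \<epsilon> K}"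

definition two_ended :: "band_union \<Rightarrow> point set \<Rightarrow> bool" where
  "two_ended Y L \<longleftrightarrow> is_tree (leaf_space Y L) \<and> card (ends (leaf_space Y L)) = 2"

definition full_measure :: "band_union \<Rightarrow> point set \<Rightarrow> bool" where
  "full_measure Y S \<longleftrightarrow> (\<forall>B\<in>bands Y. {p \<in> rect B. glue B p \<notin> S} \<in> null_sets lebesgue)"


section \<open>Isomorphism up to rescaling\<close>

text \<open>A homeomorphism \<open>h\<close> with \<open>h\<^sup>* dx = c dx\<close> for some nonzero constant \<open>c\<close>.\<close>

definition isomorphic_upto_scale :: "band_union \<Rightarrow> band_union \<Rightarrow> bool" where
  "isomorphic_upto_scale Y Y' \<longleftrightarrow>
     (\<exists>h c. homeomorphic_map (space_of Y) (space_of Y') h \<and> c \<noteq> 0 \<and>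
        (\<forall>U f. dx_primitive Y' U f \<longrightarrow>
           dx_primitive Y {p \<in> points Y. h p \<in> U} (\<lambda>p. f (h p) / c)))"

end

theory Submission
  imports Defs
begin

text \<open>The complexes are suspensions of the interval translation maps of Bruin and Troubetzkoy, which
  add \<open>\<alpha>\<close>, \<open>\<beta>\<close> and \<open>\<beta> - 1\<close> on \<open>[0, 1 - \<alpha>)\<close>, \<open>[1 - \<alpha>, 1 - \<beta>)\<close> and \<open>[1 - \<beta>, 1)\<close>: three bands over
  \<open>[0, 1]\<close> whose bottoms tile the interval while their tops overlap and leave a gap. The first return
  map to \<open>[1 - \<alpha>, 1)\<close> has the same form, and the parameters are chosen such that this renormalisation
  can be repeated forever. Then the attractor \<open>Om = \<Inter>n. F\<^sup>n [0, 1)\<close> is nowhere dense, all orbit classes are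
  dense, and if most renormalisation steps are of the kind that loses no measure, \<open>Om\<close> has positive
  measure and almost every orbit enters it.

  Collapses from free arcs never stop: if the tops covered all but countably many points of the
  remaining support, this support would be contained in \<open>Om\<close> up to a countable set. Since \<open>F\<close> maps
  \<open>Om\<close> onto itself by translations, it is injective on \<open>Om\<close> outside a null set. So in almost every leaf
  the points of \<open>Om\<close> form one bi-infinite orbit, and only finite trees are attached to each vertex of
  this line, because a point outside \<open>Om\<close> has finitely many iterated preimages.

  An isomorphism up to scale makes \<open>\<alpha>\<close> and \<open>\<beta>\<close> quotients of integral combinations of \<open>1\<close> and the
  parameters of the other complex, so each isomorphism class is countable.\<close>

section \<open>A family of interval translation maps\<close>

text \<open>The two kinds of renormalisation steps work against each other. A step with
  \<open>k i = 2\<close> at least halves the length, so infinitely many of them make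
  \<open>L\<close> tend to 0, and copies of their gaps lie in every interval, so \<open>Om\<close>
  has no interior; but every gap costs measure. Long runs of ones between the twos reconcile this:
  they make the gap small relative to the length, and exponentially growing runs make the losses
  summable. The total 1/6 is dictated by the covering argument for orbits that never meet
  \<open>Om\<close>, which needs density 1/2 of \<open>Om\<close> in every left neighbourhood of 1:
  consecutive lengths differ by a factor of at most 3, so losing 1/6 at the lengths
  \<open>L i\<close> means losing at most 1/2 at all lengths. On the topological side,
  \<open>vertical\<close> tests injective paths only, and the form is accessible only through
  primitives. The leaves are therefore identified by two facts: distinct points of a path connected
  subset are joined by an arc inside it, and a connected set of reals with countably many elements
  is at most a point. The second one also applies to the union of the three exceptional leaves,
  where the discontinuities of \<open>F\<close> spoil the dynamical description.\<close>

text \<open>Below, \<open>f i\<close> is an interval translation map of \<open>[1 - L i, 1)\<close>, and \<open>f (Suc i)\<close> is its first return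
  map to \<open>[1 - L (Suc i), 1)\<close>: the return orbit of a point of \<open>C i\<close> makes \<open>k i\<close> or \<open>k i - 1\<close> steps in \<open>A i\<close>,
  which is the origin of \<open>L_rec\<close>. The iterates of \<open>I (Suc i)\<close> cover \<open>I i\<close> if \<open>k i = 1\<close>; if \<open>k i = 2\<close>,
  they leave a gap whose proportion is bounded by \<open>loss i\<close>.\<close>

locale interval_translation_map =
  fixes L :: "nat \<Rightarrow> real" and k :: "nat \<Rightarrow> nat" and loss :: "nat \<Rightarrow> real"
  assumes L_0: "L 0 = 1"
    and L_pos: "0 < L i"
    and L_Suc_less: "L (Suc i) < L i"
    and k_cases: "k i = 1 \<or> k i = 2"
    and L_rec: "L i = k i * L (Suc i) + L (Suc (Suc i)) - L (Suc (Suc (Suc i)))"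
    and k_infinite: "\<exists>j\<ge>i. k j = 2"
    and loss: "k i = 2 \<Longrightarrow> L (Suc i) - L (Suc (Suc i)) \<le> loss i * L (Suc i)"
    and loss_nonneg: "0 \<le> loss i"
    and loss_sum: "sum loss {..<n} \<le> 1/6"
begin

lemma L_antimono: "i \<le> j \<Longrightarrow> L j \<le> L i"
  using L_Suc_less by (intro decseqD[of L]) (auto simp: decseq_Suc_iff intro: less_imp_le)

text \<open>The monotone sequence has a limit \<open>l\<close>, and
  \<open>2 * L (Suc j) \<le> L j\<close> at arbitrarily late indices leaves no room for
  \<open>l > 0\<close>.\<close>

lemma L_tendsto_0: "L \<longlonglongrightarrow> 0"
proof -
  obtain l where l: "L \<longlonglongrightarrow> l"
    by (rule decseq_convergent[of L 0]) (use L_antimono L_pos in \<open>auto simp: decseq_def less_imp_le\<close>)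
  have "l \<le> L i" for i
    using decseq_ge[OF _ l] L_antimono by (auto simp: decseq_def)
  then have ge: "l \<le> L i" for i .
  have "l \<ge> 0"
    using LIMSEQ_le_const[OF l, of 0] L_pos by (auto intro: less_imp_le)
  have "l \<le> e" if "e > 0" for e :: real
  proof -
    obtain N where N: "\<And>n. n \<ge> N \<Longrightarrow> \<bar>L n - l\<bar> < e"
      using LIMSEQ_D[OF l \<open>e > 0\<close>] by auto
    obtain j where j: "j \<ge> N" "k j = 2"
      using k_infinite by blast
    have "L j \<ge> 2 * L (Suc j)"
      using L_rec[of j] j L_Suc_less[of "Suc (Suc j)"] by simp
    then show "l \<le> e"
      using N[OF j(1)] ge[of "Suc j"] by linarith
  qed
  then have "l \<le> 0"
    by (meson dense_ge)
  with \<open>l \<ge> 0\<close> l show ?thesis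
    by simp
qed

lemma L_small: "0 < e \<Longrightarrow> \<exists>i. \<forall>j\<ge>i. L j < e"
  using LIMSEQ_D[OF L_tendsto_0, of e] L_pos by (auto simp: abs_of_pos)

lemma L_le_3: "L i \<le> 3 * L (Suc i)"
  using L_rec[of i] k_cases[of i] L_Suc_less[of "Suc i"] L_pos[of "Suc (Suc (Suc i))"] L_pos[of "Suc i"]
  by auto

definition f :: "nat \<Rightarrow> real \<Rightarrow> real" where
  "f i x = (if x < 1 - L (Suc i) then x + L (Suc i)
     else if x < 1 - L (Suc (Suc i)) then x + L (Suc (Suc i))
     else x + L (Suc (Suc i)) - L i)"

abbreviation F :: "real \<Rightarrow> real" where "F \<equiv> f 0"

definition I :: "nat \<Rightarrow> real set" where "I i = {1 - L i..<1}"
definition A :: "nat \<Rightarrow> real set" where "A i = {1 - L i..<1 - L (Suc i)}"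
definition B :: "nat \<Rightarrow> real set" where "B i = {1 - L (Suc i)..<1 - L (Suc (Suc i))}"
definition C :: "nat \<Rightarrow> real set" where "C i = {1 - L (Suc (Suc i))..<1}"

lemma I_0: "I 0 = {0..<1}"
  by (simp add: I_def L_0)

lemma I_split: "I i = A i \<union> B i \<union> C i"
  using L_Suc_less[of i] L_Suc_less[of "Suc i"] L_pos[of "Suc (Suc i)"]
  by (auto simp: I_def A_def B_def C_def)

lemma I_Suc: "I (Suc i) = B i \<union> C i"
  using L_Suc_less[of i] L_Suc_less[of "Suc i"] L_pos[of "Suc (Suc i)"]
  by (auto simp: I_def B_def C_def)

lemma A_Suc: "A (Suc i) = B i"
  by (auto simp: A_def B_def)

lemma C_split: "C i = B (Suc i) \<union> C (Suc i)"
  using L_Suc_less[of "Suc (Suc i)"] L_pos[of "Suc (Suc (Suc i))"]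
  by (auto simp: B_def C_def)

lemma I_antimono: "i \<le> j \<Longrightarrow> I j \<subseteq> I i"
  using L_antimono[of i j] by (auto simp: I_def)

lemma f_A: "x \<in> A i \<Longrightarrow> f i x = x + L (Suc i)"
  by (auto simp: f_def A_def)

lemma f_B: "x \<in> B i \<Longrightarrow> f i x = x + L (Suc (Suc i))"
  by (auto simp: f_def B_def)

lemma f_C: "x \<in> C i \<Longrightarrow> f i x = x + L (Suc (Suc i)) - L i"
  using L_Suc_less[of "Suc i"] by (auto simp: f_def C_def)

lemma f_I: "x \<in> I i \<Longrightarrow> f i x \<in> I i"
  using L_Suc_less[of i] L_Suc_less[of "Suc i"] L_pos[of "Suc (Suc i)"] L_pos[of i]
  by (auto simp: I_def f_def)

lemma F_unit: "x \<in> {0..<1} \<Longrightarrow> F x \<in> {0..<1}"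
  using f_I[of x 0] by (simp add: I_0)

lemma F_pow_unit: "x \<in> {0..<1} \<Longrightarrow> (F ^^ n) x \<in> {0..<1}"
  by (induction n) (use F_unit in simp_all)

text \<open>As long as the next point is below 1, the present one is left of
  \<open>1 - L (Suc i)\<close>, so the orbit has not yet left \<open>A i\<close>.\<close>

lemma F_pow_A_iterate:
  assumes n: "\<And>x. x \<in> A i \<Longrightarrow> (F ^^ n) x = x + L (Suc i)"
    and "1 - L i \<le> x" "x + j * L (Suc i) < 1"
  shows "(F ^^ (n * j)) x = x + j * L (Suc i)"
  using assms(3)
proof (induction j)
  case (Suc j)
  have "0 \<le> j * L (Suc i)" "0 < L (Suc i)"
    using L_pos[of "Suc i"] by simp_all
  moreover have "x + j * L (Suc i) + L (Suc i) < 1"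
    using Suc.prems by (simp add: algebra_simps)
  ultimately have "x + j * L (Suc i) \<in> A i" "x + j * L (Suc i) < 1"
    using assms(2) unfolding A_def atLeastLessThan_iff by linarith+
  with Suc n[of "x + j * L (Suc i)"] show ?case
    by (simp add: funpow_add algebra_simps)
qed simp

text \<open>The last two conclusions confine the return orbit between \<open>f i x\<close> and
  \<open>f (Suc i) x\<close> to the range in which \<open>F_pow_A_iterate\<close> applies.\<close>

lemma f_Suc_C:
  assumes "x \<in> C i"
  shows "\<exists>m. f (Suc i) x = f i x + real m * L (Suc i)" "f (Suc i) x < 1" "1 - L i \<le> f i x"
proof -
  have "x \<in> I (Suc i)"
    using assms I_Suc by simp
  then show "f (Suc i) x < 1"
    using f_I by (auto simp: I_def)
  show "1 - L i \<le> f i x"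
    using assms by (auto simp: f_C C_def)
  have "f (Suc i) x = f i x + real (k i) * L (Suc i)" if "x \<in> B (Suc i)"
    using that assms f_B[of x "Suc i"] f_C[of x i] L_rec[of i] by auto
  moreover have "f (Suc i) x = f i x + real (k i - 1) * L (Suc i)" if "x \<in> C (Suc i)"
    using that assms f_C[of x "Suc i"] f_C[of x i] L_rec[of i] k_cases[of i]
    by (auto simp: algebra_simps)
  ultimately show "\<exists>m. f (Suc i) x = f i x + real m * L (Suc i)"
    using assms C_split by blast
qed

text \<open>The exponent is the same for all of \<open>S\<close>; only so can one power of
  \<open>F\<close> translate a whole interval.\<close>

definition power_on :: "nat \<Rightarrow> nat \<Rightarrow> real set \<Rightarrow> bool" where
  "power_on n i S \<longleftrightarrow> 0 < n \<and> (\<forall>x\<in>S. (F ^^ n) x = f i x)"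

lemma power_on_Suc:
  assumes "power_on a i (A i)" "power_on c i (C i)" "S \<subseteq> C i"
    and "\<And>x. x \<in> S \<Longrightarrow> f (Suc i) x = f i x + real j * L (Suc i)"
  shows "power_on (a * j + c) (Suc i) S"
proof -
  have a: "(F ^^ a) x = x + L (Suc i)" if "x \<in> A i" for x
    using assms(1) that f_A by (simp add: power_on_def)
  have "(F ^^ (a * j + c)) x = f (Suc i) x" if "x \<in> S" for x
  proof -
    have "x \<in> C i"
      using that assms(3) by blast
    then have c: "(F ^^ c) x = f i x"
      using assms(2) by (simp add: power_on_def)
    have "f i x + real j * L (Suc i) < 1"
      using f_Suc_C(2)[OF \<open>x \<in> C i\<close>] assms(4)[OF that] by simp
    with F_pow_A_iterate[OF a f_Suc_C(3)[OF \<open>x \<in> C i\<close>]]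
    have "(F ^^ (a * j)) (f i x) = f i x + real j * L (Suc i)"
      by simp
    then show ?thesis
      unfolding funpow_add o_apply c assms(4)[OF that] .
  qed
  moreover have "0 < a * j + c"
    using assms(2) by (simp add: power_on_def)
  ultimately show ?thesis
    unfolding power_on_def by blast
qed

text \<open>The return times obey the substitution that sends \<open>(a, b, c)\<close> to
  \<open>(b, a * k i + c, a * (k i - 1) + c)\<close>, because \<open>A (Suc i) = B i\<close> and the
  points of \<open>C i\<close> return through \<open>A i\<close>.\<close>

lemma f_power:
  "\<exists>a b c. power_on a i (A i) \<and> power_on b i (B i) \<and> power_on c i (C i)"
proof (induction i)
  case 0
  have "power_on 1 0 S" for S
    by (simp add: power_on_def)
  then show ?case
    by (intro exI conjI)
next
  case (Suc i)
  from Suc.IH obtain a b c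
    where abc: "power_on a i (A i)" "power_on b i (B i)" "power_on c i (C i)"
    by (elim exE conjE) (rule that; assumption)
  have 1: "power_on (a * k i + c) (Suc i) (B (Suc i))"
  proof (rule power_on_Suc[OF abc(1,3)])
    fix x assume x: "x \<in> B (Suc i)"
    then have xC: "x \<in> C i"
      unfolding C_split[of i] by (rule UnI1)
    show "f (Suc i) x = f i x + real (k i) * L (Suc i)"
      unfolding f_B[OF x] f_C[OF xC] using L_rec[of i] by linarith
  next
    show "B (Suc i) \<subseteq> C i"
      unfolding C_split[of i] by (rule Un_upper1)
  qed
  have 2: "power_on (a * (k i - 1) + c) (Suc i) (C (Suc i))"
  proof (rule power_on_Suc[OF abc(1,3)])
    fix x assume x: "x \<in> C (Suc i)"
    then have xC: "x \<in> C i"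
      by (subst C_split) (rule UnI2)
    have "real (k i - 1) = real (k i) - 1"
      using k_cases[of i] by auto
    then have "real (k i - 1) * L (Suc i) = real (k i) * L (Suc i) - L (Suc i)"
      by (simp only: left_diff_distrib mult_1)
    then show "f (Suc i) x = f i x + real (k i - 1) * L (Suc i)"
      unfolding f_C[OF x] f_C[OF xC] using L_rec[of i] by linarith
  next
    have "C (Suc i) \<subseteq> B (Suc i) \<union> C (Suc i)"
      by (rule Un_upper2)
    then show "C (Suc i) \<subseteq> C i"
      by (simp only: C_split[of i, symmetric])
  qed
  have 3: "power_on b (Suc i) (A (Suc i))"
    unfolding power_on_def
  proof (intro conjI ballI)
    show "0 < b"
      using abc by (simp add: power_on_def)
    fix x assume x: "x \<in> A (Suc i)"
    then have "x \<in> B i"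
      by (simp add: A_Suc)
    then show "(F ^^ b) x = f (Suc i) x"
      using abc(2) f_A[OF x] f_B[of x i] by (simp add: power_on_def)
  qed
  show ?case
    by (rule exI[of _ b], rule exI[of _ "a * k i + c"], rule exI[of _ "a * (k i - 1) + c"])
      (rule conjI[OF 3 conjI[OF 1 2]])
qed

lemma f_iterate: "x \<in> I i \<Longrightarrow> \<exists>n>0. (F ^^ n) x = f i x"
proof -
  assume x: "x \<in> I i"
  obtain a b c where "power_on a i (A i)" "power_on b i (B i)" "power_on c i (C i)"
    using f_power[of i] by (elim exE conjE) (rule that; assumption)
  then show ?thesis
    using x unfolding I_split[of i] power_on_def by blast
qed

text \<open>Inductively, a power of \<open>F\<close> moves \<open>[a, b)\<close> to a left
  neighbourhood of 1. Cut from the right into pieces of length \<open>L (Suc i)\<close>, this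
  neighbourhood has all its pieces pushed up to 1 by steps inside \<open>A i\<close>.\<close>

lemma renormalisation:
  assumes "x \<in> {0..<1}"
  shows "\<exists>a b n. 0 \<le> a \<and> a \<le> x \<and> x < b \<and> b \<le> 1 \<and> b - a \<le> L i \<and>
    (\<forall>y\<in>{a..<b}. (F ^^ n) y = y + 1 - b)"
proof (induction i)
  case 0
  show ?case
    using assms by (intro exI[of _ 0] exI[of _ 1]) (auto simp: L_0)
next
  case (Suc i)
  then obtain a b n where ab: "0 \<le> a" "a \<le> x" "x < b" "b \<le> 1" "b - a \<le> L i"
    and n: "\<And>y. y \<in> {a..<b} \<Longrightarrow> (F ^^ n) y = y + 1 - b"
    by blast
  obtain h where "power_on h i (A i)"
    using f_power[of i] by (elim exE conjE) (rule that; assumption)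
  then have h: "(F ^^ h) x = x + L (Suc i)" if "x \<in> A i" for x
    using that f_A[of x i] by (simp add: power_on_def)
  let ?l = "L (Suc i)"
  have l: "?l > 0" by (rule L_pos)
  \<comment> \<open>The number of whole pieces to the right of \<open>x\<close>. The pieces are
    closed on the left, hence the ceiling minus one instead of the floor.\<close>
  define j where "j = nat (\<lceil>(b - x) / ?l\<rceil> - 1)"
  have "(b - x) / ?l > 0"
    using l ab by simp
  then have j: "real j = of_int \<lceil>(b - x) / ?l\<rceil> - 1"
    unfolding j_def by simp
  have "real j < (b - x) / ?l" "(b - x) / ?l \<le> real j + 1"
    unfolding j by linarith+
  then have j: "x < b - j * ?l" "b - (j + 1) * ?l \<le> x"
    using l by (simp_all add: field_simps)
  have "0 \<le> j * ?l" using l by simp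
  define a' where "a' = max a (b - (j + 1) * ?l)"
  define b' where "b' = b - j * ?l"
  have "(F ^^ (h * j + n)) y = y + 1 - b'" if "y \<in> {a'..<b'}" for y
  proof -
    have y: "y \<in> {a..<b}"
      using that \<open>0 \<le> j * ?l\<close> by (auto simp: a'_def b'_def)
    have "(F ^^ (h * j)) (y + 1 - b) = y + 1 - b + j * ?l"
      using that y ab by (intro F_pow_A_iterate[OF h]) (auto simp: b'_def)
    then show ?thesis
      using n[OF y] by (simp add: funpow_add b'_def)
  qed
  then have "\<forall>y\<in>{a'..<b'}. (F ^^ (h * j + n)) y = y + 1 - b'"
    by blast
  moreover have "b' - a' \<le> ?l"
    by (auto simp: b'_def a'_def algebra_simps)
  moreover have "0 \<le> a'" "a' \<le> x" "x < b'" "b' \<le> 1"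
    using ab j \<open>0 \<le> j * ?l\<close> by (auto simp: a'_def b'_def)
  ultimately show ?case
    by blast
qed

lemma orbit_enters:
  assumes "x \<in> {0..<1}" "0 < e"
  shows "\<exists>n. (F ^^ n) x \<in> {1 - e..<1}"
proof -
  obtain i where "L i < e"
    using L_small[OF assms(2)] by blast
  moreover obtain a b n where "a \<le> x" "x < b" "b - a \<le> L i"
    "\<forall>y\<in>{a..<b}. (F ^^ n) y = y + 1 - b"
    using renormalisation[OF assms(1), of i] by blast
  ultimately show ?thesis
    by (intro exI[of _ n]) auto
qed

lemma inside_interval:
  assumes "0 \<le> u" "u < v" "v \<le> 1"
  obtains a b n where "u < a" "a < b" "b < v" "\<And>y. y \<in> {a..<b} \<Longrightarrow> (F ^^ n) y = y + 1 - b"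
proof -
  obtain i where i: "L i < (v - u) / 2"
    using L_small[of "(v - u) / 2"] assms by auto
  have "(u + v) / 2 \<in> {0..<1}"
    using assms by auto
  from renormalisation[OF this, of i] obtain a b n
    where "a \<le> (u + v) / 2" "(u + v) / 2 < b" "b - a \<le> L i"
      and n: "\<forall>y\<in>{a..<b}. (F ^^ n) y = y + 1 - b"
    by (elim exE conjE) (rule that)
  then have "u < a" "a < b" "b < v"
    using i by (simp_all add: field_simps)
  then show ?thesis
    using n by (intro that[of a b n]) auto
qed

text \<open>A periodic orbit is finite, hence bounded away from 1, whereas every orbit enters each
  left neighbourhood of 1.\<close>

lemma no_periodic:
  assumes "x \<in> {0..<1}" "n > 0"
  shows "(F ^^ n) x \<noteq> x"
proof
  assume per: "(F ^^ n) x = x"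
  let ?O = "(\<lambda>m. (F ^^ m) x) ` {..<n}"
  have O: "(F ^^ m) x \<in> ?O" for m
  proof -
    have "(F ^^ (n * j)) x = x" for j
      by (induction j) (use per in \<open>simp_all add: funpow_add\<close>)
    then have "(F ^^ (m mod n + n * (m div n))) x = (F ^^ (m mod n)) x"
      by (simp only: funpow_add o_apply)
    then have "(F ^^ m) x = (F ^^ (m mod n)) x"
      by simp
    then show ?thesis
      using assms(2) by auto
  qed
  have fin: "finite ?O" "?O \<noteq> {}"
    using assms(2) by auto
  have "Max ?O < 1"
    using F_pow_unit[OF assms(1)] by (subst Max_less_iff[OF fin]) auto
  then obtain m where "(F ^^ m) x \<in> {1 - (1 - Max ?O) / 2..<1}"
    using orbit_enters[OF assms(1), of "(1 - Max ?O) / 2"] by auto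
  then have "(F ^^ m) x > Max ?O"
    using \<open>Max ?O < 1\<close> by (auto simp: field_simps)
  then show False
    using Max_ge[OF fin(1) O[of m]] by simp
qed

text \<open>Some \<open>[a, b)\<close> inside the target is translated onto a left neighbourhood of
  1. The orbit of \<open>x\<close> enters that neighbourhood, and the point of entry is pulled
  back.\<close>

lemma orbit_class_dense:
  assumes "x \<in> {0..<1}" "0 \<le> u" "u < v" "v \<le> 1"
  shows "\<exists>y\<in>{u<..<v}. \<exists>m n. (F ^^ m) y = (F ^^ n) x"
proof -
  obtain a b n where ab: "u < a" "a < b" "b < v" "\<And>y. y \<in> {a..<b} \<Longrightarrow> (F ^^ n) y = y + 1 - b"
    using inside_interval[OF assms(2-4)] by blast
  obtain m where m: "(F ^^ m) x \<in> {1 - (b - a)..<1}"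
    using orbit_enters[OF assms(1), of "b - a"] ab by auto
  let ?y = "(F ^^ m) x - (1 - b)"
  have "?y \<in> {a..<b}"
    using m by auto
  with ab(4)[OF this] ab show ?thesis
    by (intro bexI[of _ ?y] exI[of _ n] exI[of _ m]) auto
qed

subsection \<open>The attractor\<close>

definition Om :: "real set" where
  "Om = (\<Inter>n. (F ^^ n) ` {0..<1})"

lemma Om_subset: "Om \<subseteq> {0..<1}"
  unfolding Om_def using INT_lower[of 0 UNIV "\<lambda>n. (F ^^ n) ` {0..<1}"] by simp

lemma decreasing: "m \<le> n \<Longrightarrow> (F ^^ n) ` {0..<1} \<subseteq> (F ^^ m) ` {0..<1}"
proof
  fix y
  assume "m \<le> n" "y \<in> (F ^^ n) ` {0..<1}"
  then obtain x where "x \<in> {0..<1}" "y = (F ^^ (m + (n - m))) x"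
    by auto
  then show "y \<in> (F ^^ m) ` {0..<1}"
    using F_pow_unit[of x "n - m"] by (auto simp: funpow_add simp del: le_add_diff_inverse)
qed

lemma F_fibre_subset: "{x. F x = y} \<subseteq> {y - L 1, y - L 2, y - L 2 + L 0}"
  by (auto simp: f_def eval_nat_numeral split: if_splits)

lemma finite_F_fibre: "finite {x. F x = y}"
  using F_fibre_subset by (rule finite_subset) simp

lemma finite_F_pow_fibre: "finite {x. (F ^^ n) x = y}"
proof (induction n arbitrary: y)
  case (Suc n)
  have "{x. (F ^^ Suc n) x = y} = (\<Union>z\<in>{z. F z = y}. {x. (F ^^ n) x = z})"
    by auto
  then show ?case
    using Suc finite_F_fibre by simp
qed (simp add: Collect_conv_if)

lemma F_Om: "x \<in> Om \<Longrightarrow> F x \<in> Om"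
proof -
  assume x: "x \<in> Om"
  have "F x \<in> (F ^^ n) ` {0..<1}" for n
  proof -
    have "x \<in> (F ^^ n) ` {0..<1}"
      using x by (auto simp: Om_def)
    then obtain z where "z \<in> {0..<1}" "x = (F ^^ n) z"
      by blast
    then have "F x \<in> (F ^^ Suc n) ` {0..<1}"
      by simp
    then show ?thesis
      using decreasing[of n "Suc n"] by auto
  qed
  then show ?thesis
    by (auto simp: Om_def)
qed

lemma F_pow_Om: "x \<in> Om \<Longrightarrow> (F ^^ n) x \<in> Om"
  by (induction n) (use F_Om in simp_all)

text \<open>Compactness of a finite fibre: for each \<open>n\<close> some preimage lies in the
  \<open>n\<close>-th image, one preimage serves infinitely many \<open>n\<close>, and the images
  decrease.\<close>

lemma Om_preimage:
  assumes "y \<in> Om"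
  shows "\<exists>x\<in>Om. F x = y"
proof -
  let ?P = "{x \<in> {0..<1}. F x = y}"
  have fin: "finite ?P"
    by (rule finite_subset[OF _ finite_F_fibre[of y]]) auto
  have ex: "\<exists>x\<in>?P. x \<in> (F ^^ n) ` {0..<1}" for n
  proof -
    have "y \<in> (F ^^ Suc n) ` {0..<1}"
      using assms unfolding Om_def by (rule INT_D) simp
    then obtain z where "z \<in> {0..<1}" "y = F ((F ^^ n) z)"
      by auto
    then show ?thesis
      using F_pow_unit[of z n] by (intro bexI[of _ "(F ^^ n) z"]) auto
  qed
  then obtain g where g: "\<And>n. g n \<in> ?P \<and> g n \<in> (F ^^ n) ` {0..<1}"
    by metis
  then have "finite (range g)"
    using fin by (metis (no_types, lifting) finite_subset image_subsetI)
  then obtain x where inf: "infinite (g -` {x})"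
    using inf_img_fin_dom[of g UNIV] by auto
  then have "x \<in> ?P"
    using g by (metis (no_types, lifting) finite.emptyI subsetI subset_empty vimage_singleton_eq)
  moreover have "x \<in> (F ^^ n) ` {0..<1}" for n
  proof -
    obtain m where "m \<ge> n" "g m = x"
      using inf by (auto simp: infinite_nat_iff_unbounded_le)
    then show ?thesis
      using g[of m] decreasing[of n m] by auto
  qed
  ultimately show ?thesis
    by (auto simp: Om_def)
qed

text \<open>Each step back inside \<open>A i\<close> lowers the point by \<open>L (Suc i)\<close>,
  so the chain of preimages leaves \<open>A i\<close> after finitely many steps; it can only leave
  to \<open>C i\<close>, because the image of \<open>B i\<close> lies to the right of
  \<open>A i\<close>.\<close>

lemma Om_induced_chain:
  assumes surj: "\<And>y. y \<in> Om \<inter> I i \<Longrightarrow> \<exists>z\<in>Om \<inter> I i. f i z = y"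
    and z: "z \<in> Om" "z \<in> A i"
  shows "\<exists>c\<in>Om \<inter> C i. \<exists>j. z = f i c + real j * L (Suc i)"
proof -
  \<comment> \<open>A bound for the number of backward steps; the induction runs over this
    bound.\<close>
  define m where "m = nat \<lfloor>(z - (1 - L i)) / L (Suc i)\<rfloor>"
  have "z \<in> Om \<Longrightarrow> z \<in> A i \<Longrightarrow> z < 1 - L i + (real m + 1) * L (Suc i) \<Longrightarrow> ?thesis" for m
  proof (induction m arbitrary: z)
    case (0 z)
    then obtain y where y: "y \<in> Om \<inter> I i" "f i y = z"
      using surj[of z] I_split[of i] by auto
    have "y \<notin> A i"
      using 0 y f_A[of y i] by (auto simp: A_def)
    moreover have "y \<notin> B i"
      using 0 y f_B[of y i] L_pos[of "Suc (Suc i)"] by (auto simp: A_def B_def)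
    ultimately have "y \<in> C i"
      using y I_split[of i] by auto
    then show ?case
      using y by (intro bexI[of _ y] exI[of _ 0]) auto
  next
    case (Suc m z)
    then obtain y where y: "y \<in> Om \<inter> I i" "f i y = z"
      using surj[of z] I_split[of i] by auto
    show ?case
    proof (cases "y \<in> A i")
      case True
      then have "z = y + L (Suc i)"
        using y f_A by auto
      then have "y < 1 - L i + (real m + 1) * L (Suc i)"
        using Suc.prems by (simp add: algebra_simps)
      then obtain c j where "c \<in> Om \<inter> C i" "y = f i c + real j * L (Suc i)"
        using Suc.IH[of y] y True by auto
      then show ?thesis
        using \<open>z = y + L (Suc i)\<close>
        by (intro bexI[of _ c] exI[of _ "Suc j"]) (auto simp: algebra_simps)
    next
      case False
      moreover have "y \<notin> B i"
        using Suc.prems y f_B[of y i] L_pos[of "Suc (Suc i)"] by (auto simp: A_def B_def)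
      ultimately have "y \<in> C i"
        using y I_split[of i] by auto
      then show ?thesis
        using y by (intro bexI[of _ y] exI[of _ 0]) auto
    qed
  qed
  moreover have "z < 1 - L i + (real m + 1) * L (Suc i)"
  proof -
    have "(z - (1 - L i)) / L (Suc i) \<ge> 0"
      using z L_pos[of "Suc i"] by (auto simp: A_def)
    then have "(z - (1 - L i)) / L (Suc i) < real m + 1"
      unfolding m_def by linarith
    then show ?thesis
      using L_pos[of "Suc i"] by (simp add: field_simps)
  qed
  ultimately show ?thesis
    using z by blast
qed

lemma multiple_in_short_interval:
  fixes l y :: real
  assumes "y \<in> {c..<c + l}" "y + (real p - real q) * l \<in> {c..<c + l}" "l > 0"
  shows "p = q"
proof -
  have "(real p - real q) * l < l" "- ((real p - real q) * l) < l"
    using assms(1,2) unfolding atLeastLessThan_iff by linarith+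
  then have "\<bar>(real p - real q) * l\<bar> < l"
    by (simp only: abs_less_iff)
  then have "\<bar>real p - real q\<bar> * l < 1 * l"
    using assms(3) by (simp only: abs_mult abs_of_pos mult_1)
  then have "\<bar>real p - real q\<bar> < 1"
    using assms(3) by (simp only: mult_less_cancel_right_pos)
  then show ?thesis
    by linarith
qed

text \<open>A backward chain through \<open>A i\<close> starts at some \<open>c\<close> in
  \<open>C i\<close>. Its end \<open>y\<close> and \<open>f (Suc i) c\<close> differ by a multiple
  of \<open>L (Suc i)\<close> and both lie in \<open>I (Suc i)\<close>, whose length is
  \<open>L (Suc i)\<close>, so they coincide.\<close>

lemma Om_induced_surj:
  "y \<in> Om \<inter> I i \<Longrightarrow> \<exists>z\<in>Om \<inter> I i. f i z = y"
proof (induction i arbitrary: y)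
  case 0
  then show ?case
    using Om_preimage[of y] Om_subset by (auto simp: I_0)
next
  case (Suc i)
  have "y \<in> Om \<inter> I i"
    using Suc.prems I_antimono[of i "Suc i"] by auto
  then obtain z where z: "z \<in> Om \<inter> I i" "f i z = y"
    using Suc.IH by blast
  have *: ?case if c: "c \<in> Om \<inter> C i" "y = f i c + real j * L (Suc i)" for c j
  proof -
    obtain m where m: "f (Suc i) c = f i c + real m * L (Suc i)"
      using f_Suc_C c by blast
    have "c \<in> I (Suc i)"
      using c I_Suc by auto
    then have fc: "f (Suc i) c \<in> I (Suc i)"
      by (rule f_I)
    have "y + (real m - real j) * L (Suc i) = f (Suc i) c"
      using c m by (simp add: algebra_simps)
    then have "m = j"
      using fc Suc.prems L_pos[of "Suc i"]
      by (intro multiple_in_short_interval[where y = y and c = "1 - L (Suc i)" and l = "L (Suc i)"])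
        (auto simp: I_def)
    then have "f (Suc i) c = y"
      using m c by simp
    then show ?thesis
      using c \<open>c \<in> I (Suc i)\<close> by auto
  qed
  consider "z \<in> A i" | "z \<in> B i" | "z \<in> C i"
    using z I_split[of i] by auto
  then show ?case
  proof cases
    case 1
    then obtain c j where "c \<in> Om \<inter> C i" "z = f i c + real j * L (Suc i)"
      using Om_induced_chain[OF Suc.IH, of z] z by auto
    then show ?thesis
      using z f_A[OF 1] by (intro *[of c "Suc j"]) (auto simp: algebra_simps)
  next
    case 2
    then show ?thesis
      using z f_B[OF 2] f_A[of z "Suc i"] A_Suc[of i] I_Suc[of i] by auto
  next
    case 3
    then show ?thesis
      using z by (intro *[of z 0]) auto
  qed
qed

text \<open>The image of \<open>C i\<close> under \<open>f i\<close> ends where this interval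
  begins, the image of \<open>A i\<close> begins where it ends, and
  \<open>2 * L (Suc i) \<le> L i\<close> keeps the image of \<open>B i\<close> to the right of
  it.\<close>

lemma gap_disjoint_Om:
  assumes "k i = 2" "y \<in> {1 - L i + L (Suc (Suc i))..<1 - L i + L (Suc i)}"
  shows "y \<notin> Om"
proof
  assume "y \<in> Om"
  have "2 * L (Suc i) \<le> L i"
    using L_rec[of i] assms(1) L_Suc_less[of "Suc (Suc i)"] by simp
  then have "y \<in> I i"
    using assms(2) L_pos[of "Suc (Suc i)"] L_pos[of "Suc i"] by (auto simp: I_def)
  then obtain z where "z \<in> I i" "f i z = y"
    using Om_induced_surj[of y i] \<open>y \<in> Om\<close> by auto
  moreover have "f i z \<notin> {1 - L i + L (Suc (Suc i))..<1 - L i + L (Suc i)}" if "z \<in> I i"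
    using that \<open>2 * L (Suc i) \<le> L i\<close> L_pos[of "Suc (Suc i)"] by (auto simp: f_def I_def)
  ultimately show False
    using assms(2) by simp
qed

text \<open>A gap close to 1 is pulled back by a translation into the given interval; since
  \<open>Om\<close> is forward invariant, the copy avoids it as well.\<close>

lemma Om_nowhere_dense:
  assumes "0 \<le> u" "u < v" "v \<le> 1"
  shows "\<exists>a b. a < b \<and> {a<..<b} \<subseteq> {u<..<v} - Om"
proof -
  obtain a b n where ab: "u < a" "a < b" "b < v" "\<And>y. y \<in> {a..<b} \<Longrightarrow> (F ^^ n) y = y + 1 - b"
    using inside_interval[OF assms] by blast
  obtain i where "\<And>j. j \<ge> i \<Longrightarrow> L j < b - a"
    using L_small[of "b - a"] ab by auto
  then obtain j where j: "L j < b - a" "k j = 2"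
    using k_infinite by blast
  define p where "p = 1 - L j + L (Suc (Suc j))"
  define q where "q = 1 - L j + L (Suc j)"
  have pq: "1 - (b - a) < p" "p < q" "q < 1"
    using j L_Suc_less[of "Suc j"] L_Suc_less[of j] L_pos[of "Suc (Suc j)"]
    by (auto simp: p_def q_def)
  have "{p - (1 - b)<..<q - (1 - b)} \<subseteq> {u<..<v} - Om"
  proof
    fix y
    assume y: "y \<in> {p - (1 - b)<..<q - (1 - b)}"
    then have "y \<in> {a..<b}"
      using pq by auto
    then have "(F ^^ n) y \<in> {p..<q}"
      using ab(4)[of y] y by auto
    then have "(F ^^ n) y \<notin> Om"
      using gap_disjoint_Om[OF j(2)] by (simp add: p_def q_def)
    then have "y \<notin> Om"
      using F_pow_Om by blast
    then show "y \<in> {u<..<v} - Om"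
      using \<open>y \<in> {a..<b}\<close> ab by auto
  qed
  with pq show ?thesis
    by (intro exI[of _ "p - (1 - b)"] exI[of _ "q - (1 - b)"]) auto
qed

end

context interval_translation_map
begin

subsection \<open>Measure of the attractor\<close>

lemma F_image_lebesgue:
  assumes "S \<in> sets lebesgue"
  shows "F ` S \<in> sets lebesgue"
proof -
  have "F ` S = (+) (L 1) ` (S \<inter> {..<1 - L 1}) \<union> (+) (L 2) ` (S \<inter> ({..<1 - L 2} - {..<1 - L 1}))
    \<union> (+) (L 2 - L 0) ` (S - {..<1 - L 2} - {..<1 - L 1})"
    by (force simp: f_def eval_nat_numeral image_iff)
  moreover have "{..<c} \<in> sets lebesgue" for c :: real
    by simp
  ultimately show ?thesis
    using assms by (auto intro!: sets.Un lebesgue_sets_translation sets.Int sets.Diff)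
qed

lemma F_pow_image_lebesgue:
  "S \<in> sets lebesgue \<Longrightarrow> (F ^^ n) ` S \<in> sets lebesgue"
proof (induction n)
  case (Suc n)
  then have "F ` (F ^^ n) ` S \<in> sets lebesgue"
    by (intro F_image_lebesgue)
  then show ?case
    by (simp add: image_comp)
qed simp

lemma Om_lmeasurable: "Om \<in> lmeasurable"
proof -
  have "Om \<in> sets lebesgue"
    unfolding Om_def by (intro sets.countable_INT'' F_pow_image_lebesgue) auto
  moreover have "bounded Om"
    by (rule bounded_subset[of "{0..1}"]) (use Om_subset in auto)
  ultimately show ?thesis
    by (rule bounded_set_imp_lmeasurable[rotated])
qed

text \<open>A finite-level substitute for \<open>Om\<close>: it is forward invariant, and its
  complement can be estimated by descending from level \<open>J\<close>.\<close>

definition E :: "nat \<Rightarrow> real set" where "E J = (\<Union>n. (F ^^ n) ` I J)"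

lemma I_subset_E: "I J \<subseteq> E J"
proof -
  have "(F ^^ 0) ` I J \<subseteq> E J"
    unfolding E_def by (rule UN_upper) simp
  then show ?thesis by simp
qed

lemma F_E: "x \<in> E J \<Longrightarrow> F x \<in> E J"
proof -
  assume "x \<in> E J"
  then obtain n z where "z \<in> I J" "x = (F ^^ n) z"
    by (auto simp: E_def)
  then have "F x = (F ^^ Suc n) z" by simp
  then show ?thesis
    using \<open>z \<in> I J\<close> unfolding E_def by blast
qed

lemma F_pow_E: "x \<in> E J \<Longrightarrow> (F ^^ n) x \<in> E J"
  by (induction n) (use F_E in simp_all)

lemma f_E: "x \<in> E J \<Longrightarrow> x \<in> I i \<Longrightarrow> f i x \<in> E J"
  using f_iterate F_pow_E by metis

lemma E_lebesgue: "E J \<in> sets lebesgue"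
proof -
  have "(F ^^ n) ` I J \<in> sets lebesgue" for n
    unfolding I_def by (intro F_pow_image_lebesgue) simp
  then show ?thesis
    unfolding E_def by (intro sets.countable_UN) auto
qed

lemma E_antimono: "i \<le> j \<Longrightarrow> E j \<subseteq> E i"
  using I_antimono[of i j] by (auto simp: E_def)

text \<open>Only finitely many points reach \<open>y\<close> in fewer than \<open>N\<close> steps. A
  short enough \<open>I J\<close> contains none of them, so the point of \<open>I J\<close> that
  reaches \<open>y\<close> needs at least \<open>N\<close> steps.\<close>

lemma Int_E_subset_Om: "(\<Inter>J. E J) \<subseteq> Om"
proof
  fix y
  assume y: "y \<in> (\<Inter>J. E J)"
  have "y \<in> (F ^^ N) ` {0..<1}" for N
  proof -
    let ?S = "\<Union>n<N. {x. (F ^^ n) x = y} \<inter> {0..<1}"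
    have fin: "finite ?S"
      using finite_F_pow_fibre by auto
    obtain J where J: "I J \<inter> ?S = {}"
    proof (cases "?S = {}")
      case False
      have "Max ?S < 1"
        using fin False by (subst Max_less_iff) auto
      then obtain J where "L J < 1 - Max ?S"
        using L_small[of "1 - Max ?S"] by auto
      moreover have "x \<le> Max ?S" if "x \<in> ?S" for x
        using that fin by (rule Max_ge[rotated])
      ultimately have "I J \<inter> ?S = {}"
        unfolding I_def by fastforce
      then show thesis
        by (rule that)
    qed (use that in blast)
    obtain n z where nz: "z \<in> I J" "y = (F ^^ n) z"
      using y unfolding E_def by blast
    have z: "z \<in> {0..<1}"
      using nz I_antimono[of 0 J] by (auto simp: I_0)
    have "\<not> n < N"
    proof
      assume "n < N"
      then have "z \<in> ?S"
        using nz z by blast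
      then show False
        using J nz by blast
    qed
    then have "(F ^^ n) ` {0..<1} \<subseteq> (F ^^ N) ` {0..<1}"
      by (intro decreasing) simp
    then show ?thesis
      using nz z by blast
  qed
  then show "y \<in> Om"
    by (simp add: Om_def)
qed

lemma diff_lmeasurable: "T \<in> sets lebesgue \<Longrightarrow> {a..<b::real} - T \<in> lmeasurable"
proof (rule bounded_set_imp_lmeasurable)
  show "bounded ({a..<b} - T)"
    by (rule bounded_subset[of "{a..b}"]) auto
qed auto

lemma lmeasurable_Ico: "{a..<b::real} \<in> lmeasurable"
  using diff_lmeasurable[of "{}" a b] by simp

lemma ABC_diff_lmeasurable:
  "A i - E J \<in> lmeasurable" "B i - E J \<in> lmeasurable" "C i - E J \<in> lmeasurable"
  unfolding A_def B_def C_def by (intro diff_lmeasurable E_lebesgue)+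

lemma lmeasurable_cover:
  fixes S T U V :: "real set"
  assumes "S \<subseteq> T \<union> (+) u ` U \<union> (+) v ` V" "S \<in> lmeasurable" "T \<in> lmeasurable" "U \<in> lmeasurable" "V \<in> lmeasurable"
  shows "measure lebesgue S \<le> measure lebesgue T + measure lebesgue U + measure lebesgue V"
proof -
  have UV: "(+) u ` U \<in> lmeasurable" "(+) v ` V \<in> lmeasurable"
    using assms by (auto intro: measurable_translation)
  have "measure lebesgue S \<le> measure lebesgue (T \<union> (+) u ` U \<union> (+) v ` V)"
    using assms UV by (intro measure_mono_fmeasurable fmeasurable.Un) auto
  also have "\<dots> \<le> measure lebesgue (T \<union> (+) u ` U) + measure lebesgue ((+) v ` V)"
    using assms UV by (intro measure_Un_le) (auto dest: fmeasurableD)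
  also have "measure lebesgue (T \<union> (+) u ` U) \<le> measure lebesgue T + measure lebesgue ((+) u ` U)"
    using assms UV by (intro measure_Un_le) (auto dest: fmeasurableD)
  finally show ?thesis
    by (simp add: measure_translation)
qed

text \<open>For \<open>k i = 1\<close> the image of \<open>B (Suc i)\<close> under
  \<open>f i\<close> is exactly \<open>A i\<close>. Since \<open>f i\<close> preserves
  \<open>E J\<close>, a point missing from \<open>E J\<close> has only missing preimages.\<close>

lemma A_diff_E_subset_1:
  assumes "k i = 1"
  shows "A i - E J \<subseteq> (+) (L (Suc (Suc i)) - L i) ` (B (Suc i) - E J)"
proof
  fix x
  assume x: "x \<in> A i - E J"
  let ?c = "x - (L (Suc (Suc i)) - L i)"
  have c: "?c \<in> B (Suc i)"
    using x L_rec[of i] assms by (auto simp: A_def B_def)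
  then have "?c \<in> C i"
    using C_split[of i] by simp
  then have "f i ?c = x" "?c \<in> I i"
    using f_C[of ?c i] I_split[of i] by auto
  then have "?c \<notin> E J"
    using f_E[of ?c J i] x by auto
  then show "x \<in> (+) (L (Suc (Suc i)) - L i) ` (B (Suc i) - E J)"
    using c by (intro image_eqI[of _ _ ?c]) auto
qed

text \<open>From left to right, \<open>A i\<close> consists of the image of \<open>C i\<close>, the
  gap, and the second image of \<open>B (Suc i)\<close>.\<close>

lemma A_diff_E_subset_2:
  assumes "k i = 2"
  shows "A i - E J \<subseteq> {1 - L i + L (Suc (Suc i))..<1 - L i + L (Suc i)}
    \<union> (+) (L (Suc (Suc i)) - L i) ` (C i - E J)
    \<union> (+) (L (Suc (Suc i)) - L i + L (Suc i)) ` (B (Suc i) - E J)"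
proof
  fix x
  assume x: "x \<in> A i - E J"
  have rec: "L i = 2 * L (Suc i) + L (Suc (Suc i)) - L (Suc (Suc (Suc i)))"
    using L_rec[of i] assms by simp
  consider "x < 1 - L i + L (Suc (Suc i))" | "x \<in> {1 - L i + L (Suc (Suc i))..<1 - L i + L (Suc i)}"
    | "1 - L i + L (Suc i) \<le> x"
    by fastforce
  then show "x \<in> {1 - L i + L (Suc (Suc i))..<1 - L i + L (Suc i)}
    \<union> (+) (L (Suc (Suc i)) - L i) ` (C i - E J)
    \<union> (+) (L (Suc (Suc i)) - L i + L (Suc i)) ` (B (Suc i) - E J)"
  proof cases
    case 1
    let ?c = "x - (L (Suc (Suc i)) - L i)"
    have c: "?c \<in> C i"
      using x 1 by (auto simp: A_def C_def)
    then have "f i ?c = x" "?c \<in> I i"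
      using f_C[of ?c i] I_split[of i] by auto
    then have "?c \<notin> E J"
      using f_E[of ?c J i] x by auto
    then have "x \<in> (+) (L (Suc (Suc i)) - L i) ` (C i - E J)"
      using c by (intro image_eqI[of _ _ ?c]) auto
    then show ?thesis by blast
  next
    case 3
    let ?c = "x - (L (Suc (Suc i)) - L i + L (Suc i))"
    have c: "?c \<in> B (Suc i)"
      using x 3 rec by (auto simp: A_def B_def)
    then have cC: "?c \<in> C i"
      using C_split[of i] by simp
    then have fc: "f i ?c = x - L (Suc i)" "?c \<in> I i"
      using f_C[of ?c i] I_split[of i] by auto
    have "x - L (Suc i) \<in> A i"
      using x 3 L_pos[of "Suc i"] by (auto simp: A_def)
    then have "f i (f i ?c) = x" "f i ?c \<in> I i"
      using fc f_A[of "x - L (Suc i)" i] I_split[of i] by auto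
    then have "?c \<notin> E J"
      using f_E[of ?c J i] f_E[of "f i ?c" J i] fc x by auto
    then have "x \<in> (+) (L (Suc (Suc i)) - L i + L (Suc i)) ` (B (Suc i) - E J)"
      using c by (intro image_eqI[of _ _ ?c]) auto
    then show ?thesis by blast
  qed blast
qed

text \<open>Descending induction from level \<open>J\<close>, where nothing is missing. Every piece
  inherits the missing proportion of the next level; only a step with \<open>k i = 2\<close>
  increases it, by its gap.\<close>

lemma measure_diff_E:
  "i \<le> J \<Longrightarrow> measure lebesgue (A i - E J) \<le> sum loss {i..<J} * (L i - L (Suc i)) \<and>
    measure lebesgue (B i - E J) \<le> sum loss {i..<J} * (L (Suc i) - L (Suc (Suc i))) \<and>
    measure lebesgue (C i - E J) \<le> sum loss {i..<J} * L (Suc (Suc i))"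
proof (induction rule: inc_induct)
  case base
  have empty: "A J - E J = {}" "B J - E J = {}" "C J - E J = {}"
    using I_subset_E[of J] I_split[of J] by auto
  show ?case
    unfolding empty by simp
next
  case (step i)
  let ?d' = "sum loss {Suc i..<J}"
  let ?d = "sum loss {i..<J}"
  have d: "?d = loss i + ?d'"
    using step.hyps by (simp add: sum.atLeast_Suc_lessThan)
  have d': "?d' \<ge> 0"
    by (intro sum_nonneg) (simp add: loss_nonneg)
  have d_le: "?d' * t \<le> ?d * t" if "t \<ge> 0" for t
    using that loss_nonneg[of i] by (intro mult_right_mono) (auto simp: d)
  note pos = L_Suc_less[of i] L_Suc_less[of "Suc i"] L_Suc_less[of "Suc (Suc i)"] L_pos[of "Suc (Suc (Suc i))"]
  have B': "measure lebesgue (B (Suc i) - E J) \<le> ?d' * (L (Suc (Suc i)) - L (Suc (Suc (Suc i))))"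
    and C': "measure lebesgue (C (Suc i) - E J) \<le> ?d' * L (Suc (Suc (Suc i)))"
    using step.IH by simp_all
  have "measure lebesgue (B i - E J) \<le> ?d' * (L (Suc i) - L (Suc (Suc i)))"
    using step.IH by (simp add: A_Suc)
  also have "\<dots> \<le> ?d * (L (Suc i) - L (Suc (Suc i)))"
    by (rule d_le) (use pos in simp)
  finally have 1: "measure lebesgue (B i - E J) \<le> ?d * (L (Suc i) - L (Suc (Suc i)))" .
  have "C i - E J = (B (Suc i) - E J) \<union> (C (Suc i) - E J)"
    using C_split[of i] by blast
  then have "measure lebesgue (C i - E J) \<le> measure lebesgue (B (Suc i) - E J) + measure lebesgue (C (Suc i) - E J)"
    by (simp only:) (intro measure_Un_le fmeasurableD ABC_diff_lmeasurable)
  also have "\<dots> \<le> ?d' * L (Suc (Suc i))"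
    using B' C' by (simp add: algebra_simps)
  finally have C_d': "measure lebesgue (C i - E J) \<le> ?d' * L (Suc (Suc i))" .
  also have "\<dots> \<le> ?d * L (Suc (Suc i))"
    by (rule d_le) (use pos in simp)
  finally have 2: "measure lebesgue (C i - E J) \<le> ?d * L (Suc (Suc i))" .
  have 3: "measure lebesgue (A i - E J) \<le> ?d * (L i - L (Suc i))"
  proof (cases "k i = 1")
    case True
    have "measure lebesgue (A i - E J) \<le> measure lebesgue ({} :: real set)
        + measure lebesgue (B (Suc i) - E J) + measure lebesgue ({} :: real set)"
      by (rule lmeasurable_cover[where u = "L (Suc (Suc i)) - L i" and v = 0])
        (use A_diff_E_subset_1[OF True, of J] in \<open>auto simp: ABC_diff_lmeasurable\<close>)
    also have "\<dots> \<le> ?d' * (L (Suc (Suc i)) - L (Suc (Suc (Suc i))))"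
      using B' by simp
    also have "\<dots> = ?d' * (L i - L (Suc i))"
      using L_rec[of i] True by simp
    also have "\<dots> \<le> ?d * (L i - L (Suc i))"
      by (rule d_le) (use pos in simp)
    finally show ?thesis .
  next
    case False
    then have k: "k i = 2"
      using k_cases[of i] by simp
    have rec: "L i = 2 * L (Suc i) + L (Suc (Suc i)) - L (Suc (Suc (Suc i)))"
      using L_rec[of i] k by simp
    have sum1: "sum loss {..<J} = sum loss {..<i} + ?d"
      using step.hyps by (subst sum.atLeastLessThan_concat[symmetric, of 0 i J, unfolded atLeast0LessThan]) auto
    have "sum loss {..<i} \<ge> 0"
      by (intro sum_nonneg) (simp add: loss_nonneg)
    then have "?d \<le> 1"
      using sum1 loss_sum[of J] by linarith
    then have "?d' \<le> 1"
      using d loss_nonneg[of i] by linarith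
    let ?g = "L (Suc i) - L (Suc (Suc i))"
    have "measure lebesgue (A i - E J) \<le> measure lebesgue {1 - L i + L (Suc (Suc i))..<1 - L i + L (Suc i)}
        + measure lebesgue (C i - E J) + measure lebesgue (B (Suc i) - E J)"
      by (rule lmeasurable_cover[OF A_diff_E_subset_2[OF k]]) (simp_all add: ABC_diff_lmeasurable lmeasurable_Ico)
    also have "\<dots> \<le> ?g + ?d' * L (Suc (Suc i)) + ?d' * (L (Suc (Suc i)) - L (Suc (Suc (Suc i))))"
      using C_d' B' pos by (simp add: measure_lborel_Ico)
    \<comment> \<open>The gap and the two images tile \<open>A i\<close>, so the images have total
      length \<open>L i - L (Suc i) - ?g\<close>.\<close>
    also have "\<dots> = ?g + ?d' * (L i - L (Suc i) - ?g)"
      unfolding rec by (simp add: algebra_simps)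
    also have "\<dots> \<le> loss i * L (Suc i) + ?d' * (L i - L (Suc i))"
      using loss[OF k] d' pos by (intro add_mono mult_left_mono) auto
    also have "loss i * L (Suc i) \<le> loss i * (L i - L (Suc i))"
      using pos loss_nonneg[of i] by (intro mult_left_mono) (auto simp: rec)
    finally show ?thesis
      by (simp add: d algebra_simps)
  qed
  show ?case
    using 1 2 3 by blast
qed

lemma measure_I_diff_E: "measure lebesgue (I i - E J) \<le> L i / 6"
proof (cases "i \<le> J")
  case True
  let ?d = "sum loss {i..<J}"
  have "sum loss {..<J} = sum loss {..<i} + ?d"
    using True by (subst sum.atLeastLessThan_concat[symmetric, of 0 i J, unfolded atLeast0LessThan]) auto
  moreover have "sum loss {..<i} \<ge> 0"
    by (intro sum_nonneg) (simp add: loss_nonneg)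
  ultimately have "?d \<le> 1/6"
    using loss_sum[of J] by linarith
  have eq: "I i - E J = (A i - E J) \<union> (B i - E J) \<union> (C i - E J)"
    using I_split[of i] by blast
  have "measure lebesgue (I i - E J) \<le> measure lebesgue ((A i - E J) \<union> (B i - E J)) + measure lebesgue (C i - E J)"
    unfolding eq by (intro measure_Un_le sets.Un fmeasurableD ABC_diff_lmeasurable)
  also have "measure lebesgue ((A i - E J) \<union> (B i - E J)) \<le> measure lebesgue (A i - E J) + measure lebesgue (B i - E J)"
    by (intro measure_Un_le sets.Un fmeasurableD ABC_diff_lmeasurable)
  also have "measure lebesgue (A i - E J) + measure lebesgue (B i - E J) + measure lebesgue (C i - E J) \<le> ?d * L i"
    using measure_diff_E[OF True] by (simp add: algebra_simps)
  also have "\<dots> \<le> 1/6 * L i"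
    using \<open>?d \<le> 1/6\<close> L_pos[of i] by (intro mult_right_mono) auto
  finally show ?thesis by simp
next
  case False
  then have empty: "I i - E J = {}"
    using I_antimono[of J i] I_subset_E[of J] by auto
  show ?thesis
    unfolding empty using L_pos[of i] by (simp add: less_imp_le)
qed

lemma measure_I_diff_Om: "measure lebesgue (I i - Om) \<le> L i / 6"
proof -
  let ?U = "\<Union>J. I i - E J"
  have U_lm: "?U \<in> lmeasurable"
  proof (rule bounded_set_imp_lmeasurable)
    show "bounded ?U"
      by (rule bounded_subset[of "{1 - L i..1}"]) (auto simp: I_def)
    show "?U \<in> sets lebesgue"
      using E_lebesgue by (intro sets.countable_UN) (auto simp: I_def)
  qed
  have "(\<lambda>J. measure lebesgue (I i - E J)) \<longlonglongrightarrow> measure lebesgue ?U"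
  proof (rule Lim_measure_incseq)
    show "range (\<lambda>J. I i - E J) \<subseteq> sets lebesgue"
      using E_lebesgue by (auto simp: I_def)
    show "incseq (\<lambda>J. I i - E J)"
      using E_antimono by (auto simp: incseq_def)
    show "emeasure lebesgue ?U \<noteq> \<infinity>"
      using fmeasurableD2[OF U_lm] by simp
  qed
  then have U: "measure lebesgue ?U \<le> L i / 6"
    by (rule LIMSEQ_le_const2) (intro exI allI impI measure_I_diff_E)
  have "I i - Om \<subseteq> ?U"
    using Int_E_subset_Om by auto
  moreover have "I i - Om \<in> lmeasurable"
    unfolding I_def using Om_lmeasurable by (intro diff_lmeasurable fmeasurableD)
  ultimately have "measure lebesgue (I i - Om) \<le> measure lebesgue ?U"
    by (intro measure_mono_fmeasurable U_lm fmeasurableD)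
  with U show ?thesis by simp
qed

text \<open>The shortest \<open>I i\<close> containing \<open>[c, 1)\<close> is at most three times
  as long, and at most a sixth of it lies outside \<open>Om\<close>.\<close>

lemma measure_tail_diff_Om:
  assumes "0 \<le> c" "c < 1"
  shows "measure lebesgue ({c..<1} - Om) \<le> (1 - c) / 2"
proof -
  have "\<exists>j. L j < 1 - c"
    using L_small[of "1 - c"] assms by auto
  define j where "j = (LEAST j. L j < 1 - c)"
  have j: "L j < 1 - c"
    unfolding j_def using \<open>\<exists>j. L j < 1 - c\<close> by (rule LeastI_ex)
  then have "j \<noteq> 0"
    using assms L_0 by (cases j) auto
  then obtain i where i: "j = Suc i"
    by (cases j) auto
  have "\<not> L i < 1 - c"
    using not_less_Least[of i "\<lambda>j. L j < 1 - c"] i unfolding j_def[symmetric] by simp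
  then have sub: "{c..<1} - Om \<subseteq> I i - Om"
    by (auto simp: I_def)
  have "measure lebesgue ({c..<1} - Om) \<le> measure lebesgue (I i - Om)"
    using sub Om_lmeasurable
    by (intro measure_mono_fmeasurable) (auto simp: I_def intro!: diff_lmeasurable dest: fmeasurableD)
  also have "\<dots> \<le> L i / 6"
    by (rule measure_I_diff_Om)
  also have "\<dots> \<le> L j / 2"
    using L_le_3[of i] by (simp add: i)
  finally show ?thesis
    using j by simp
qed

lemma measure_Om_pos: "measure lebesgue Om > 0"
proof -
  have "measure lebesgue ({0..<1} - Om) \<le> 1/2"
    using measure_tail_diff_Om[of 0] by simp
  moreover have "measure lebesgue ({0..<1::real} - Om) = measure lebesgue {0..<1::real} - measure lebesgue Om"
    using Om_subset Om_lmeasurable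
    by (intro measurable_measure_Diff) (auto simp: lmeasurable_Ico dest: fmeasurableD)
  ultimately show ?thesis
    by (simp add: measure_lborel_Ico)
qed

lemma uncountable_Om: "uncountable Om"
proof
  assume "countable Om"
  then have "Om \<in> null_sets lborel"
    by (rule countable_imp_null_set_lborel)
  then have "measure lebesgue Om = 0"
    by (intro measure_eq_0_null_sets null_sets_completionI)
  then show False
    using measure_Om_pos by simp
qed

end

section \<open>Null sets: orbits that avoid the attractor and points with two preimages in
  it\<close>

context interval_translation_map
begin

lemma mem_translation: "x \<in> (+) c ` S \<longleftrightarrow> x - c \<in> S" for x c :: real
  by (auto intro: image_eqI[of _ _ "x - c"])

lemma shift_vimage_eq: "{x. x + c \<in> S} = (+) (- c) ` S" for c :: real
  by (auto intro: image_eqI[of _ _ "_ + c"])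

lemma negligible_F_image: "negligible S \<Longrightarrow> negligible (F ` S)"
proof -
  assume "negligible S"
  moreover have "F ` S \<subseteq> (+) (L 1) ` S \<union> (+) (L 2) ` S \<union> (+) (L 2 - L 0) ` S"
    by (auto simp: f_def mem_translation eval_nat_numeral split: if_splits)
  ultimately show ?thesis
    by (metis (no_types) negligible_Un negligible_subset negligible_translation)
qed

lemma negligible_F_vimage: "negligible S \<Longrightarrow> negligible (F -` S)"
proof -
  assume "negligible S"
  then have "negligible {x. x + c \<in> S}" for c
    unfolding shift_vimage_eq by (rule negligible_translation)
  moreover have "F -` S \<subseteq> {x. x + L 1 \<in> S} \<union> {x. x + L 2 \<in> S} \<union> {x. x + (L 2 - L 0) \<in> S}"
    by (auto simp: f_def eval_nat_numeral algebra_simps split: if_splits)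
  ultimately show ?thesis
    by (metis (no_types) negligible_Un negligible_subset)
qed

text \<open>\<open>F\<close> consists of three translations, so images and preimages of null sets
  are null, and there are countably many pairs of exponents.\<close>

lemma negligible_saturation:
  assumes "negligible S"
  shows "negligible {x. \<exists>m n. (F ^^ m) x \<in> (F ^^ n) ` S}"
proof -
  have 1: "negligible ((F ^^ n) ` S)" for n
  proof (induction n)
    case (Suc n)
    have "(F ^^ Suc n) ` S = F ` (F ^^ n) ` S"
      by (simp add: image_comp)
    then show ?case
      using negligible_F_image[OF Suc] by simp
  qed (use assms in simp)
  have 2: "negligible T \<Longrightarrow> negligible ((F ^^ m) -` T)" for m T
  proof (induction m arbitrary: T)
    case (Suc m)
    have "(F ^^ Suc m) -` T = (F ^^ m) -` F -` T"
      by auto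
    then show ?case
      using Suc.IH[OF negligible_F_vimage[OF Suc.prems]] by (simp only:)
  qed simp
  have "{x. \<exists>m n. (F ^^ m) x \<in> (F ^^ n) ` S} = (\<Union>m. \<Union>n. (F ^^ m) -` (F ^^ n) ` S)"
    by auto
  then show ?thesis
    using 1 2 by (simp add: negligible_Union_nat)
qed

text \<open>A point that never enters the attractor lies in arbitrarily short intervals that some iterate
  translates onto a left neighbourhood of \<open>1\<close>, and there the attractor has density at least
  \<open>1/2\<close>. So a Vitali cover by such intervals shows that these points have measure zero.\<close>

lemma negligible_never_enters_Om:
  "negligible {x \<in> {0..<1}. \<forall>n. (F ^^ n) x \<notin> Om}"
proof -
  let ?N = "{x \<in> {0..<1}. \<forall>n. (F ^^ n) x \<notin> Om}"
  define good where "good = {(a, b). 0 \<le> a \<and> a < b \<and> b \<le> 1 \<and> (\<exists>n. \<forall>y\<in>{a..<b}. (F ^^ n) y = y + 1 - b)}"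
  have vimage: "S \<in> sets lebesgue \<Longrightarrow> (F ^^ n) -` S \<in> sets lebesgue" for n S
  proof (induction n arbitrary: S)
    case (Suc n)
    have shift: "{x. x + c \<in> S} \<in> sets lebesgue" for c
      unfolding shift_vimage_eq using Suc.prems by (rule lebesgue_sets_translation)
    have "F -` S = ({x. x + L 1 \<in> S} \<inter> {..<1 - L 1}) \<union> ({x. x + L 2 \<in> S} \<inter> ({..<1 - L 2} - {..<1 - L 1}))
      \<union> ({x. x + (L 2 - L 0) \<in> S} - {..<1 - L 2} - {..<1 - L 1})"
      by (auto simp: f_def eval_nat_numeral algebra_simps split: if_splits)
    moreover have "{..<c} \<in> sets lebesgue" for c :: real
      by simp
    ultimately have "F -` S \<in> sets lebesgue"
      using Suc.prems by (auto intro!: sets.Un sets.Int sets.Diff shift)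
    moreover have "(F ^^ Suc n) -` S = (F ^^ n) -` F -` S"
      by auto
    ultimately show ?case
      using Suc.IH by (simp only:)
  qed simp
  have "{x. \<exists>n. (F ^^ n) x \<in> Om} = (\<Union>n. (F ^^ n) -` Om)"
    by auto
  also have "\<dots> \<in> sets lebesgue"
    using vimage[OF fmeasurableD[OF Om_lmeasurable]] by (intro sets.countable_UN) auto
  finally have N_lm: "?N \<in> lmeasurable"
    using diff_lmeasurable[of "{x. \<exists>n. (F ^^ n) x \<in> Om}" 0 1]
    by (simp add: set_diff_eq)
  have half: "measure lebesgue (?N \<inter> {a..<b}) \<le> (b - a) / 2" if ab: "(a, b) \<in> good" for a b
  proof -
    obtain n where n: "\<And>y. y \<in> {a..<b} \<Longrightarrow> (F ^^ n) y = y + 1 - b"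
      using ab unfolding good_def by blast
    have "?N \<inter> {a..<b} \<subseteq> (+) (b - 1) ` ({1 - (b - a)..<1} - Om)"
    proof
      fix y
      assume y: "y \<in> ?N \<inter> {a..<b}"
      then have "y + 1 - b \<in> {1 - (b - a)..<1} - Om"
        using n[of y] by (auto dest!: spec[of _ n])
      then show "y \<in> (+) (b - 1) ` ({1 - (b - a)..<1} - Om)"
        by (intro image_eqI[of _ _ "y + 1 - b"]) auto
    qed
    then have "measure lebesgue (?N \<inter> {a..<b}) \<le> measure lebesgue ((+) (b - 1) ` ({1 - (b - a)..<1} - Om))"
      using N_lm Om_lmeasurable
      by (intro measure_mono_fmeasurable measurable_translation diff_lmeasurable sets.Int)
        (auto dest: fmeasurableD)
    also have "\<dots> \<le> (b - a) / 2"
      using measure_tail_diff_Om[of "1 - (b - a)"] that by (auto simp: good_def measure_translation)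
    finally show ?thesis .
  qed
  \<comment> \<open>An open \<open>T\<close> exceeds \<open>?N\<close> by less than
    \<open>e\<close>. Disjoint good intervals inside \<open>T\<close> cover almost all of
    \<open>?N\<close>, and each meets it in at most half its length. Letting \<open>e\<close> be
    small makes the measure zero.\<close>
  have le: "measure lebesgue ?N \<le> (measure lebesgue ?N + e) / 2" if "e > 0" for e :: real
  proof -
    obtain T where T: "open T" "?N \<subseteq> T" "T - ?N \<in> lmeasurable" "emeasure lebesgue (T - ?N) < ennreal e"
      using sets_lebesgue_outer_open[OF fmeasurableD[OF N_lm] \<open>e > 0\<close>] by blast
    have T_lm: "T \<in> lmeasurable"
    proof -
      have "T = (T - ?N) \<union> ?N"
        using T(2) by (simp only: Un_Diff_cancel2 Un_absorb2)
      then show ?thesis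
        using fmeasurable.Un[OF T(3) N_lm] by simp
    qed
    have T_le: "measure lebesgue T \<le> measure lebesgue ?N + e"
    proof -
      have "measure lebesgue (T - ?N) < e"
        using T(3,4) that by (simp add: emeasure_eq_measure2 ennreal_less_iff)
      moreover have "measure lebesgue (T - ?N) = measure lebesgue T - measure lebesgue ?N"
        using T T_lm N_lm by (intro measurable_measure_Diff) (auto dest: fmeasurableD)
      ultimately show ?thesis
        by linarith
    qed
    define K where "K = {(a, b) \<in> good. {a..b} \<subseteq> T}"
    \<comment> \<open>Centre and radius, because the covering theorem speaks of closed balls; the
      endpoint that turns \<open>[a, b)\<close> into a closed interval is a null set.\<close>
    define c r :: "real \<times> real \<Rightarrow> real" where "c p = (fst p + snd p) / 2" and "r p = (snd p - fst p) / 2" for p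
    have cball: "cball (c p) (r p) = {fst p..snd p}" for p
      by (auto simp: c_def r_def cball_eq_atLeastAtMost field_simps)
    have "0 < r p" if "p \<in> K" for p
      using that by (auto simp: K_def good_def r_def)
    moreover have "\<exists>p. p \<in> K \<and> x \<in> cball (c p) (r p) \<and> r p < d" if x: "x \<in> ?N" "0 < d" for x d
    proof -
      obtain \<delta> where \<delta>: "\<delta> > 0" "cball x \<delta> \<subseteq> T"
        using T x open_contains_cball by blast
      obtain i where "L i < min d \<delta>"
        using L_small[of "min d \<delta>"] x(2) \<delta>(1) by auto
      moreover obtain a b n where ab: "0 \<le> a" "a \<le> x" "x < b" "b \<le> 1" "b - a \<le> L i"
        "\<forall>y\<in>{a..<b}. (F ^^ n) y = y + 1 - b"
        using renormalisation[of x i] x(1) by blast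
      moreover have "{a..b} \<subseteq> cball x \<delta>"
        using calculation by (auto simp: dist_real_def)
      ultimately have "(a, b) \<in> K"
        using \<delta> by (force simp: K_def good_def)
      moreover have "r (a, b) < d"
        using ab \<open>L i < min d \<delta>\<close> x(2) by (simp add: r_def)
      moreover have "x \<in> cball (c (a, b)) (r (a, b))"
        unfolding cball using ab by simp
      ultimately show ?thesis
        by blast
    qed
    ultimately obtain D where D: "countable D" "D \<subseteq> K"
      "pairwise (\<lambda>i j. disjnt (cball (c i) (r i)) (cball (c j) (r j))) D"
      "negligible (?N - (\<Union>i\<in>D. cball (c i) (r i)))"
      by (rule Vitali_covering_theorem_cballs[where a = c and r = r and K = K and S = ?N]) blast+
    let ?J = "\<lambda>p. cball (c p) (r p)"
    have J_lm: "?J p \<in> lmeasurable" for p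
      by simp
    have half': "measure lebesgue (?N \<inter> ?J p) \<le> measure lebesgue (?J p) / 2" if "p \<in> D" for p
    proof -
      obtain a b where p: "p = (a, b)" "(a, b) \<in> good"
        using \<open>p \<in> D\<close> D(2) by (auto simp: K_def)
      have "a < b"
        using p by (auto simp: good_def)
      have "measure lebesgue (?N \<inter> ?J p) \<le> measure lebesgue ((?N \<inter> {a..<b}) \<union> {b})"
        unfolding cball p fst_conv snd_conv
      proof (rule measure_mono_fmeasurable)
        show "?N \<inter> {a..b} \<subseteq> (?N \<inter> {a..<b}) \<union> {b}"
          by auto
        show "?N \<inter> {a..b} \<in> sets lebesgue"
          using N_lm by (intro sets.Int fmeasurableD) auto
        have "{b..b} \<in> lmeasurable"
          by (rule lmeasurable_interval)
        then show "(?N \<inter> {a..<b}) \<union> {b} \<in> lmeasurable"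
          using N_lm by (intro fmeasurable.Un fmeasurable_Int_fmeasurable) auto
      qed
      also have "\<dots> \<le> measure lebesgue (?N \<inter> {a..<b}) + measure lebesgue {b}"
        using N_lm by (intro measure_Un_le) (auto dest: fmeasurableD)
      also have "\<dots> \<le> (b - a) / 2"
        using half[OF p(2)] by simp
      finally show ?thesis
        using \<open>a < b\<close> by (simp add: cball p(1))
    qed
    have fin: "measure lebesgue (\<Union>p\<in>D'. ?N \<inter> ?J p) \<le> measure lebesgue T / 2" if "D' \<subseteq> D" "finite D'" for D'
    proof -
      have pw: "pairwise (\<lambda>i j. disjnt (?J i) (?J j)) D'"
        using D(3) that(1) by (rule pairwise_subset)
      have "measure lebesgue (\<Union>p\<in>D'. ?N \<inter> ?J p) \<le> (\<Sum>p\<in>D'. measure lebesgue (?N \<inter> ?J p))"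
      proof (rule measure_UNION_le[OF that(2)])
        show "?N \<inter> ?J p \<in> sets lebesgue" for p
          using fmeasurableD[OF N_lm] by (rule sets.Int) simp
      qed
      also have "\<dots> \<le> (\<Sum>p\<in>D'. measure lebesgue (?J p) / 2)"
        using half' that by (intro sum_mono) auto
      also have "\<dots> = measure lebesgue (\<Union>p\<in>D'. ?J p) / 2"
        using that by (subst measure_UNION'[OF _ _ pw]) (simp_all add: sum_divide_distrib)
      also have "measure lebesgue (\<Union>p\<in>D'. ?J p) \<le> measure lebesgue T"
      proof (rule measure_mono_fmeasurable)
        have "?J p \<subseteq> T" if "p \<in> D'" for p
        proof -
          have "p \<in> K"
            using \<open>p \<in> D'\<close> \<open>D' \<subseteq> D\<close> D(2) by blast
          then show ?thesis
            unfolding cball K_def by (cases p) simp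
        qed
        then show "(\<Union>p\<in>D'. ?J p) \<subseteq> T"
          by (rule UN_least)
        show "(\<Union>p\<in>D'. ?J p) \<in> sets lebesgue"
          using that by (intro sets.finite_UN) auto
      qed (rule T_lm)
      finally show ?thesis by simp
    qed
    have "measure lebesgue (\<Union>p\<in>D. ?N \<inter> ?J p) \<le> measure lebesgue T / 2"
    proof (rule measure_UN_bound[OF D(1)])
      show "?N \<inter> ?J p \<in> lmeasurable" for p
        using N_lm by (rule fmeasurable_Int_fmeasurable) simp
    qed (rule fin)
    moreover have "measure lebesgue ?N \<le> measure lebesgue (\<Union>p\<in>D. ?N \<inter> ?J p)"
    proof -
      have "measure lebesgue (?N - (\<Union>p\<in>D. ?J p)) = 0"
        using D(4) by (rule negligible_imp_measure0)
      moreover have "?N = (?N - (\<Union>p\<in>D. ?J p)) \<union> (\<Union>p\<in>D. ?N \<inter> ?J p)"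
        by blast
      moreover have "measure lebesgue ((?N - (\<Union>p\<in>D. ?J p)) \<union> (\<Union>p\<in>D. ?N \<inter> ?J p))
        \<le> measure lebesgue (?N - (\<Union>p\<in>D. ?J p)) + measure lebesgue (\<Union>p\<in>D. ?N \<inter> ?J p)"
      proof (rule measure_Un_le)
        have "(\<Union>p\<in>D. ?J p) \<in> sets lebesgue"
          using D(1) by (rule sets.countable_UN'') simp
        then show "?N - (\<Union>p\<in>D. ?J p) \<in> sets lebesgue"
          using fmeasurableD[OF N_lm] by (rule sets.Diff[rotated])
        have "?N \<inter> ?J p \<in> sets lebesgue" for p
          using fmeasurableD[OF N_lm] by (rule sets.Int) simp
        then show "(\<Union>p\<in>D. ?N \<inter> ?J p) \<in> sets lebesgue"
          by (rule sets.countable_UN''[OF D(1)])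
      qed
      ultimately show ?thesis
        by simp
    qed
    moreover have "n \<le> (n + e) / 2" if "u \<le> t / 2" "n \<le> u" "t \<le> n + e" for n u t :: real
      using that by simp
    ultimately show ?thesis
      using T_le by blast
  qed
  define m where "m = measure lebesgue ?N"
  have le: "m \<le> (m + e) / 2" if "e > 0" for e :: real
    unfolding m_def using that by (rule le)
  have "m = 0"
  proof (rule ccontr)
    assume "m \<noteq> 0"
    moreover have "0 \<le> m"
      unfolding m_def by (rule measure_nonneg)
    ultimately show False
      using le[of "m / 2"] by simp
  qed
  then show ?thesis
    using N_lm negligible_iff_measure unfolding m_def by blast
qed

text \<open>Measure is preserved by \<open>F\<close> from the attractor onto itself, so the translated pieces cannot overlap.\<close>

lemma negligible_double_preimage:
  "negligible {y. \<exists>u\<in>Om. \<exists>v\<in>Om. u \<noteq> v \<and> F u = y \<and> F v = y}"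
proof -
  \<comment> \<open>The three translated pieces of \<open>Om\<close>. A point with two different
    preimages in \<open>Om\<close> lies in two of them.\<close>
  define P1 where "P1 = (+) (L 1) ` (Om \<inter> {..<1 - L 1})"
  define P2 where "P2 = (+) (L 2) ` (Om \<inter> {1 - L 1..<1 - L 2})"
  define P3 where "P3 = (+) (L 2 - L 0) ` (Om \<inter> {1 - L 2..})"
  have L21: "L 2 < L 1"
    using L_Suc_less[of 1] by (simp add: eval_nat_numeral)
  have sub: "{y. \<exists>u\<in>Om. \<exists>v\<in>Om. u \<noteq> v \<and> F u = y \<and> F v = y} \<subseteq> (P1 \<inter> P2) \<union> (P1 \<inter> P3) \<union> (P2 \<inter> P3)"
  proof
    fix y
    assume "y \<in> {y. \<exists>u\<in>Om. \<exists>v\<in>Om. u \<noteq> v \<and> F u = y \<and> F v = y}"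
    then obtain u v where uv: "u \<in> Om" "v \<in> Om" "u \<noteq> v" "F u = y" "F v = y"
      by blast
    have in_P: "w < 1 - L 1 \<and> F w = w + L 1 \<and> F w \<in> P1 \<or> 1 - L 1 \<le> w \<and> w < 1 - L 2 \<and> F w = w + L 2 \<and> F w \<in> P2
      \<or> 1 - L 2 \<le> w \<and> F w = w + L 2 - L 0 \<and> F w \<in> P3" if "w \<in> Om" for w
      using that L21 by (auto simp: f_def P1_def P2_def P3_def mem_translation eval_nat_numeral)
    from in_P[OF uv(1)] in_P[OF uv(2)] show "y \<in> P1 \<inter> P2 \<union> P1 \<inter> P3 \<union> P2 \<inter> P3"
      using uv(3-5) by auto
  qed
  have Om: "Om \<inter> T \<in> lmeasurable" if "T \<in> sets lebesgue" for T
    using Om_lmeasurable that by (rule fmeasurable_Int_fmeasurable)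
  have lm: "P1 \<in> lmeasurable" "P2 \<in> lmeasurable" "P3 \<in> lmeasurable"
    unfolding P1_def P2_def P3_def by (intro measurable_translation Om; simp)+
  let ?m = "measure lebesgue"
  \<comment> \<open>The pieces have the total measure of \<open>Om\<close> and cover
    \<open>Om\<close>, so inclusion-exclusion leaves no measure for their overlaps.\<close>
  have "?m P1 + ?m P2 + ?m P3 = ?m (Om \<inter> {..<1 - L 1}) + ?m (Om \<inter> {1 - L 1..<1 - L 2}) + ?m (Om \<inter> {1 - L 2..})"
    by (simp only: P1_def P2_def P3_def measure_translation)
  also have "?m (Om \<inter> {..<1 - L 1}) + ?m (Om \<inter> {1 - L 1..<1 - L 2}) = ?m (Om \<inter> {..<1 - L 1} \<union> Om \<inter> {1 - L 1..<1 - L 2})"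
    by (subst measure_Un3) (auto simp: Om intro!: arg_cong[where f = ?m, THEN trans, OF _ measure_empty])
  also have "Om \<inter> {..<1 - L 1} \<union> Om \<inter> {1 - L 1..<1 - L 2} = Om \<inter> {..<1 - L 2}"
    using L21 by auto
  also have "?m (Om \<inter> {..<1 - L 2}) + ?m (Om \<inter> {1 - L 2..}) = ?m (Om \<inter> {..<1 - L 2} \<union> Om \<inter> {1 - L 2..})"
    by (subst measure_Un3) (auto simp: Om intro!: arg_cong[where f = ?m, THEN trans, OF _ measure_empty])
  also have "Om \<inter> {..<1 - L 2} \<union> Om \<inter> {1 - L 2..} = Om"
    by auto
  also have "?m Om \<le> ?m (P1 \<union> (P2 \<union> P3))"
  proof (intro measure_mono_fmeasurable fmeasurable.Un lm)
    show "Om \<subseteq> P1 \<union> (P2 \<union> P3)"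
    proof
      fix y assume "y \<in> Om"
      then obtain w where "w \<in> Om" "F w = y"
        using Om_preimage by blast
      then show "y \<in> P1 \<union> (P2 \<union> P3)"
        using L21 by (auto simp: f_def P1_def P2_def P3_def mem_translation eval_nat_numeral split: if_splits)
    qed
  qed (use Om_lmeasurable in auto)
  also have "\<dots> = ?m P1 + (?m P2 + ?m P3 - ?m (P2 \<inter> P3)) - ?m (P1 \<inter> (P2 \<union> P3))"
    using lm by (simp add: measure_Un3 fmeasurable.Un)
  finally have "?m (P2 \<inter> P3) + ?m (P1 \<inter> (P2 \<union> P3)) \<le> 0"
    by simp
  then have "?m (P2 \<inter> P3) = 0" "?m (P1 \<inter> (P2 \<union> P3)) = 0"
    using measure_nonneg[of lebesgue "P2 \<inter> P3"] measure_nonneg[of lebesgue "P1 \<inter> (P2 \<union> P3)"] by linarith+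
  moreover have "P2 \<inter> P3 \<in> lmeasurable" "P1 \<inter> (P2 \<union> P3) \<in> lmeasurable"
    using lm by (auto intro!: fmeasurable_Int_fmeasurable fmeasurable.Un dest: fmeasurableD)
  ultimately have "negligible (P2 \<inter> P3)" "negligible (P1 \<inter> (P2 \<union> P3))"
    by (simp_all add: negligible_iff_measure)
  then have "negligible (P2 \<inter> P3 \<union> P1 \<inter> (P2 \<union> P3))"
    by (rule negligible_Un)
  then show ?thesis
    by (rule negligible_subset) (use sub in blast)
qed

end

subsection \<open>Existence of the parameters\<close>

text \<open>\<open>L_rec\<close> solved for its last term, with the first two lengths after 1 as
  free parameters. Monotonicity and positivity are the conditions to be met.\<close>

fun solution :: "(nat \<Rightarrow> nat) \<Rightarrow> real \<times> real \<Rightarrow> nat \<Rightarrow> real" where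
  "solution k ab 0 = 1"
| "solution k ab (Suc 0) = fst ab"
| "solution k ab (Suc (Suc 0)) = snd ab"
| "solution k ab (Suc (Suc (Suc i))) =
     solution k ab (Suc (Suc i)) + k i * solution k ab (Suc i) - solution k ab i"

lemma continuous_on_solution: "continuous_on S (\<lambda>ab. solution k ab i)"
proof (induction i rule: less_induct)
  case (less i)
  consider "i = 0" | "i = 1" | "i = 2" | j where "i = Suc (Suc (Suc j))"
    by (metis One_nat_def Suc_1 not0_implies_Suc)
  then show ?case
  proof cases
    case 4
    then have "continuous_on S (\<lambda>ab. solution k ab j)" "continuous_on S (\<lambda>ab. solution k ab (Suc j))"
      "continuous_on S (\<lambda>ab. solution k ab (Suc (Suc j)))"
      by (simp_all add: less)
    then show ?thesis
      unfolding 4 by (auto intro!: continuous_intros)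
  qed (auto simp: eval_nat_numeral intro!: continuous_intros)
qed

text \<open>Read towards smaller indices the recursion preserves monotonicity: a nonincreasing
  \<open>v\<close> is extended by \<open>k 0 * v 0 + v 1 - v 2\<close>, which is at least
  \<open>v 0\<close> because \<open>1 \<le> k 0\<close>.\<close>

lemma finite_solution_exists:
  fixes k :: "nat \<Rightarrow> nat"
  assumes "\<And>i. 1 \<le> k i"
  shows "\<exists>u :: nat \<Rightarrow> real. 0 < u 0 \<and> (\<forall>i. u (Suc i) \<le> u i \<and> 0 \<le> u i) \<and>
    (\<forall>i<N. u i = k i * u (Suc i) + u (Suc (Suc i)) - u (Suc (Suc (Suc i))))"
  using assms
proof (induction N arbitrary: k)
  case 0
  show ?case
    by (rule exI[of _ "\<lambda>_. 1"]) simp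
next
  case (Suc N)
  from Suc.IH[of "k \<circ> Suc"] Suc.prems obtain v :: "nat \<Rightarrow> real" where v: "0 < v 0"
    "\<And>i. v (Suc i) \<le> v i" "\<And>i. 0 \<le> v i"
    "\<And>i. i < N \<Longrightarrow> v i = k (Suc i) * v (Suc i) + v (Suc (Suc i)) - v (Suc (Suc (Suc i)))"
    by auto
  define u where "u = case_nat (k 0 * v 0 + v 1 - v 2) v"
  have u: "u 0 = k 0 * v 0 + v 1 - v 2" "\<And>i. u (Suc i) = v i"
    by (simp_all add: u_def)
  have "1 * v 0 \<le> real (k 0) * v 0"
    using Suc.prems[of 0] v(1) by (intro mult_right_mono) auto
  then have ge: "v 0 \<le> u 0"
    using v(2)[of 1] by (simp add: u eval_nat_numeral)
  have "u (Suc i) \<le> u i \<and> 0 \<le> u i" for i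
    using ge v(1-3) by (cases i) (auto simp: u(2) intro: order_trans[OF _ ge])
  moreover have "u i = k i * u (Suc i) + u (Suc (Suc i)) - u (Suc (Suc (Suc i)))" if "i < Suc N" for i
    using that v(4) by (cases i) (auto simp: u(2), simp add: u(1) eval_nat_numeral)
  moreover have "0 < u 0"
    using ge v(1) by simp
  ultimately show ?case
    by (intro exI[of _ u]) blast
qed

text \<open>The conditions up to index \<open>N\<close> cut out nested compact subsets of the unit
  square. They are nonempty by the finite solutions, divided by their first term.\<close>

lemma solution_exists:
  fixes k :: "nat \<Rightarrow> nat"
  assumes "\<And>i. 1 \<le> k i"
  shows "\<exists>ab. \<forall>i. 0 \<le> solution k ab i \<and> solution k ab (Suc i) \<le> solution k ab i"
proof -
  define K where "K N = {ab \<in> cbox (0, 0) (1, 1). \<forall>i\<le>N. 0 \<le> solution k ab i \<and> solution k ab (Suc i) \<le> solution k ab i}" for N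
  have "\<Inter>(range K) \<noteq> {}"
  proof (rule compact_nest)
    fix N
    have "K N = cbox (0, 0) (1, 1) \<inter> (\<Inter>i\<in>{..N}. {ab. 0 \<le> solution k ab i} \<inter> {ab. solution k ab (Suc i) \<le> solution k ab i})"
      by (auto simp: K_def)
    moreover have "closed (\<Inter>i\<in>{..N}. {ab. 0 \<le> solution k ab i} \<inter> {ab. solution k ab (Suc i) \<le> solution k ab i})"
      by (intro closed_INT ballI closed_Int closed_Collect_le continuous_on_solution continuous_on_const)
    ultimately show "compact (K N)"
      by (simp add: compact_Int_closed)
    show "K N \<noteq> {}"
    proof -
      obtain u :: "nat \<Rightarrow> real" where u: "0 < u 0" "\<And>i. u (Suc i) \<le> u i" "\<And>i. 0 \<le> u i"
        "\<And>i. i < N + 2 \<Longrightarrow> u i = k i * u (Suc i) + u (Suc (Suc i)) - u (Suc (Suc (Suc i)))"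
        using finite_solution_exists[of k "N + 2", OF assms] by blast
      define ab where "ab = (u 1 / u 0, u 2 / u 0)"
      have sol: "i \<le> N + 2 \<Longrightarrow> solution k ab i = u i / u 0" for i
      proof (induction i rule: less_induct)
        case (less i)
        consider "i = 0" | "i = 1" | "i = 2" | j where "i = Suc (Suc (Suc j))"
          by (metis One_nat_def Suc_1 not0_implies_Suc)
        then show ?case
        proof cases
          case 4
          then have "solution k ab i = u (Suc (Suc j)) / u 0 + k j * (u (Suc j) / u 0) - u j / u 0"
            using less by simp
          also have "\<dots> = (u (Suc (Suc j)) + k j * u (Suc j) - u j) / u 0"
            by (simp add: add_divide_distrib diff_divide_distrib)
          also have "u (Suc (Suc j)) + k j * u (Suc j) - u j = u i"
            using u(4)[of j] less.prems 4 by simp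
          finally show ?thesis .
        qed (use u(1) in \<open>auto simp: ab_def eval_nat_numeral\<close>)
      qed
      have "u 1 \<le> u 0" "u 2 \<le> u 0"
        using u(2)[of 0] u(2)[of 1] by (auto simp: eval_nat_numeral)
      then have "ab \<in> cbox (0, 0) (1, 1)"
        using u(1,3) by (auto simp: ab_def)
      then have "ab \<in> K N"
        using u(1-3) by (auto simp: K_def sol divide_right_mono)
      then show ?thesis by blast
    qed
  next
    fix M N :: nat
    assume "M \<le> N"
    then show "K N \<subseteq> K M"
      by (auto simp: K_def)
  qed
  then obtain ab where "\<And>N. ab \<in> K N"
    by blast
  then show ?thesis
    by (intro exI[of _ ab]) (auto simp: K_def)
qed

text \<open>A binary sequence \<open>s\<close> is coded by the lengths of the runs of ones between successive twos. The
  exponential growth of the runs makes the losses summable; the positions of the twos alternate in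
  parity because the recursion for the gaps \<open>len s i - len s (Suc i)\<close> advances the index by \<open>2\<close>.\<close>

definition run :: "(nat \<Rightarrow> bool) \<Rightarrow> nat \<Rightarrow> nat" where
  "run s n = 12 * 2 ^ n + (if s n then 1 else 0)"

fun pos :: "(nat \<Rightarrow> bool) \<Rightarrow> nat \<Rightarrow> nat" where
  "pos s 0 = 0"
| "pos s (Suc n) = pos s n + 2 * run s n + 1"

definition multiplier :: "(nat \<Rightarrow> bool) \<Rightarrow> nat \<Rightarrow> nat" where
  "multiplier s i = (if i \<in> range (pos s) then 2 else 1)"

lemma multiplier_cases: "multiplier s i = 1 \<or> multiplier s i = 2"
  by (simp add: multiplier_def)

lemma multiplier_eqI: "(multiplier s i = 2 \<longleftrightarrow> multiplier s' i = 2) \<Longrightarrow> multiplier s i = multiplier s' i"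
  using multiplier_cases[of s i] multiplier_cases[of s' i] by auto

lemma strict_mono_pos: "strict_mono (pos s)"
  by (simp add: strict_mono_Suc_iff)

lemma multiplier_between: "pos s n < i \<Longrightarrow> i < pos s (Suc n) \<Longrightarrow> multiplier s i = 1"
proof -
  assume i: "pos s n < i" "i < pos s (Suc n)"
  have "i \<notin> range (pos s)"
  proof
    assume "i \<in> range (pos s)"
    then obtain j where "i = pos s j" by blast
    then have "n < j" "j < Suc n"
      using i strict_mono_less[OF strict_mono_pos] by blast+
    then show False by simp
  qed
  then show ?thesis
    by (simp add: multiplier_def)
qed

lemma even_pos: "even (pos s n) = even n"
  by (induction n) auto

text \<open>\<open>pos s n\<close> is at least \<open>n\<close> and has the parity of
  \<open>n\<close>, so any \<open>n\<close> that is at least \<open>i\<close> and has the parity of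
  \<open>i\<close> will do.\<close>

lemma multiplier_two_same_parity: "\<exists>t. multiplier s (i + 2 * t) = 2"
proof -
  define n where "n = (if even i then i * 2 else i * 2 + 1)"
  have "i \<le> n"
    by (simp add: n_def)
  also have "n \<le> pos s n"
    using strict_mono_pos by (rule strict_mono_imp_increasing)
  finally have "i \<le> pos s n" .
  moreover have "even (pos s n) = even i"
    by (simp add: even_pos n_def)
  ultimately have "i + 2 * ((pos s n - i) div 2) = pos s n"
    by (simp add: even_diff_nat)
  then show ?thesis
    by (intro exI[of _ "(pos s n - i) div 2"]) (simp add: multiplier_def)
qed

text \<open>The factor 12 in \<open>run\<close> is chosen for this bound: the geometric series sums
  to \<open>2/12\<close>.\<close>

lemma inverse_run_sum: "(\<Sum>n<N. 1 / real (run s n)) \<le> 1/6"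
proof -
  have "(\<Sum>n<N. 1 / real (run s n)) \<le> (\<Sum>n<N. 1/12 * (1/2) ^ n)"
  proof (intro sum_mono)
    fix n
    have "1 / real (run s n) \<le> 1 / (12 * 2 ^ n)"
      by (rule divide_left_mono) (auto simp: run_def intro!: mult_pos_pos add_pos_pos)
    then show "1 / real (run s n) \<le> 1/12 * (1/2) ^ n"
      by (simp add: power_divide)
  qed
  also have "\<dots> = 1/6 * (1 - (1/2) ^ N)"
    unfolding sum_distrib_left[symmetric] by (simp add: sum_gp_strict)
  also have "\<dots> \<le> 1/6"
    by simp
  finally show ?thesis .
qed

definition parameter :: "(nat \<Rightarrow> bool) \<Rightarrow> real \<times> real" where
  "parameter s = (SOME ab. \<forall>i. 0 \<le> solution (multiplier s) ab i \<and> solution (multiplier s) ab (Suc i) \<le> solution (multiplier s) ab i)"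

definition len :: "(nat \<Rightarrow> bool) \<Rightarrow> nat \<Rightarrow> real" where
  "len s = solution (multiplier s) (parameter s)"

definition lost :: "(nat \<Rightarrow> bool) \<Rightarrow> nat \<Rightarrow> real" where
  "lost s i = (if i \<in> range (pos s) then 1 / real (run s (inv (pos s) i)) else 0)"

context
  fixes s :: "nat \<Rightarrow> bool"
begin

lemma len_weak: "0 \<le> len s i" "len s (Suc i) \<le> len s i"
proof -
  have "\<exists>ab. \<forall>i. 0 \<le> solution (multiplier s) ab i \<and> solution (multiplier s) ab (Suc i) \<le> solution (multiplier s) ab i"
    by (rule solution_exists) (simp add: multiplier_def)
  from someI_ex[OF this] show "0 \<le> len s i" "len s (Suc i) \<le> len s i"
    unfolding len_def parameter_def by blast+
qed

lemma len_rec: "len s i = multiplier s i * len s (Suc i) + len s (Suc (Suc i)) - len s (Suc (Suc (Suc i)))"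
  by (simp add: len_def)

text \<open>A zero at \<open>Suc i\<close> forces a zero at the next index, and then the recursion
  makes \<open>len s i\<close> nonpositive.\<close>

lemma len_pos: "0 < len s i"
proof (induction i)
  case 0
  show ?case by (simp add: len_def)
next
  case (Suc i)
  show ?case
  proof (rule ccontr)
    assume "\<not> 0 < len s (Suc i)"
    then have "len s (Suc i) = 0" "len s (Suc (Suc i)) = 0"
      using len_weak[of "Suc i"] len_weak(1)[of "Suc (Suc i)"] by auto
    then show False
      using len_rec[of i] len_weak(1)[of "Suc (Suc (Suc i))"] Suc by simp
  qed
qed

lemma gap_rec: "len s (Suc i) - len s (Suc (Suc i)) =
    len s (Suc (Suc (Suc i))) - len s (Suc (Suc (Suc (Suc i)))) + (real (multiplier s (Suc i)) - 1) * len s (Suc (Suc i))"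
  using len_rec[of "Suc i"] by (simp add: algebra_simps)

text \<open>By \<open>gap_rec\<close>, each gap is the gap two places later plus a nonnegative term,
  and this term is positive at a two. As the index moves by 2, twos are needed at both
  parities.\<close>

lemma gap_pos: "len s (Suc (Suc i)) < len s (Suc i)"
proof -
  obtain t where "multiplier s (Suc i + 2 * t) = 2"
    using multiplier_two_same_parity by blast
  then show ?thesis
  proof (induction t arbitrary: i)
    case 0
    then show ?case
      using gap_rec[of i] len_pos[of "Suc (Suc i)"] len_weak(2)[of "Suc (Suc (Suc i))"] by simp
  next
    case (Suc t)
    have "len s (Suc (Suc (Suc (Suc i)))) < len s (Suc (Suc (Suc i)))"
      using Suc.prems by (intro Suc.IH) simp
    moreover have "0 \<le> (real (multiplier s (Suc i)) - 1) * len s (Suc (Suc i))"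
      using len_pos[of "Suc (Suc i)"] by (simp add: multiplier_def)
    ultimately show ?case
      using gap_rec[of i] by linarith
  qed
qed

lemma len_Suc_less: "len s (Suc i) < len s i"
proof (cases i)
  case 0
  have "1 * len s 1 \<le> real (multiplier s 0) * len s 1"
    using len_pos[of 1] by (intro mult_right_mono) (auto simp: multiplier_def)
  then show ?thesis
    using len_rec[of 0] gap_pos[of 1] by (simp add: 0 eval_nat_numeral)
qed (use gap_pos in simp)

text \<open>During the run of ones after \<open>pos s n\<close> the gap recurs unchanged at every
  second index. These \<open>run s n\<close> copies belong to disjoint stretches of a decreasing
  sequence, so together they do not exceed its first term.\<close>

lemma len_loss:
  "len s (Suc (pos s n)) - len s (Suc (Suc (pos s n))) \<le> 1 / real (run s n) * len s (Suc (pos s n))"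
proof -
  let ?j = "pos s n"
  let ?g = "\<lambda>i. len s (Suc i) - len s (Suc (Suc i))"
  have g: "t \<le> run s n \<Longrightarrow> ?g (?j + 2 * t) = ?g ?j" for t
  proof (induction t)
    case (Suc t)
    have "multiplier s (Suc (?j + 2 * t)) = 1"
      using Suc.prems by (intro multiplier_between[of s n]) auto
    then show ?case
      using gap_rec[of "?j + 2 * t"] Suc by simp
  qed simp
  have "t \<le> run s n \<Longrightarrow> t * ?g ?j \<le> len s (Suc ?j) - len s (Suc (?j + 2 * t))" for t
  proof (induction t)
    case (Suc t)
    have "?g ?j \<le> len s (Suc (?j + 2 * t)) - len s (Suc (?j + 2 * Suc t))"
      using g[of t] Suc.prems len_weak(2)[of "Suc (Suc (?j + 2 * t))"] by simp
    with Suc show ?case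
      by (simp add: algebra_simps)
  qed simp
  from this[of "run s n"] have "run s n * ?g ?j \<le> len s (Suc ?j)"
    using len_weak(1)[of "Suc (?j + 2 * run s n)"] by simp
  moreover have "0 < run s n"
    by (simp add: run_def)
  ultimately show ?thesis
    by (simp add: field_simps)
qed

lemma lost_sum: "sum (lost s) {..<N} \<le> 1/6"
proof -
  have inj: "inj (pos s)"
    using strict_mono_pos by (rule strict_mono_imp_inj_on)
  let ?A = "{n. pos s n < N}"
  have A: "?A \<subseteq> {..<N}"
    using strict_mono_imp_increasing[OF strict_mono_pos] le_less_trans by blast
  have "sum (lost s) {..<N} = sum (lost s) (pos s ` ?A)"
    by (rule sum.mono_neutral_right) (auto simp: lost_def)
  also have "\<dots> = (\<Sum>n\<in>?A. 1 / real (run s n))"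
    using inj by (subst sum.reindex) (auto simp: inj_on_def lost_def inv_f_f)
  also have "\<dots> \<le> (\<Sum>n<N. 1 / real (run s n))"
    using A by (intro sum_mono2) auto
  finally show ?thesis
    using inverse_run_sum[of s N] by linarith
qed

lemma interval_translation_map: "interval_translation_map (len s) (multiplier s) (lost s)"
proof
  fix i
  show "len s 0 = 1"
    by (simp add: len_def)
  show "0 < len s i" "len s (Suc i) < len s i"
    by (rule len_pos len_Suc_less)+
  show "multiplier s i = 1 \<or> multiplier s i = 2"
    by (simp add: multiplier_def)
  show "len s i = real (multiplier s i) * len s (Suc i) + len s (Suc (Suc i)) - len s (Suc (Suc (Suc i)))"
    by (rule len_rec)
  show "\<exists>j\<ge>i. multiplier s j = 2"
    using multiplier_two_same_parity[of s i] by (metis le_add1)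
  show "len s (Suc i) - len s (Suc (Suc i)) \<le> lost s i * len s (Suc i)" if "multiplier s i = 2"
  proof -
    have "i \<in> range (pos s)"
      using that by (simp add: multiplier_def split: if_splits)
    then obtain n where n: "i = pos s n"
      by blast
    have "inv (pos s) i = n"
      unfolding n by (rule inv_f_f) (rule strict_mono_imp_inj_on[OF strict_mono_pos])
    then show ?thesis
      using len_loss[of n] by (simp add: lost_def n)
  qed
  show "0 \<le> lost s i"
    by (simp add: lost_def)
  show "sum (lost s) {..<n} \<le> 1 / 6" for n
    by (rule lost_sum)
qed

text \<open>The remaining difference in the recursion lies strictly between 0 and
  \<open>len s (Suc i)\<close>. So the multiplier is the integer part of
  \<open>len s i / len s (Suc i)\<close>, as in a continued fraction.\<close>

lemma multiplier_eq_2_iff: "multiplier s i = 2 \<longleftrightarrow> 2 * len s (Suc i) < len s i"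
  using len_rec[of i] gap_pos[of "Suc i"] gap_pos[of i] len_pos[of "Suc (Suc (Suc i))"]
  by (auto simp: multiplier_def split: if_splits)

end

lemma parameters_determine_len:
  assumes "len s 1 = len s' 1" "len s 2 = len s' 2"
  shows "len s i = len s' i"
proof -
  have "len s i = len s' i \<and> len s (Suc i) = len s' (Suc i) \<and> len s (Suc (Suc i)) = len s' (Suc (Suc i))"
  proof (induction i)
    case 0
    then show ?case
      using assms by (simp add: len_def eval_nat_numeral)
  next
    case (Suc i)
    then have "multiplier s i = 2 \<longleftrightarrow> multiplier s' i = 2"
      by (simp add: multiplier_eq_2_iff)
    then have "multiplier s i = multiplier s' i"
      by (rule multiplier_eqI)
    then show ?case
      using Suc len_rec[of s i] len_rec[of s' i] by auto
  qed
  then show ?thesis by blast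
qed

text \<open>The lengths determine the multipliers one after the other. Given \<open>pos s n\<close>,
  the next two stands at one of two possible places, two indices apart, and this decides
  \<open>s n\<close>.\<close>

lemma inj_parameters: "inj (\<lambda>s. (len s 1, len s 2))"
proof (rule injI, rule ext)
  fix s s' :: "nat \<Rightarrow> bool" and n
  assume "(len s 1, len s 2) = (len s' 1, len s' 2)"
  then have "multiplier s i = 2 \<longleftrightarrow> multiplier s' i = 2" for i
    by (simp add: multiplier_eq_2_iff parameters_determine_len[of s s'])
  then have eq: "multiplier s i = multiplier s' i" for i
    by (rule multiplier_eqI)
  have next_pos: "s n \<longleftrightarrow> multiplier s (pos s n + 2 * (12 * 2 ^ n) + 1) = 1" for s n
  proof (cases "s n")
    case True
    then have "multiplier s (pos s n + 2 * (12 * 2 ^ n) + 1) = 1"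
      by (intro multiplier_between[of s n]) (auto simp: run_def)
    with True show ?thesis by simp
  next
    case False
    then have "pos s n + 2 * (12 * 2 ^ n) + 1 = pos s (Suc n)"
      by (simp add: run_def)
    then have "multiplier s (pos s n + 2 * (12 * 2 ^ n) + 1) = 2"
      unfolding multiplier_def by (simp only: rangeI if_True)
    with False show ?thesis by simp
  qed
  have "pos s n = pos s' n"
  proof (induction n)
    case (Suc n)
    then have "s n = s' n"
      using next_pos[of s n] next_pos[of s' n] eq by simp
    then show ?case
      using Suc by (simp add: run_def)
  qed simp
  then show "s n = s' n"
    using next_pos[of s n] next_pos[of s' n] eq by simp
qed

lemma uncountable_parameters: "uncountable (range (\<lambda>s. (len s 1, len s 2)))"
proof
  assume "countable (range (\<lambda>s. (len s 1, len s 2)))"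
  then have "countable (UNIV :: (nat \<Rightarrow> bool) set)"
    using inj_parameters by (rule countable_image_inj_on)
  then obtain e :: "nat \<Rightarrow> nat \<Rightarrow> bool" where "range e = UNIV"
    by (metis UNIV_not_empty range_from_nat_into)
  then obtain n where "e n = (\<lambda>n. \<not> e n n)"
    by (metis rangeE UNIV_I)
  then show False
    by metis
qed

section \<open>Leaves as classes of vertices\<close>

text \<open>Each vertical arc becomes one edge, directed from bottom to top, of a graph on the
  support. Its connectedness relation \<open>leaf_rel\<close> describes the leaves without
  mentioning paths.\<close>

definition band_edges :: "band_union \<Rightarrow> (real \<times> real) set" where
  "band_edges Y = (\<Union>B\<in>bands Y. (\<lambda>t. (t + shift B False, t + shift B True)) ` {lo B..hi B})"

definition leaf_rel :: "band_union \<Rightarrow> (real \<times> real) set" where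
  "leaf_rel Y = (band_edges Y \<union> (band_edges Y)^-1)^*"

definition band_at :: "band_union \<Rightarrow> real \<Rightarrow> band" where
  "band_at Y x = (THE B. B \<in> bands Y \<and> x \<in> {lo B..hi B})"

text \<open>Inside a band the bottom of the arc is chosen, because in a suspension the arc going up
  from a nonsingular point is unique.\<close>

definition vertex :: "band_union \<Rightarrow> point \<Rightarrow> real" where
  "vertex Y p = (case p of Inl x \<Rightarrow> x | Inr q \<Rightarrow> fst q + shift (band_at Y (fst q)) False)"

definition leaf_of :: "band_union \<Rightarrow> real \<Rightarrow> point set" where
  "leaf_of Y x = {p \<in> points Y. (x, vertex Y p) \<in> leaf_rel Y}"

text \<open>Two charts cover the complex: the points that are not at height \<open>1/2\<close>, projected along the
  bands to the support, and the open bands.\<close>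

definition base_position :: "band_union \<Rightarrow> point \<Rightarrow> real" where
  "base_position Y p = (case p of Inl x \<Rightarrow> x | Inr q \<Rightarrow> fst q + shift (band_at Y (fst q)) (snd q > 1/2))"

definition band_position :: "point \<Rightarrow> real" where
  "band_position p = (case p of Inl x \<Rightarrow> 0 | Inr q \<Rightarrow> fst q)"

definition charts :: "band_union \<Rightarrow> (point set \<times> (point \<Rightarrow> real)) set" where
  "charts Y = {({p \<in> points Y. \<forall>q. p = Inr q \<longrightarrow> snd q \<noteq> 1/2}, base_position Y),
               ({p \<in> points Y. \<exists>q. p = Inr q}, band_position)}"

lemma leaf_rel_refl: "(x, x) \<in> leaf_rel Y"
  by (simp add: leaf_rel_def)

lemma leaf_rel_sym: "(x, y) \<in> leaf_rel Y \<Longrightarrow> (y, x) \<in> leaf_rel Y"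
proof -
  have "sym (leaf_rel Y)"
    unfolding leaf_rel_def by (rule sym_rtrancl) (rule sym_Un_converse)
  then show "(x, y) \<in> leaf_rel Y \<Longrightarrow> (y, x) \<in> leaf_rel Y"
    by (rule symD)
qed

lemma leaf_rel_trans: "(x, y) \<in> leaf_rel Y \<Longrightarrow> (y, z) \<in> leaf_rel Y \<Longrightarrow> (x, z) \<in> leaf_rel Y"
  unfolding leaf_rel_def by (rule rtrancl_trans)

lemma leaf_rel_band:
  assumes "B \<in> bands Y" "t \<in> {lo B..hi B}"
  shows "(t + shift B e, t + shift B e') \<in> leaf_rel Y"
proof -
  have "(t + shift B False, t + shift B True) \<in> band_edges Y"
    using assms unfolding band_edges_def by blast
  then have "(t + shift B False, t + shift B True) \<in> leaf_rel Y"
    by (auto simp: leaf_rel_def)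
  then show ?thesis
    using leaf_rel_sym leaf_rel_refl by (cases e; cases e') auto
qed

text \<open>Finitely many bands leave each vertex with finitely many neighbours.\<close>

lemma countable_leaf_rel:
  assumes "finite (bands Y)"
  shows "countable (leaf_rel Y `` {x})"
proof -
  let ?R = "band_edges Y \<union> (band_edges Y)^-1"
  have fin: "finite (?R `` {z})" for z
  proof -
    have "?R `` {z} \<subseteq> (\<Union>B\<in>bands Y. {z - shift B False + shift B True, z - shift B True + shift B False})"
      by (auto simp: band_edges_def)
    then show ?thesis
      by (rule finite_subset) (use assms in simp)
  qed
  have "countable ((?R ^^ n) `` {x})" for n
  proof (induction n)
    case (Suc n)
    have "(?R ^^ Suc n) `` {x} = (\<Union>z\<in>(?R ^^ n) `` {x}. ?R `` {z})"
      by auto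
    then show ?case
      by (simp only:) (intro countable_UN Suc.IH countable_finite fin)
  qed auto
  moreover have "leaf_rel Y `` {x} = (\<Union>n. (?R ^^ n) `` {x})"
    by (auto simp: leaf_rel_def rtrancl_is_UN_relpow)
  ultimately show ?thesis
    by simp
qed

lemma locally_constant_on_iff:
  "locally_constant_on S f \<longleftrightarrow> (\<forall>p\<in>S. \<exists>T. open T \<and> p \<in> T \<and> (\<forall>q\<in>T \<inter> S. f q = f p))"
  unfolding locally_constant_on_def eventually_at_topological
  by (intro ball_cong refl ex_cong1) auto

lemma locally_constant_onI:
  assumes "\<And>q. q \<in> S \<Longrightarrow> f q = c"
  shows "locally_constant_on S f"
  unfolding locally_constant_on_iff
proof
  fix p
  assume "p \<in> S"
  then show "\<exists>T. open T \<and> p \<in> T \<and> (\<forall>q\<in>T \<inter> S. f q = f p)"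
    using assms by (intro exI[of _ UNIV]) simp
qed

lemma locally_constant_on_subset:
  "locally_constant_on S f \<Longrightarrow> T \<subseteq> S \<Longrightarrow> locally_constant_on T f"
  unfolding locally_constant_on_iff by (meson IntI IntD1 IntD2 subsetD)

lemma openin_locally_constant:
  assumes "locally_constant_on S f"
  shows "openin (top_of_set S) {x \<in> S. P (f x)}"
proof (subst openin_subopen, intro ballI)
  fix x
  assume x: "x \<in> {x \<in> S. P (f x)}"
  then obtain T where T: "open T" "x \<in> T" "\<forall>q\<in>T \<inter> S. f q = f x"
    using assms unfolding locally_constant_on_iff by blast
  have "openin (top_of_set S) (S \<inter> T)"
    using T(1) by (rule openin_open_Int)
  moreover have "S \<inter> T \<subseteq> {x \<in> S. P (f x)}"
  proof
    fix q
    assume q: "q \<in> S \<inter> T"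
    then have "f q = f x"
      using T(3) by blast
    then show "q \<in> {x \<in> S. P (f x)}"
      using q x by simp
  qed
  ultimately show "\<exists>T. openin (top_of_set S) T \<and> x \<in> T \<and> T \<subseteq> {x \<in> S. P (f x)}"
    using x T(2) by blast
qed

lemma locally_constant_on_imp_continuous:
  assumes "locally_constant_on S f"
  shows "continuous_on S f"
  unfolding continuous_on_def
proof
  fix x
  assume "x \<in> S"
  then have "\<forall>\<^sub>F q in at x within S. f q = f x"
    using assms by (simp add: locally_constant_on_def)
  then show "(f \<longlongrightarrow> f x) (at x within S)"
    by (rule tendsto_eventually)
qed

lemma locally_constant_on_diff:
  assumes "locally_constant_on S f" "locally_constant_on S g"
  shows "locally_constant_on S (\<lambda>x. f x - g x)"
  using assms unfolding locally_constant_on_def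
  by (auto elim!: ballE eventually_elim2)

subsection \<open>Primitives\<close>

text \<open>The difference of two primitives is locally constant on the support and on every band,
  so its level set through \<open>p\<close> is open in the quotient.\<close>

lemma dx_primitive_diff:
  assumes "dx_primitive Y U f" "dx_primitive Y V h" "p \<in> U \<inter> V"
  shows "\<exists>W. openin (space_of Y) W \<and> p \<in> W \<and> W \<subseteq> U \<inter> V \<and> (\<forall>q\<in>W. f q - h q = f p - h p)"
proof -
  let ?W = "{q \<in> U \<inter> V. f q - h q = f p - h p}"
  have op: "openin (space_of Y) (U \<inter> V)"
    using assms by (auto simp: dx_primitive_def)
  have "openin (space_of Y) ?W"
    unfolding openin_space_of
  proof (intro conjI ballI)
    show "?W \<subseteq> points Y"
      using op by (auto simp: openin_space_of)
    let ?S = "{x \<in> support Y. Inl x \<in> U \<inter> V}"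
    have "locally_constant_on ?S (\<lambda>x. f (Inl x) - x)" "locally_constant_on ?S (\<lambda>x. h (Inl x) - x)"
      using assms by (auto simp: dx_primitive_def elim: locally_constant_on_subset)
    then have "locally_constant_on ?S (\<lambda>x. (f (Inl x) - x) - (h (Inl x) - x))"
      by (rule locally_constant_on_diff)
    then have "openin (top_of_set ?S) {x \<in> ?S. f (Inl x) - h (Inl x) = f p - h p}"
      using openin_locally_constant[of ?S "\<lambda>x. (f (Inl x) - x) - (h (Inl x) - x)" "\<lambda>c. c = f p - h p"]
      by simp
    moreover have "openin (top_of_set (support Y)) ?S"
      using op by (simp add: openin_space_of)
    ultimately show "openin (top_of_set (support Y)) {x \<in> support Y. Inl x \<in> ?W}"
      using openin_trans by (simp add: conj_assoc)
  next
    fix B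
    assume B: "B \<in> bands Y"
    let ?S = "{q \<in> rect B. glue B q \<in> U \<inter> V}"
    have "locally_constant_on ?S (\<lambda>q. f (glue B q) - fst q)" "locally_constant_on ?S (\<lambda>q. h (glue B q) - fst q)"
      using assms B by (auto simp: dx_primitive_def elim: locally_constant_on_subset)
    then have "locally_constant_on ?S (\<lambda>q. (f (glue B q) - fst q) - (h (glue B q) - fst q))"
      by (rule locally_constant_on_diff)
    then have "openin (top_of_set ?S) {q \<in> ?S. f (glue B q) - h (glue B q) = f p - h p}"
      using openin_locally_constant[of ?S "\<lambda>q. (f (glue B q) - fst q) - (h (glue B q) - fst q)" "\<lambda>c. c = f p - h p"]
      by simp
    moreover have "openin (top_of_set (rect B)) ?S"
      using op B by (simp add: openin_space_of)
    ultimately show "openin (top_of_set (rect B)) {q \<in> rect B. glue B q \<in> ?W}"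
      using openin_trans by (simp add: conj_assoc)
  qed
  then show ?thesis
    using assms(3) by (intro exI[of _ ?W]) auto
qed

lemma openin_space_of_preimage:
  assumes U: "openin (space_of Y) U" and "open V"
    and "continuous_on {x \<in> support Y. Inl x \<in> U} (\<lambda>x. f (Inl x))"
    and "\<And>B. B \<in> bands Y \<Longrightarrow> continuous_on {p \<in> rect B. glue B p \<in> U} (\<lambda>p. f (glue B p))"
  shows "openin (space_of Y) {p \<in> U. f p \<in> V}"
  unfolding openin_space_of
proof (intro conjI ballI)
  show "{p \<in> U. f p \<in> V} \<subseteq> points Y"
    using U by (auto simp: openin_space_of)
  let ?S = "{x \<in> support Y. Inl x \<in> U}"
  have "openin (top_of_set ?S) (?S \<inter> (\<lambda>x. f (Inl x)) -` V)"
    using assms by (intro continuous_openin_preimage_gen)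
  moreover have "openin (top_of_set (support Y)) ?S"
    using U by (simp add: openin_space_of)
  ultimately have "openin (top_of_set (support Y)) (?S \<inter> (\<lambda>x. f (Inl x)) -` V)"
    by (rule openin_trans)
  moreover have "?S \<inter> (\<lambda>x. f (Inl x)) -` V = {x \<in> support Y. Inl x \<in> {p \<in> U. f p \<in> V}}"
    by auto
  ultimately show "openin (top_of_set (support Y)) {x \<in> support Y. Inl x \<in> {p \<in> U. f p \<in> V}}"
    by simp
next
  fix B
  assume B: "B \<in> bands Y"
  let ?S = "{p \<in> rect B. glue B p \<in> U}"
  have "openin (top_of_set ?S) (?S \<inter> (\<lambda>p. f (glue B p)) -` V)"
    using assms B by (intro continuous_openin_preimage_gen)
  moreover have "openin (top_of_set (rect B)) ?S"
    using U B by (simp add: openin_space_of)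
  ultimately have "openin (top_of_set (rect B)) (?S \<inter> (\<lambda>p. f (glue B p)) -` V)"
    by (rule openin_trans)
  moreover have "?S \<inter> (\<lambda>p. f (glue B p)) -` V = {p \<in> rect B. glue B p \<in> {p \<in> U. f p \<in> V}}"
    by auto
  ultimately show "openin (top_of_set (rect B)) {p \<in> rect B. glue B p \<in> {p \<in> U. f p \<in> V}}"
    by simp
qed

lemma openin_dx_primitive_preimage:
  assumes "dx_primitive Y U f" "open V"
  shows "openin (space_of Y) {p \<in> U. f p \<in> V}"
proof (rule openin_space_of_preimage[OF _ assms(2)])
  show "openin (space_of Y) U"
    using assms(1) by (simp add: dx_primitive_def)
  have "continuous_on {x \<in> support Y. Inl x \<in> U} (\<lambda>x. (f (Inl x) - x) + x)"
    using assms(1) by (intro continuous_on_add continuous_on_id locally_constant_on_imp_continuous)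
      (simp add: dx_primitive_def)
  then show "continuous_on {x \<in> support Y. Inl x \<in> U} (\<lambda>x. f (Inl x))"
    by simp
  fix B
  assume "B \<in> bands Y"
  then have "continuous_on {p \<in> rect B. glue B p \<in> U} (\<lambda>p. (f (glue B p) - fst p) + fst p)"
    using assms(1) by (intro continuous_on_add continuous_on_fst continuous_on_id locally_constant_on_imp_continuous)
      (simp add: dx_primitive_def)
  then show "continuous_on {p \<in> rect B. glue B p \<in> U} (\<lambda>p. f (glue B p))"
    by simp
qed

lemma openin_curve_preimage:
  fixes S :: "real set"
  assumes "continuous_map (top_of_set S) X c" "openin X U" "t \<in> S" "c t \<in> U"
  shows "\<exists>e>0. \<forall>t'\<in>S. \<bar>t' - t\<bar> < e \<longrightarrow> c t' \<in> U"
proof -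
  have "openin (top_of_set S) {t \<in> S. c t \<in> U}"
    using openin_continuous_map_preimage[OF assms(1,2)] by simp
  then show ?thesis
    using assms(3,4) unfolding openin_euclidean_subtopology_iff by (force simp: dist_real_def)
qed

locale band_complex =
  fixes Y :: band_union
  assumes union_of_bands: "union_of_bands Y"
begin

lemma finite_bands: "finite (bands Y)"
  using union_of_bands by (simp add: union_of_bands_def)

lemma base_support: "B \<in> bands Y \<Longrightarrow> t \<in> {lo B..hi B} \<Longrightarrow> t + shift B e \<in> support Y"
proof -
  assume "B \<in> bands Y" "t \<in> {lo B..hi B}"
  then have "base B e \<subseteq> support Y" "t + shift B e \<in> base B e"
    using union_of_bands by (simp_all add: union_of_bands_def base_def)
  then show ?thesis by blast
qed

text \<open>The rectangles are disjoint and equally high, so the first coordinate alone identifies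
  the band.\<close>

lemma band_at:
  assumes "B \<in> bands Y" "x \<in> {lo B..hi B}"
  shows "band_at Y x = B"
  unfolding band_at_def
proof (rule the_equality)
  fix B'
  assume B': "B' \<in> bands Y \<and> x \<in> {lo B'..hi B'}"
  then have "(x, 0) \<in> rect B \<inter> rect B'"
    using assms by (auto simp: rect_def)
  then show "B' = B"
    using union_of_bands assms(1) B' by (fastforce simp: union_of_bands_def pairwise_def disjnt_def)
qed (use assms in blast)

lemma topspace: "topspace (space_of Y) = points Y"
  using union_of_bands by (rule topspace_space_of)

lemma glue_eq_Inr: "glue B p = Inr q \<longleftrightarrow> q = p \<and> snd p \<noteq> 0 \<and> snd p \<noteq> 1"
  by (auto simp: glue_def)

lemma glue_points: "B \<in> bands Y \<Longrightarrow> p \<in> rect B \<Longrightarrow> glue B p \<in> points Y"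
  by (auto simp: points_def)

lemma Inl_points: "x \<in> support Y \<Longrightarrow> Inl x \<in> points Y"
  by (auto simp: points_def)

lemma pointsE:
  assumes "p \<in> points Y"
  obtains x where "x \<in> support Y" "p = Inl x"
  | B q where "B \<in> bands Y" "q \<in> rect B" "0 < snd q" "snd q < 1" "p = Inr q" "band_at Y (fst q) = B" "p = glue B q"
proof -
  consider x where "x \<in> support Y" "p = Inl x" | B q where "B \<in> bands Y" "q \<in> rect B" "p = glue B q"
    using assms by (auto simp: points_def)
  then show thesis
  proof cases
    case (2 B q)
    then have q: "fst q \<in> {lo B..hi B}" "0 \<le> snd q" "snd q \<le> 1"
      by (auto simp: rect_def)
    consider "snd q = 0" | "snd q = 1" | "0 < snd q" "snd q < 1"
      using q by linarith
    then show thesis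
    proof cases
      case 3
      then show thesis
        using that(2)[OF 2(1,2)] 2(3) band_at[OF 2(1) q(1)] by (simp add: glue_def)
    qed (use that(1) 2 q base_support[OF 2(1) q(1)] in \<open>auto simp: glue_def\<close>)
  qed (rule that(1))
qed

lemma Inl_points_iff: "Inl x \<in> points Y \<longleftrightarrow> x \<in> support Y"
  by (auto elim: pointsE intro: Inl_points)

lemma base_position_glue:
  assumes "B \<in> bands Y" "p \<in> rect B"
  shows "base_position Y (glue B p) = fst p + shift B (snd p > 1/2)"
  using assms band_at[OF assms(1), of "fst p"] by (auto simp: base_position_def glue_def rect_def)

lemma vertex_base_position: "p \<in> points Y \<Longrightarrow> (vertex Y p, base_position Y p) \<in> leaf_rel Y"
proof (erule pointsE)
  fix B q
  assume "B \<in> bands Y" "q \<in> rect B" "p = Inr q" "band_at Y (fst q) = B"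
  then show "(vertex Y p, base_position Y p) \<in> leaf_rel Y"
    using leaf_rel_band[of B Y "fst q"] by (auto simp: vertex_def base_position_def rect_def)
qed (auto simp: vertex_def base_position_def leaf_rel_refl)

lemma vertex_glue:
  assumes "B \<in> bands Y" "t \<in> {lo B..hi B}" "y \<in> {0..1}"
  shows "(t + shift B False, vertex Y (glue B (t, y))) \<in> leaf_rel Y"
  using leaf_rel_band[OF assms(1,2)] band_at[OF assms(1,2)] leaf_rel_refl
  by (auto simp: vertex_def glue_def)

lemma vertex_support: "p \<in> points Y \<Longrightarrow> vertex Y p \<in> support Y"
  by (erule pointsE) (auto simp: vertex_def rect_def intro!: base_support)

lemma chart_dx_primitive:
  assumes "(U, h) \<in> charts Y"
  shows "dx_primitive Y U h"
proof -
  let ?U0 = "{p \<in> points Y. \<forall>q. p = Inr q \<longrightarrow> snd q \<noteq> 1/2}" and ?U1 = "{p \<in> points Y. \<exists>q. p = Inr q}"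
  have pre0: "{p \<in> rect B. glue B p \<in> ?U0} = rect B \<inter> {p. snd p \<noteq> 1/2}" if "B \<in> bands Y" for B
    by (auto simp: glue_points[OF that] glue_eq_Inr)
  have pre1: "{p \<in> rect B. glue B p \<in> ?U1} = rect B \<inter> {p. snd p \<noteq> 0 \<and> snd p \<noteq> 1}" if "B \<in> bands Y" for B
    by (auto simp: glue_points[OF that] glue_eq_Inr)
  have "open {p :: real \<times> real. snd p \<noteq> c}" for c
    by (intro open_Collect_neq continuous_intros)
  then have op: "openin (top_of_set S) (S \<inter> {p :: real \<times> real. snd p \<noteq> c})" for S c
    by (rule openin_open_Int)
  have op2: "openin (top_of_set S) (S \<inter> {p :: real \<times> real. snd p \<noteq> c \<and> snd p \<noteq> d})" for S c d
  proof -
    have "S \<inter> {p :: real \<times> real. snd p \<noteq> c \<and> snd p \<noteq> d} = (S \<inter> {p. snd p \<noteq> c}) \<inter> (S \<inter> {p. snd p \<noteq> d})"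
      by auto
    then show ?thesis
      using openin_Int[OF op op] by simp
  qed
  have s0: "{x \<in> support Y. Inl x \<in> ?U0} = support Y" and s1: "{x \<in> support Y. Inl x \<in> ?U1} = {}"
    by (auto simp: Inl_points_iff)
  have "dx_primitive Y ?U0 (base_position Y)"
    unfolding dx_primitive_def
  proof (intro conjI ballI)
    show "openin (space_of Y) ?U0"
      unfolding openin_space_of s0
    proof (intro conjI ballI)
      fix B assume "B \<in> bands Y"
      then show "openin (top_of_set (rect B)) {p \<in> rect B. glue B p \<in> ?U0}"
        by (simp only: pre0 op)
    qed auto
    show "locally_constant_on {x \<in> support Y. Inl x \<in> ?U0} (\<lambda>x. base_position Y (Inl x) - x)"
      by (simp add: base_position_def locally_constant_on_def)
    fix B
    assume B: "B \<in> bands Y"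
    show "locally_constant_on {p \<in> rect B. glue B p \<in> ?U0} (\<lambda>p. base_position Y (glue B p) - fst p)"
      unfolding pre0[OF B] locally_constant_on_iff
    proof
      fix p
      assume p: "p \<in> rect B \<inter> {p. snd p \<noteq> 1/2}"
      show "\<exists>T. open T \<and> p \<in> T \<and> (\<forall>q\<in>T \<inter> (rect B \<inter> {p. snd p \<noteq> 1/2}). base_position Y (glue B q) - fst q = base_position Y (glue B p) - fst p)"
      proof (cases "snd p > 1/2")
        case True
        have "open {q :: real \<times> real. snd q > 1/2}"
          by (intro open_Collect_less continuous_intros)
        then show ?thesis
          using True p B by (intro exI[of _ "{q. snd q > 1/2}"]) (auto simp: base_position_glue)
      next
        case False
        have "open {q :: real \<times> real. snd q < 1/2}"
          by (intro open_Collect_less continuous_intros)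
        then show ?thesis
          using False p B by (intro exI[of _ "{q. snd q < 1/2}"]) (auto simp: base_position_glue)
      qed
    qed
  qed
  moreover have "dx_primitive Y ?U1 band_position"
    unfolding dx_primitive_def
  proof (intro conjI ballI)
    show "openin (space_of Y) ?U1"
      unfolding openin_space_of s1
    proof (intro conjI ballI)
      fix B assume "B \<in> bands Y"
      then show "openin (top_of_set (rect B)) {p \<in> rect B. glue B p \<in> ?U1}"
        by (simp only: pre1 op2)
    qed auto
    show "locally_constant_on {x \<in> support Y. Inl x \<in> ?U1} (\<lambda>x. band_position (Inl x) - x)"
      unfolding s1 by (simp add: locally_constant_on_def)
    fix B
    assume B: "B \<in> bands Y"
    have "band_position (glue B q) - fst q = 0" if "q \<in> rect B \<inter> {p. snd p \<noteq> 0 \<and> snd p \<noteq> 1}" for q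
      using that by (auto simp: glue_def band_position_def)
    then show "locally_constant_on {p \<in> rect B. glue B p \<in> ?U1} (\<lambda>p. band_position (glue B p) - fst p)"
      unfolding pre1[OF B] by (rule locally_constant_onI)
  qed
  ultimately show ?thesis
    using assms by (auto simp: charts_def)
qed

lemma chart_exists: "p \<in> points Y \<Longrightarrow> \<exists>U h. (U, h) \<in> charts Y \<and> p \<in> U"
  by (cases p) (auto simp: charts_def)

lemma chart_vertex:
  assumes "(U, h) \<in> charts Y" "p \<in> U" "q \<in> U" "h p = h q"
  shows "(vertex Y p, vertex Y q) \<in> leaf_rel Y"
proof -
  have pq: "p \<in> points Y" "q \<in> points Y"
    using assms by (auto simp: charts_def)
  from assms(1) consider "h = base_position Y" | "U = {p \<in> points Y. \<exists>q. p = Inr q}" "h = band_position"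
    by (auto simp: charts_def)
  then show ?thesis
  proof cases
    case 1
    then show ?thesis
      using vertex_base_position[OF pq(1)] vertex_base_position[OF pq(2)] assms(4)
      by (metis leaf_rel_sym leaf_rel_trans)
  next
    case 2
    then have "vertex Y p = vertex Y q"
      using assms by (auto simp: vertex_def band_position_def)
    then show ?thesis
      by (simp add: leaf_rel_refl)
  qed
qed

lemma countable_chart_leaf:
  assumes "(U, h) \<in> charts Y"
  shows "countable (h ` (leaf_of Y x \<inter> U))"
proof -
  let ?V = "leaf_rel Y `` {x}"
  have V: "countable ?V"
    using finite_bands by (rule countable_leaf_rel)
  from assms consider "h = base_position Y" | "U = {p \<in> points Y. \<exists>q. p = Inr q}" "h = band_position"
    by (auto simp: charts_def)
  then show ?thesis
  proof cases
    case 1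
    have "h ` (leaf_of Y x \<inter> U) \<subseteq> ?V"
      using vertex_base_position by (auto simp: 1 leaf_of_def intro: leaf_rel_trans)
    then show ?thesis
      using V countable_subset by blast
  next
    case 2
    have "h ` (leaf_of Y x \<inter> U) \<subseteq> (\<Union>B\<in>bands Y. (\<lambda>v. v - shift B False) ` ?V)"
    proof
      fix z
      assume "z \<in> h ` (leaf_of Y x \<inter> U)"
      then obtain q where q: "Inr q \<in> points Y" "(x, vertex Y (Inr q)) \<in> leaf_rel Y" "z = fst q"
        using 2 by (auto simp: leaf_of_def band_position_def)
      then have "band_at Y (fst q) \<in> bands Y"
        by (auto elim: pointsE)
      moreover have "z = vertex Y (Inr q) - shift (band_at Y (fst q)) False"
        using q by (simp add: vertex_def)
      ultimately show "z \<in> (\<Union>B\<in>bands Y. (\<lambda>v. v - shift B False) ` ?V)"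
        using q(2) by blast
    qed
    moreover have "countable (\<Union>B\<in>bands Y. (\<lambda>v. v - shift B False) ` ?V)"
      using V by (intro countable_UN countable_finite[OF finite_bands] countable_image)
    ultimately show ?thesis
      by (rule countable_subset)
  qed
qed

text \<open>More general than a single leaf because annulus-freeness also requires curves in the
  union of the singular leaves.\<close>

definition countably_many_leaves :: "point set \<Rightarrow> bool" where
  "countably_many_leaves M \<longleftrightarrow> (\<exists>N. countable N \<and> M \<subseteq> (\<Union>x\<in>N. leaf_of Y x))"

lemma countable_chart:
  assumes "(U, h) \<in> charts Y" "countably_many_leaves M"
  shows "countable (h ` (M \<inter> U))"
proof -
  obtain N where N: "countable N" "M \<subseteq> (\<Union>x\<in>N. leaf_of Y x)"
    using assms(2) by (auto simp: countably_many_leaves_def)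
  have "h ` (M \<inter> U) \<subseteq> (\<Union>x\<in>N. h ` (leaf_of Y x \<inter> U))"
    using N(2) by blast
  moreover have "countable (\<Union>x\<in>N. h ` (leaf_of Y x \<inter> U))"
    using N(1) countable_chart_leaf[OF assms(1)] by (intro countable_UN)
  ultimately show ?thesis
    by (rule countable_subset)
qed

lemma countably_many_leaves_leaf_of: "M \<subseteq> leaf_of Y x \<Longrightarrow> countably_many_leaves M"
  unfolding countably_many_leaves_def by (intro exI[of _ "{x}"]) auto

text \<open>Near \<open>t\<close> the chart coordinate is a continuous function on an interval with
  countably many values, hence constant.\<close>

lemma chart_constant:
  fixes S :: "real set"
  assumes c: "continuous_map (top_of_set S) (space_of Y) c" "connected S" "countably_many_leaves (c ` S)"
    and Uh: "(U, h) \<in> charts Y" and t: "t \<in> S" "c t \<in> U"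
  shows "\<exists>e>0. \<forall>t'\<in>S. \<bar>t' - t\<bar> < e \<longrightarrow> c t' \<in> U \<and> h (c t') = h (c t)"
proof -
  have prim: "dx_primitive Y U h"
    using Uh by (rule chart_dx_primitive)
  then obtain e where e: "e > 0" "\<And>t'. t' \<in> S \<Longrightarrow> \<bar>t' - t\<bar> < e \<Longrightarrow> c t' \<in> U"
    using openin_curve_preimage[OF c(1) _ t] unfolding dx_primitive_def by metis
  let ?T = "S \<inter> {t - e<..<t + e}"
  have "is_interval ?T"
    using c(2) by (intro is_interval_Int is_interval_connected_1[THEN iffD2]) auto
  then have conn: "connected ?T"
    by (simp add: is_interval_connected_1)
  have U: "c t' \<in> U" if "t' \<in> ?T" for t'
    using e(2) that by auto
  have "continuous_on ?T (h \<circ> c)"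
  proof (subst continuous_on_open_gen[of _ _ UNIV], simp, intro allI impI)
    fix V :: "real set"
    assume "openin (top_of_set UNIV) V"
    then have V: "open V"
      by simp
    have "openin (top_of_set S) {t' \<in> S. c t' \<in> {p \<in> U. h p \<in> V}}"
      using openin_continuous_map_preimage[OF c(1) openin_dx_primitive_preimage[OF prim V]] by simp
    then obtain N where "open N" "{t' \<in> S. c t' \<in> {p \<in> U. h p \<in> V}} = S \<inter> N"
      unfolding openin_open by blast
    then have "openin (top_of_set ?T) (?T \<inter> {t' \<in> S. c t' \<in> {p \<in> U. h p \<in> V}})"
      unfolding openin_open by (intro exI[of _ N]) auto
    moreover have "?T \<inter> {t' \<in> S. c t' \<in> {p \<in> U. h p \<in> V}} = ?T \<inter> (h \<circ> c) -` V"
      using U by auto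
    ultimately show "openin (top_of_set ?T) (?T \<inter> (h \<circ> c) -` V)"
      by simp
  qed
  then have "connected ((h \<circ> c) ` ?T)"
    using conn by (rule connected_continuous_image)
  moreover have "countable ((h \<circ> c) ` ?T)"
    by (rule countable_subset[OF _ countable_chart[OF Uh c(3)]]) (use U in auto)
  ultimately have "h (c t') = h (c t)" if "t' \<in> ?T" for t'
    using connected_uncountable[of "(h \<circ> c) ` ?T" "h (c t')" "h (c t)"] that t(1) e(1) by force
  then show ?thesis
    using e U by (intro exI[of _ e]) (auto simp: abs_less_iff)
qed

text \<open>Locally every primitive is a chart coordinate up to a constant, and along such a path
  chart coordinates are locally constant.\<close>

lemma dx_zero_along_leaves:
  assumes "pathin (space_of Y) g" "countably_many_leaves (g ` {0..1})"
  shows "dx_zero_along Y g"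
  unfolding dx_zero_along_def locally_constant_on_iff
proof (intro allI impI ballI)
  fix U f t
  assume f: "dx_primitive Y U f" and t: "t \<in> {t \<in> {0..1}. g t \<in> U}"
  have g: "continuous_map (top_of_set {0..1}) (space_of Y) g"
    using assms(1) by (simp add: pathin_def)
  have "g t \<in> points Y"
    using t f by (auto simp: dx_primitive_def openin_space_of)
  then obtain V h where Vh: "(V, h) \<in> charts Y" "g t \<in> V"
    using chart_exists by blast
  obtain W where W: "openin (space_of Y) W" "g t \<in> W" "\<forall>q\<in>W. f q - h q = f (g t) - h (g t)"
    using dx_primitive_diff[OF f chart_dx_primitive[OF Vh(1)], of "g t"] t Vh by blast
  obtain e1 where e1: "e1 > 0" "\<forall>t'\<in>{0..1}. \<bar>t' - t\<bar> < e1 \<longrightarrow> g t' \<in> V \<and> h (g t') = h (g t)"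
    using chart_constant[OF g _ assms(2) Vh(1)] t Vh by auto
  obtain e2 where e2: "e2 > 0" "\<forall>t'\<in>{0..1}. \<bar>t' - t\<bar> < e2 \<longrightarrow> g t' \<in> W"
    using openin_curve_preimage[OF g W(1)] t W(2) by auto
  have "(f \<circ> g) t' = (f \<circ> g) t" if "t' \<in> {0..1}" "\<bar>t' - t\<bar> < min e1 e2" for t'
  proof -
    have "g t' \<in> W" "h (g t') = h (g t)"
      using e1 e2 that by auto
    then have "f (g t') - h (g t) = f (g t) - h (g t)"
      using W(3) by metis
    then show ?thesis by simp
  qed
  then show "\<exists>T. open T \<and> t \<in> T \<and> (\<forall>q\<in>T \<inter> {t \<in> {0..1}. g t \<in> U}. (f \<circ> g) q = (f \<circ> g) t)"
    using e1(1) e2(1) by (intro exI[of _ "ball t (min e1 e2)"]) (auto simp: dist_real_def abs_minus_commute)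
qed

text \<open>Lying in one leaf is an equivalence relation on the parameter interval. It holds
  locally, since charts are primitives and equal chart coordinates mean equal leaves; connectedness
  makes it global.\<close>

lemma dx_zero_along_vertex:
  assumes "pathin (space_of Y) g" "dx_zero_along Y g"
  shows "(vertex Y (g 0), vertex Y (g 1)) \<in> leaf_rel Y"
proof (rule connected_equivalence_relation[of "{0..1::real}" 0 1 "\<lambda>t t'. (vertex Y (g t), vertex Y (g t')) \<in> leaf_rel Y"])
  fix t :: real
  assume t: "t \<in> {0..1}"
  have g: "continuous_map (top_of_set {0..1}) (space_of Y) g"
    using assms(1) by (simp add: pathin_def)
  have "g t \<in> points Y"
    using g t by (auto simp: continuous_map_def topspace)
  then obtain U h where Uh: "(U, h) \<in> charts Y" "g t \<in> U"
    using chart_exists by blast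
  note prim = chart_dx_primitive[OF Uh(1)]
  then have "locally_constant_on {t \<in> {0..1}. g t \<in> U} (h \<circ> g)"
    using assms(2) by (auto simp: dx_zero_along_def)
  then obtain T where T: "open T" "t \<in> T" "\<forall>q\<in>T \<inter> {t \<in> {0..1}. g t \<in> U}. h (g q) = h (g t)"
    using t Uh(2) by (auto simp: locally_constant_on_iff)
  have "openin (top_of_set {0..1}) {t \<in> {0..1}. g t \<in> U}"
    using openin_continuous_map_preimage[OF g, of U] prim by (simp add: dx_primitive_def)
  then have "openin (top_of_set {0..1}) ({t \<in> {0..1}. g t \<in> U} \<inter> ({0..1} \<inter> T))"
    using T(1) by (intro openin_Int openin_open_Int)
  moreover have "t \<in> {t \<in> {0..1}. g t \<in> U} \<inter> ({0..1} \<inter> T)"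
    using t T(2) Uh(2) by blast
  moreover have "\<forall>t'\<in>{t \<in> {0..1}. g t \<in> U} \<inter> ({0..1} \<inter> T). (vertex Y (g t), vertex Y (g t')) \<in> leaf_rel Y"
  proof
    fix t'
    assume t': "t' \<in> {t \<in> {0..1}. g t \<in> U} \<inter> ({0..1} \<inter> T)"
    then have "h (g t) = h (g t')" "g t' \<in> U"
      using T(3) by force+
    then show "(vertex Y (g t), vertex Y (g t')) \<in> leaf_rel Y"
      using chart_vertex[OF Uh] by blast
  qed
  ultimately show "\<exists>S. openin (top_of_set {0..1}) S \<and> t \<in> S \<and> (\<forall>t'\<in>S. (vertex Y (g t), vertex Y (g t')) \<in> leaf_rel Y)"
    by blast
qed (auto intro: leaf_rel_sym leaf_rel_trans)

subsection \<open>Embedding into Euclidean space\<close>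

lemma continuous_map_space_of:
  fixes f :: "point \<Rightarrow> 'b::topological_space"
  assumes "continuous_on (support Y) (\<lambda>x. f (Inl x))"
    and "\<And>B. B \<in> bands Y \<Longrightarrow> continuous_on (rect B) (\<lambda>p. f (glue B p))"
  shows "continuous_map (space_of Y) euclidean f"
  unfolding continuous_map_def
proof (intro conjI allI impI)
  fix V :: "'b set"
  assume "openin euclidean V"
  then have "open V" by simp
  moreover have "{x \<in> support Y. Inl x \<in> points Y} = support Y"
    "{p \<in> rect B. glue B p \<in> points Y} = rect B" if "B \<in> bands Y" for B
    using that by (auto simp: points_def)
  ultimately show "openin (space_of Y) {p \<in> topspace (space_of Y). f p \<in> V}"
    using assms openin_topspace[of "space_of Y"]
    by (intro openin_space_of_preimage) (auto simp: topspace Inl_points_iff glue_points)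
qed simp

lemma continuous_map_glue:
  assumes "B \<in> bands Y"
  shows "continuous_map (top_of_set (rect B)) (space_of Y) (glue B)"
  unfolding continuous_map_def
  using assms by (auto simp: topspace glue_points openin_space_of)

lemma continuous_map_Inl: "continuous_map (top_of_set (support Y)) (space_of Y) Inl"
  unfolding continuous_map_def by (auto simp: topspace Inl_points openin_space_of)

lemma compact_space: "compact_space (space_of Y)"
proof -
  obtain F where F: "finite F" "\<forall>I\<in>F. \<exists>u v. u \<le> v \<and> I = {u..v}" "support Y = \<Union>F"
    using union_of_bands by (auto simp: union_of_bands_def multi_interval_def)
  have "compact (support Y)"
    unfolding F(3) using F(1,2) by (intro compact_Union) auto
  then have "compactin (space_of Y) (Inl ` support Y)"
    by (intro image_compactin[OF _ continuous_map_Inl]) (simp add: compactin_subtopology)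
  moreover have "compactin (space_of Y) (glue B ` rect B)" if "B \<in> bands Y" for B
  proof (rule image_compactin[OF _ continuous_map_glue[OF that]])
    have "compact (rect B)"
      unfolding rect_def by (intro compact_Times compact_Icc)
    then show "compactin (top_of_set (rect B)) (rect B)"
      by (simp add: compactin_subtopology)
  qed
  ultimately have D: "compactin (space_of Y) (Inl ` support Y)"
    and K: "\<And>B. B \<in> bands Y \<Longrightarrow> compactin (space_of Y) (glue B ` rect B)"
    by blast+
  have "compactin (space_of Y) (\<Union>B\<in>bands Y. glue B ` rect B)"
  proof (rule compactin_Union)
    show "finite ((\<lambda>B. glue B ` rect B) ` bands Y)"
      using finite_bands by (rule finite_imageI)
  qed (use K in blast)
  then have "compactin (space_of Y) (points Y)"
    unfolding points_def by (rule compactin_Un[OF D])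
  then show ?thesis
    by (simp add: compact_space_def topspace)
qed

text \<open>Transfers the Hausdorff property and the existence of arcs from Euclidean space. The
  first coordinate interpolates between the two gluings. The others carry the factor
  \<open>snd p * (1 - snd p)\<close>, which vanishes on the bases and so respects the gluing, and
  which in the interior allows the height and the number of the band to be recovered.\<close>

lemma embedding_exists:
  "\<exists>f :: point \<Rightarrow> real \<times> real \<times> real \<times> real. embedding_map (space_of Y) euclidean f"
proof -
  obtain idx :: "band \<Rightarrow> nat" where idx: "inj_on idx (bands Y)"
    using finite_imp_inj_to_nat_seg[OF finite_bands] by blast
  define e where "e B p = (fst p + (1 - snd p) * shift B False + snd p * shift B True,
      snd p * (1 - snd p), snd p * (1 - snd p) * snd p, snd p * (1 - snd p) * real (idx B))"
    for B and p :: "real \<times> real"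
  define f where "f p = (case p of Inl x \<Rightarrow> (x, 0, 0, 0) | Inr q \<Rightarrow> e (band_at Y (fst q)) q)" for p :: point
  have f_glue: "f (glue B p) = e B p" if "B \<in> bands Y" "p \<in> rect B" for B p
    using that band_at[of B "fst p"] by (auto simp: f_def e_def glue_def rect_def)
  have cont: "continuous_map (space_of Y) euclidean f"
  proof (rule continuous_map_space_of)
    show "continuous_on (support Y) (\<lambda>x. f (Inl x))"
      by (auto simp: f_def intro!: continuous_intros)
    fix B
    assume "B \<in> bands Y"
    then have "continuous_on (rect B) (\<lambda>p. f (glue B p)) = continuous_on (rect B) (e B)"
      by (intro continuous_on_cong refl f_glue)
    moreover have "continuous_on (rect B) (e B)"
      unfolding e_def by (intro continuous_intros)
    ultimately show "continuous_on (rect B) (\<lambda>p. f (glue B p))"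
      by simp
  qed
  have "inj_on f (points Y)"
  proof (rule inj_onI)
    fix p p'
    assume p: "p \<in> points Y" and p': "p' \<in> points Y" and eq: "f p = f p'"
    have eqI: "p = p'" if p: "p = Inr q" "q \<in> rect B" "0 < snd q" "snd q < 1" "B \<in> bands Y" "band_at Y (fst q) = B"
        and p': "p' = Inr q'" "q' \<in> rect B'" "0 < snd q'" "snd q' < 1" "B' \<in> bands Y" "band_at Y (fst q') = B'"
      for q q' B B'
    proof -
      have e: "e B q = e B' q'"
        using eq p p' by (simp add: f_def)
      then have phi: "snd q * (1 - snd q) = snd q' * (1 - snd q')"
        by (simp add: e_def)
      have pos: "snd q * (1 - snd q) > 0"
        using p by simp
      have "snd q * (1 - snd q) * snd q = snd q * (1 - snd q) * snd q'"
        using e unfolding e_def prod.inject phi by blast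
      then have s: "snd q = snd q'"
        using pos by (metis mult_left_cancel less_irrefl)
      have "snd q * (1 - snd q) * real (idx B) = snd q * (1 - snd q) * real (idx B')"
        using e unfolding e_def prod.inject phi by blast
      then have "idx B = idx B'"
        using pos by (metis mult_left_cancel less_irrefl of_nat_eq_iff)
      then have "B = B'"
        using idx p p' by (auto dest: inj_onD)
      then have "fst q = fst q'"
        using e s by (simp add: e_def)
      then show ?thesis
        using s p p' by (simp add: prod_eq_iff)
    qed
    have InrE: "\<exists>B. q \<in> rect B \<and> 0 < snd q \<and> snd q < 1 \<and> B \<in> bands Y \<and> band_at Y (fst q) = B"
      if "Inr q \<in> points Y" for q
      using that by (rule pointsE) auto
    have mixed: "f (Inl x) \<noteq> f (Inr q)" if "Inr q \<in> points Y" for x q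
      using InrE[OF that] by (auto simp: f_def e_def)
    show "p = p'"
    proof (cases p)
      case (Inl x)
      then obtain x' where x': "p' = Inl x'"
        using eq mixed p' by (cases p') auto
      then show ?thesis
        using eq Inl by (simp add: f_def)
    next
      case (Inr q)
      then obtain q' where q': "p' = Inr q'"
        using eq mixed[of q] p by (cases p') metis+
      show ?thesis
        using InrE[of q] InrE[of q'] p p' Inr q' eqI[of q _ q'] by metis
    qed
  qed
  then show ?thesis
    using cont compact_space by (intro exI[of _ f] continuous_imp_embedding_map) (simp_all add: topspace)
qed

lemma Hausdorff: "Hausdorff_space (space_of Y)"
proof -
  obtain f :: "point \<Rightarrow> real \<times> real \<times> real \<times> real" where f: "embedding_map (space_of Y) euclidean f"
    using embedding_exists by blast
  have "Hausdorff_space (subtopology euclidean (f ` topspace (space_of Y)))"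
    by (rule Hausdorff_space_subtopology) simp
  then show ?thesis
    using embedding_map_imp_homeomorphic_space[OF f] homeomorphic_Hausdorff_space by blast
qed

text \<open>\<open>vertical\<close> says something about injective paths only, so an arbitrary path
  between two points has to be replaced by an arc.\<close>

lemma path_connectedin_arc:
  assumes L: "path_connectedin (space_of Y) L" and pq: "p \<in> L" "q \<in> L" "p \<noteq> q"
  shows "\<exists>g. pathin (space_of Y) g \<and> inj_on g {0..1} \<and> g ` {0..1} \<subseteq> L \<and> g 0 = p \<and> g 1 = q"
proof -
  obtain f :: "point \<Rightarrow> real \<times> real \<times> real \<times> real" where "embedding_map (space_of Y) euclidean f"
    using embedding_exists by blast
  then obtain f' where f': "homeomorphic_maps (space_of Y) (subtopology euclidean (f ` points Y)) f f'"
    unfolding embedding_map_def homeomorphic_map_maps topspace by blast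
  have f'f: "f' (f p) = p" if "p \<in> points Y" for p
    using f' that by (auto simp: homeomorphic_maps_def topspace)
  have contf: "continuous_map (space_of Y) euclidean f"
    using f' by (auto simp: homeomorphic_maps_def continuous_map_in_subtopology)
  obtain g where g: "pathin (space_of Y) g" "g \<in> {0..1} \<rightarrow> L" "g 0 = p" "g 1 = q"
    using L pq unfolding path_connectedin by blast
  have LY: "L \<subseteq> points Y"
    using L by (auto simp: path_connectedin topspace)
  have "path (f \<circ> g)"
    using continuous_map_compose[OF g(1)[unfolded pathin_def] contf] unfolding path_def by simp
  moreover have "f p \<noteq> f q"
    using f'f pq LY by (metis subsetD)
  ultimately obtain a where a: "arc a" "path_image a \<subseteq> path_image (f \<circ> g)" "pathstart a = f p" "pathfinish a = f q"
    using path_contains_arc[of "f \<circ> g" "f p" "f q"] g(3,4) by (auto simp: pathstart_def pathfinish_def)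
  have fL: "a t \<in> f ` L" if "t \<in> {0..1}" for t
  proof -
    have "a t \<in> (f \<circ> g) ` {0..1}"
      using a(2) that unfolding path_image_def by blast
    then show ?thesis
      using g(2) by auto
  qed
  have "a \<in> {0..1} \<rightarrow> f ` points Y"
    using fL LY by blast
  then have "continuous_map (top_of_set {0..1}) (subtopology euclidean (f ` points Y)) a"
    using a(1) by (simp add: continuous_map_in_subtopology arc_def path_def)
  moreover have "continuous_map (subtopology euclidean (f ` points Y)) (space_of Y) f'"
    using f' by (simp add: homeomorphic_maps_def)
  ultimately have "pathin (space_of Y) (f' \<circ> a)"
    unfolding pathin_def by (rule continuous_map_compose)
  moreover have "inj_on (f' \<circ> a) {0..1}"
  proof (rule inj_onI)
    fix s t
    assume st: "s \<in> {0..1}" "t \<in> {0..1}" "(f' \<circ> a) s = (f' \<circ> a) t"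
    obtain y z where yz: "y \<in> L" "a s = f y" "z \<in> L" "a t = f z"
      using fL st by blast
    have "f' (f y) = y" "f' (f z) = z"
      using f'f LY yz by blast+
    then have "y = z"
      using st(3) yz by simp
    then have "a s = a t"
      using yz by simp
    moreover have "inj_on a {0..1}"
      using a(1) by (simp add: arc_def)
    ultimately show "s = t"
      using st by (simp add: inj_on_eq_iff)
  qed
  moreover have "(f' \<circ> a) ` {0..1} \<subseteq> L"
  proof
    fix z
    assume "z \<in> (f' \<circ> a) ` {0..1}"
    then obtain t y where "t \<in> {0..1}" "z = f' (a t)" "y \<in> L" "a t = f y"
      using fL by fastforce
    then show "z \<in> L"
      using f'f LY by auto
  qed
  moreover have "(f' \<circ> a) 0 = p" "(f' \<circ> a) 1 = q"
    using a(3,4) f'f pq LY by (auto simp: pathstart_def pathfinish_def)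
  ultimately show ?thesis
    by blast
qed

subsection \<open>The leaves\<close>

lemma vertical_vertex:
  assumes "vertical Y L" "p \<in> L" "q \<in> L"
  shows "(vertex Y p, vertex Y q) \<in> leaf_rel Y"
proof (cases "p = q")
  case False
  then obtain g where g: "pathin (space_of Y) g" "inj_on g {0..1}" "g ` {0..1} \<subseteq> L" "g 0 = p" "g 1 = q"
    using path_connectedin_arc assms by (metis vertical_def)
  then have "dx_zero_along Y g"
    using assms(1) by (auto simp: vertical_def)
  then show ?thesis
    using dx_zero_along_vertex g by blast
qed (simp add: leaf_rel_refl)

lemma vertical_subset_leaf_of:
  assumes "vertical Y L" "p \<in> L"
  shows "L \<subseteq> leaf_of Y (vertex Y p)"
proof
  fix q
  assume "q \<in> L"
  moreover have "L \<subseteq> points Y"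
    using assms(1) by (auto simp: vertical_def path_connectedin topspace)
  ultimately show "q \<in> leaf_of Y (vertex Y p)"
    using vertical_vertex[OF assms] by (auto simp: leaf_of_def)
qed

lemma vertical_subset:
  assumes "L \<subseteq> leaf_of Y x" "path_connectedin (space_of Y) L"
  shows "vertical Y L"
  unfolding vertical_def
  using assms dx_zero_along_leaves countably_many_leaves_leaf_of by (meson order_trans)

lemma glue_leaf_of:
  assumes "B \<in> bands Y" "t \<in> {lo B..hi B}" "y \<in> {0..1}" "(x, t + shift B e) \<in> leaf_rel Y"
  shows "glue B (t, y) \<in> leaf_of Y x"
proof -
  have "(x, vertex Y (glue B (t, y))) \<in> leaf_rel Y"
    using assms vertex_glue[OF assms(1-3)] leaf_rel_band[OF assms(1,2)] leaf_rel_trans by metis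
  then show ?thesis
    using glue_points[OF assms(1)] assms(2,3) by (auto simp: leaf_of_def rect_def)
qed

lemma path_component_of_arc:
  assumes B: "B \<in> bands Y" "t \<in> {lo B..hi B}" and x: "(x, t + shift B e) \<in> leaf_rel Y"
    and y: "y \<in> {0..1}" "y' \<in> {0..1}"
  shows "path_component_of (subtopology (space_of Y) (leaf_of Y x)) (glue B (t, y)) (glue B (t, y'))"
proof -
  let ?g = "\<lambda>s. glue B (t, (1 - s) * y + s * y')"
  have in01: "(1 - s) * y + s * y' \<in> {0..1}" if "s \<in> {0..1}" for s
  proof -
    have "0 \<le> (1 - s) * y + s * y'"
      using that y by simp
    moreover have "(1 - s) * y + s * y' \<le> (1 - s) * 1 + s * 1"
      using that y by (intro add_mono mult_left_mono) auto
    ultimately show ?thesis by simp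
  qed
  have "continuous_map (top_of_set {0..1}) (top_of_set (rect B)) (\<lambda>s. (t, (1 - s) * y + s * y'))"
    using B in01 by (auto simp: continuous_map_in_subtopology rect_def intro!: continuous_intros)
  then have "continuous_map (top_of_set {0..1}) (space_of Y) ?g"
    using continuous_map_compose[OF _ continuous_map_glue[OF B(1)]] unfolding o_def by blast
  then have "pathin (subtopology (space_of Y) (leaf_of Y x)) ?g"
    using glue_leaf_of[OF B _ x] in01 by (auto simp: pathin_def continuous_map_in_subtopology)
  then show ?thesis
    unfolding path_component_of_def by (intro exI[of _ ?g]) auto
qed

lemma glue_0: "glue B (t, 0) = Inl (t + shift B False)" and glue_1: "glue B (t, 1) = Inl (t + shift B True)"
  by (simp_all add: glue_def)

lemma path_component_of_leaf_rel:
  assumes "(x, y) \<in> leaf_rel Y" "x \<in> support Y"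
  shows "path_component_of (subtopology (space_of Y) (leaf_of Y x)) (Inl x) (Inl y)"
  using assms(1) unfolding leaf_rel_def
proof (induction rule: rtrancl_induct)
  case base
  have "Inl x \<in> leaf_of Y x"
    using assms(2) by (auto simp: leaf_of_def Inl_points vertex_def leaf_rel_refl)
  then show ?case
    by (auto simp: path_component_of_refl topspace leaf_of_def)
next
  case (step y z)
  then have xy: "(x, y) \<in> leaf_rel Y"
    by (simp add: leaf_rel_def)
  from step.hyps(2) obtain B t e where B: "B \<in> bands Y" "t \<in> {lo B..hi B}" "y = t + shift B e" "z = t + shift B (\<not> e)"
    by (auto simp: band_edges_def)
  have "path_component_of (subtopology (space_of Y) (leaf_of Y x)) (glue B (t, of_bool e)) (glue B (t, of_bool (\<not> e)))"
    using B xy by (intro path_component_of_arc) auto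
  then have "path_component_of (subtopology (space_of Y) (leaf_of Y x)) (Inl y) (Inl z)"
    using B by (cases e) (auto simp: glue_0 glue_1)
  with step.IH show ?case
    by (rule path_component_of_trans)
qed

lemma path_connectedin_leaf_of:
  assumes "x \<in> support Y"
  shows "path_connectedin (space_of Y) (leaf_of Y x)"
proof -
  let ?X = "subtopology (space_of Y) (leaf_of Y x)"
  have "path_component_of ?X (Inl x) p" if p: "p \<in> leaf_of Y x" for p
  proof -
    have pY: "p \<in> points Y" and r: "(x, vertex Y p) \<in> leaf_rel Y"
      using p by (auto simp: leaf_of_def)
    have "path_component_of ?X (Inl (vertex Y p)) p"
    proof (rule pointsE[OF pY])
      fix z
      assume "p = Inl z"
      then show ?thesis
        using p by (auto simp: vertex_def path_component_of_refl topspace leaf_of_def)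
    next
      fix B q
      assume B: "B \<in> bands Y" "q \<in> rect B" "p = Inr q" "band_at Y (fst q) = B" "p = glue B q"
      then have "path_component_of ?X (glue B (fst q, 0)) (glue B (fst q, snd q))"
        using r by (intro path_component_of_arc[where e = False]) (auto simp: rect_def vertex_def)
      then show ?thesis
        using B by (simp add: glue_0 vertex_def)
    qed
    with path_component_of_leaf_rel[OF r assms] show ?thesis
      by (rule path_component_of_trans)
  qed
  then have "path_connected_space ?X"
    unfolding path_connected_space_iff_path_component
    by (auto simp: topspace) (meson path_component_of_sym path_component_of_trans)
  then show ?thesis
    by (auto simp: path_connectedin_def topspace leaf_of_def)
qed

lemma leaf_of_leaves:
  assumes "x \<in> support Y"
  shows "leaf_of Y x \<in> leaves Y"
proof -
  have v: "vertical Y (leaf_of Y x)"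
    using assms by (intro vertical_subset path_connectedin_leaf_of) auto
  have x: "Inl x \<in> leaf_of Y x"
    using assms by (auto simp: leaf_of_def Inl_points vertex_def leaf_rel_refl)
  have "L' = leaf_of Y x" if "vertical Y L'" "leaf_of Y x \<subseteq> L'" for L'
    using vertical_subset_leaf_of[OF that(1), of "Inl x"] that x by (auto simp: vertex_def)
  with v show ?thesis
    by (auto simp: leaves_in_def leaf_of_def)
qed

lemma leaves_eq:
  assumes "support Y \<noteq> {}"
  shows "leaves Y = leaf_of Y ` support Y"
proof (intro equalityI subsetI)
  fix L
  assume L: "L \<in> leaves Y"
  have leaf: "vertical Y (leaf_of Y x)" "leaf_of Y x \<subseteq> points Y" if "x \<in> support Y" for x
    using leaf_of_leaves[OF that] by (auto simp: leaves_in_def)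
  \<comment> \<open>The empty set is no leaf: it is contained in the vertical set
    \<open>leaf_of Y x\<close>, which is nonempty.\<close>
  obtain p where p: "p \<in> L"
  proof (cases "L = {}")
    case True
    obtain x where x: "x \<in> support Y"
      using assms by blast
    then have "leaf_of Y x = {}"
      using L leaf[OF x] True by (auto simp: leaves_in_def)
    moreover have "Inl x \<in> leaf_of Y x"
      using x by (auto simp: leaf_of_def Inl_points vertex_def leaf_rel_refl)
    ultimately show ?thesis by blast
  qed (use that in blast)
  have v: "vertical Y L" and pY: "p \<in> points Y"
    using L p by (auto simp: leaves_in_def)
  have s: "vertex Y p \<in> support Y"
    using pY by (rule vertex_support)
  have "leaf_of Y (vertex Y p) = L"
    using L leaf[OF s] vertical_subset_leaf_of[OF v p] by (auto simp: leaves_in_def)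
  with s show "L \<in> leaf_of Y ` support Y"
    by blast
qed (use leaf_of_leaves in auto)

end

section \<open>Circles and ends\<close>

lemma cis_eq_imp_eq:
  assumes "cis s = cis t" "\<bar>s - t\<bar> < 2 * pi"
  shows "s = t"
proof -
  have "cis (s - t) = 1"
    using assms(1) by (simp add: cis_divide[symmetric])
  then have "cos (s - t) = 1"
    by (metis cis.sel(1) one_complex.sel(1))
  then obtain n :: nat where "s - t = real n * 2 * pi \<or> s - t = - (real n * 2 * pi)"
    using cos_one_2pi[of "s - t"] by blast
  then have n: "\<bar>s - t\<bar> = n * (2 * pi)"
    by auto
  then have "n * (2 * pi) < 1 * (2 * pi)"
    using assms(2) by simp
  then have "n = 0"
    by (subst (asm) mult_less_cancel_right_pos) simp_all
  then show ?thesis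
    using n by simp
qed

text \<open>A continuous injective function on an interval is strictly monotone and has no minimum
  at an interior point, but a periodic continuous function attains its minimum.\<close>

lemma circle_minimum_not_injective:
  fixes b :: "real \<Rightarrow> real"
  assumes cont: "continuous_on UNIV b" and per: "\<And>t. b (t + 2 * pi) = b t"
    and inj: "\<And>t. (\<And>t'. b t \<le> b t') \<Longrightarrow> \<exists>e>0. inj_on b {t - e..t + e}"
  shows False
proof -
  have "\<exists>t\<in>{0..2 * pi}. \<forall>t'\<in>{0..2 * pi}. b t \<le> b t'"
    using cont by (intro continuous_attains_inf) (auto intro: continuous_on_subset)
  then obtain t where t: "\<And>t'. t' \<in> {0..2 * pi} \<Longrightarrow> b t \<le> b t'"
    by blast
  have per_nat: "b (s + real n * (2 * pi)) = b s" for s and n :: nat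
  proof (induction n)
    case (Suc n)
    have "s + real (Suc n) * (2 * pi) = (s + real n * (2 * pi)) + 2 * pi"
      by (simp add: algebra_simps)
    then show ?case
      using per[of "s + real n * (2 * pi)"] Suc by (simp only:)
  qed simp
  have per_int: "b (s + of_int n * (2 * pi)) = b s" for s and n :: int
  proof (cases "n \<ge> 0")
    case True
    then show ?thesis
      using per_nat[of s "nat n"] by simp
  next
    case False
    then show ?thesis
      using per_nat[of "s + of_int n * (2 * pi)" "nat (- n)"] by simp
  qed
  have "b t \<le> b t'" for t'
  proof -
    define n where "n = \<lfloor>t' / (2 * pi)\<rfloor>"
    have "of_int n \<le> t' / (2 * pi)" "t' / (2 * pi) < of_int n + 1"
      unfolding n_def by linarith+
    then have "of_int n * (2 * pi) \<le> t'" "t' < (of_int n + 1) * (2 * pi)"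
      by (simp_all add: pos_le_divide_eq pos_divide_less_eq)
    then have "t' + of_int (- n) * (2 * pi) \<in> {0..2 * pi}"
      by (simp add: algebra_simps)
    then have "b t \<le> b (t' + of_int (- n) * (2 * pi))"
      by (rule t)
    then show ?thesis
      by (simp only: per_int)
  qed
  then obtain e where e: "e > 0" "inj_on b {t - e..t + e}"
    using inj[of t] by blast
  have "(b (t - e) < b t \<and> b t < b (t + e)) \<or> (b (t + e) < b t \<and> b t < b (t - e))"
    using e cont by (intro continuous_inj_imp_mono) (auto intro: continuous_on_subset)
  then show False
    using \<open>\<And>t'. b t \<le> b t'\<close> by (meson not_less)
qed

lemma not_inj_on_circle_real:
  fixes g :: "complex \<Rightarrow> real"
  assumes "continuous_on circle g" "inj_on g circle"
  shows False
proof (rule circle_minimum_not_injective[of "\<lambda>t. g (cis t)"])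
  show "continuous_on UNIV (\<lambda>t. g (cis t))"
    by (rule continuous_on_compose2[OF assms(1)]) (auto intro!: continuous_intros)
  show "g (cis (t + 2 * pi)) = g (cis t)" for t
    by (simp add: cis_mult[symmetric] del: cis_mult)
  fix t
  have "inj_on (\<lambda>t. g (cis t)) {t - 1..t + 1}"
  proof (rule inj_onI)
    fix s s'
    assume s: "s \<in> {t - 1..t + 1}" "s' \<in> {t - 1..t + 1}" "g (cis s) = g (cis s')"
    then have "cis s = cis s'"
      using assms(2) by (auto dest!: inj_onD)
    moreover have "\<bar>s - s'\<bar> < 2 * pi"
      using s pi_gt3 by auto
    ultimately show "s = s'"
      by (rule cis_eq_imp_eq)
  qed
  then show "\<exists>e>0. inj_on (\<lambda>t. g (cis t)) {t - e..t + e}"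
    by (intro exI[of _ 1]) simp
qed

text \<open>A homeomorphism would map the boundary circle at height 0 injectively into a circle
  without the point \<open>w = f (1, 1)\<close>; stereographic projection from \<open>w\<close>
  would then embed a circle into the line.\<close>

lemma circle_not_homeomorphic_annulus:
  "\<not> (circle \<times> {0..1::real}) homeomorphic circle"
proof
  assume "(circle \<times> {0..1::real}) homeomorphic circle"
  then obtain f g where fg: "homeomorphism (circle \<times> {0..1::real}) circle f g"
    by (auto simp: homeomorphic_def)
  have inj: "inj_on f (circle \<times> {0..1})"
    using fg by (auto simp: homeomorphism_def intro: inj_on_inverseI)
  have im: "f ` (circle \<times> {0..1}) \<subseteq> circle" and cf: "continuous_on (circle \<times> {0..1}) f"
    using fg by (auto simp: homeomorphism_def)
  define w where "w = f (1, 1)"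
  have "w \<in> circle"
    using im unfolding w_def by (rule subsetD) auto
  then have w: "norm w = 1"
    by simp
  \<comment> \<open>The rotation that moves \<open>w\<close> to \<open>-1\<close>, which is the
    centre of the projection \<open>h\<close>.\<close>
  define u where "u z = - f (z, 0) / w" for z
  have u: "norm (u z) = 1" "u z \<noteq> -1" if "z \<in> circle" for z
  proof -
    have "f (z, 0) \<in> circle"
      using im by (rule subsetD) (use that in auto)
    then show "norm (u z) = 1"
      using w by (simp add: u_def norm_divide)
    have "f (z, 0) \<noteq> w"
      using inj that unfolding w_def by (auto dest!: inj_onD)
    then show "u z \<noteq> -1"
      using w by (auto simp: u_def field_simps)
  qed
  have pos: "1 + Re (u z) > 0" and sq: "(Re (u z))\<^sup>2 + (Im (u z))\<^sup>2 = 1" if "z \<in> circle" for z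
  proof -
    show sq: "(Re (u z))\<^sup>2 + (Im (u z))\<^sup>2 = 1"
      using u(1)[OF that] cmod_power2[of "u z"] by simp
    have "Re (u z) \<ge> -1"
      using u(1)[OF that] abs_Re_le_cmod[of "u z"] by auto
    moreover have "Re (u z) \<noteq> -1"
    proof
      assume "Re (u z) = -1"
      then have "u z = -1"
        using sq by (simp add: complex_eq_iff)
      then show False
        using u(2)[OF that] by simp
    qed
    ultimately show "1 + Re (u z) > 0"
      by simp
  qed
  define h where "h z = Im (u z) / (1 + Re (u z))" for z
  have cu: "continuous_on circle u"
    unfolding u_def using w by (intro continuous_intros continuous_on_compose2[OF cf]) auto
  have "continuous_on circle h"
    unfolding h_def using pos by (intro continuous_intros cu) force
  moreover have "inj_on h circle"
  proof (rule inj_onI)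
    fix z z'
    assume z: "z \<in> circle" "z' \<in> circle" "h z = h z'"
    have Re: "Re (u z) = (1 - (h z)\<^sup>2) / (1 + (h z)\<^sup>2)" if "z \<in> circle" for z
    proof -
      have I: "Im (u z) = h z * (1 + Re (u z))"
        using pos[OF that] by (simp add: h_def)
      have "(1 + Re (u z)) * (1 - Re (u z)) = (h z)\<^sup>2 * (1 + Re (u z)) * (1 + Re (u z))"
        using sq[OF that] unfolding I by (simp add: power2_eq_square algebra_simps)
      then have "(1 + Re (u z)) * (1 - Re (u z)) = (1 + Re (u z)) * ((h z)\<^sup>2 * (1 + Re (u z)))"
        by (simp add: mult_ac)
      then have "1 - Re (u z) = (h z)\<^sup>2 * (1 + Re (u z))"
        using pos[OF that] by (metis less_irrefl mult_left_cancel)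
      moreover have "1 + (h z)\<^sup>2 > 0"
        by (simp add: add_pos_nonneg)
      ultimately show ?thesis
        by (simp add: field_simps)
    qed
    have "Re (u z) = Re (u z')"
      using Re z by simp
    moreover have "Im (u z) = Im (u z')"
      using calculation z pos[of z] pos[of z'] by (simp add: h_def)
    ultimately have "u z = u z'"
      by (simp add: complex_eq_iff)
    then have "f (z, 0) = f (z', 0)"
      using w by (auto simp: u_def)
    then show "z = z'"
      using inj z by (auto dest!: inj_onD)
  qed
  ultimately show False
    by (rule not_inj_on_circle_real)
qed

text \<open>Decreasing connected sets that leave every compact set select one component of each
  complement. The last conclusion is the uniqueness that counting ends requires.\<close>

lemma end_of_neighbourhoods:
  fixes X :: "'a topology" and U :: "nat \<Rightarrow> 'a set"
  assumes conn: "\<And>n. connectedin X (U n)" and ne: "\<And>n. U n \<noteq> {}"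
    and dec: "\<And>m n. m \<le> n \<Longrightarrow> U n \<subseteq> U m"
    and exh: "\<And>K. compactin X K \<Longrightarrow> \<exists>n. K \<inter> U n = {}"
  obtains \<epsilon> where "\<epsilon> \<in> ends X"
    and "\<And>K n. compactin X K \<Longrightarrow> K \<inter> U n = {} \<Longrightarrow> U n \<subseteq> \<epsilon> K"
    and "\<And>\<delta>. \<delta> \<in> ends X \<Longrightarrow> (\<And>K. compactin X K \<Longrightarrow> \<exists>n. K \<inter> U n = {} \<and> \<delta> K \<inter> U n \<noteq> {}) \<Longrightarrow> \<delta> = \<epsilon>"
proof -
  define S where "S K = subtopology X (topspace X - K)" for K
  define \<epsilon> where "\<epsilon> = (\<lambda>K\<in>{K. compactin X K}. {y. \<exists>n. K \<inter> U n = {} \<and> (\<exists>u\<in>U n. connected_component_of (S K) u y)})"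
  have UX: "U n \<subseteq> topspace X" for n
    using conn connectedin_subset_topspace by blast
  have join: "connected_component_of (S K) u v" if "K \<inter> U n = {}" "u \<in> U n" "v \<in> U n" for K n u v
  proof -
    have "connectedin (S K) (U n)"
      using conn[of n] UX[of n] that(1) by (auto simp: S_def connectedin_subtopology)
    then show ?thesis
      using that unfolding connected_component_of_def by blast
  qed
  have eps: "\<epsilon> K = connected_component_of_set (S K) u" if K: "compactin X K" "K \<inter> U n = {}" "u \<in> U n" for K n u
  proof -
    have "connected_component_of (S K) u y" if m: "K \<inter> U m = {}" "v \<in> U m" "connected_component_of (S K) v y" for m v y
    proof -
      obtain z where z: "z \<in> U (max m n)"
        using ne by blast
      moreover have "U (max m n) \<subseteq> U m" "U (max m n) \<subseteq> U n"
        using dec[OF max.cobounded1] dec[OF max.cobounded2] by blast+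
      ultimately have "z \<in> U m" "z \<in> U n"
        by blast+
      then have "connected_component_of (S K) u z" "connected_component_of (S K) z v"
        using join K m by blast+
      then show ?thesis
        using m(3) connected_component_of_trans by metis
    qed
    then show ?thesis
      using K by (auto simp: \<epsilon>_def)
  qed
  have SK: "u \<in> topspace (S K)" if "K \<inter> U n = {}" "u \<in> U n" for K n u
    using that UX[of n] by (auto simp: S_def)
  have "\<epsilon> \<in> ends X"
    unfolding ends_def
  proof (intro CollectI conjI allI impI)
    show "\<epsilon> \<in> (\<Pi>\<^sub>E K\<in>{K. compactin X K}. connected_components_of (subtopology X (topspace X - K)))"
    proof (rule PiE_I)
      fix K
      assume "K \<in> {K. compactin X K}"
      then obtain n u where "compactin X K" "K \<inter> U n = {}" "u \<in> U n"
        using exh[of K] ne by blast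
      then have "\<epsilon> K \<in> connected_components_of (S K)"
        using eps SK unfolding connected_components_of_def by blast
      then show "\<epsilon> K \<in> connected_components_of (subtopology X (topspace X - K))"
        by (simp add: S_def)
    qed (simp add: \<epsilon>_def)
    fix K K'
    assume K: "compactin X K \<and> compactin X K' \<and> K \<subseteq> K'"
    then obtain n u where n: "K' \<inter> U n = {}" "u \<in> U n"
      using exh[of K'] ne by blast
    then have "K \<inter> U n = {}"
      using K by blast
    then have "\<epsilon> K' = connected_component_of_set (S K') u" "\<epsilon> K = connected_component_of_set (S K) u"
      using eps[OF _ n] eps[OF _ _ n(2), of K] K by blast+
    moreover have "connected_component_of (S K) u y" if "connected_component_of (S K') u y" for y
      using that K unfolding S_def by (elim conjE connected_component_of_mono) blast
    ultimately show "\<epsilon> K' \<subseteq> \<epsilon> K"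
      by blast
  qed
  moreover have "U n \<subseteq> \<epsilon> K" if "compactin X K" "K \<inter> U n = {}" for K n
  proof
    fix v
    assume v: "v \<in> U n"
    then show "v \<in> \<epsilon> K"
      unfolding eps[OF that v] using join[OF that(2) v v] by simp
  qed
  moreover have "\<delta> = \<epsilon>" if \<delta>: "\<delta> \<in> ends X" "\<And>K. compactin X K \<Longrightarrow> \<exists>n. K \<inter> U n = {} \<and> \<delta> K \<inter> U n \<noteq> {}" for \<delta>
  proof
    fix K
    show "\<delta> K = \<epsilon> K"
    proof (cases "compactin X K")
      case True
      then obtain n u where u: "K \<inter> U n = {}" "u \<in> U n" "u \<in> \<delta> K"
        using \<delta>(2) by blast
      have "\<delta> K \<in> connected_components_of (S K)"
        using \<delta>(1) True by (auto simp: ends_def S_def)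
      then obtain z where "\<delta> K = connected_component_of_set (S K) z"
        unfolding connected_components_of_def by blast
      then have "\<delta> K = connected_component_of_set (S K) u"
        using u(3) connected_component_of_equiv[of "S K" z u] by simp
      then show ?thesis
        using eps[OF True u(1,2)] by simp
    next
      case False
      then show ?thesis
        using \<delta>(1) by (auto simp: ends_def \<epsilon>_def PiE_def extensional_def)
    qed
  qed
  ultimately show thesis
    by (rule that)
qed

text \<open>On the complement of \<open>K n\<close> an end picks a connected part of the disjoint
  open sets \<open>U n\<close> and \<open>V n\<close>, hence one side, and compatibility gives the
  same side for all \<open>n\<close>. Every compact set lies in some \<open>K n\<close>, so the side
  determines the end.\<close>

lemma card_ends_eq_2:
  fixes X :: "'a topology" and U V :: "nat \<Rightarrow> 'a set"
  assumes U: "\<And>n. connectedin X (U n)" "\<And>n. openin X (U n)" "\<And>n. U n \<noteq> {}" "\<And>m n. m \<le> n \<Longrightarrow> U n \<subseteq> U m"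
    and V: "\<And>n. connectedin X (V n)" "\<And>n. openin X (V n)" "\<And>n. V n \<noteq> {}" "\<And>m n. m \<le> n \<Longrightarrow> V n \<subseteq> V m"
    and disj: "U 0 \<inter> V 0 = {}"
    and comp: "\<And>n. compactin X (topspace X - (U n \<union> V n))"
    and exh: "\<And>K. compactin X K \<Longrightarrow> \<exists>n. K \<inter> (U n \<union> V n) = {}"
  shows "card (ends X) = 2"
proof -
  define K where "K n = topspace X - (U n \<union> V n)" for n
  have K: "compactin X (K n)" "K n \<inter> U n = {}" "K n \<inter> V n = {}" for n
    using comp by (auto simp: K_def)
  have exhU: "\<exists>n. K \<inter> U n = {}" and exhV: "\<exists>n. K \<inter> V n = {}" if "compactin X K" for K
    using exh[OF that] by blast+
  obtain \<epsilon> where \<epsilon>: "\<epsilon> \<in> ends X" "\<And>K n. compactin X K \<Longrightarrow> K \<inter> U n = {} \<Longrightarrow> U n \<subseteq> \<epsilon> K"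
    "\<And>\<delta>. \<delta> \<in> ends X \<Longrightarrow> (\<And>K. compactin X K \<Longrightarrow> \<exists>n. K \<inter> U n = {} \<and> \<delta> K \<inter> U n \<noteq> {}) \<Longrightarrow> \<delta> = \<epsilon>"
    using end_of_neighbourhoods[OF U(1,3,4) exhU] by blast
  obtain \<eta> where \<eta>: "\<eta> \<in> ends X" "\<And>K n. compactin X K \<Longrightarrow> K \<inter> V n = {} \<Longrightarrow> V n \<subseteq> \<eta> K"
    "\<And>\<delta>. \<delta> \<in> ends X \<Longrightarrow> (\<And>K. compactin X K \<Longrightarrow> \<exists>n. K \<inter> V n = {} \<and> \<delta> K \<inter> V n \<noteq> {}) \<Longrightarrow> \<delta> = \<eta>"
    using end_of_neighbourhoods[OF V(1,3,4) exhV] by blast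
  have side: "\<delta> (K n) \<noteq> {} \<and> (\<delta> (K n) \<subseteq> U n \<or> \<delta> (K n) \<subseteq> V n)" if "\<delta> \<in> ends X" for \<delta> n
  proof -
    have comps: "\<delta> (K n) \<in> connected_components_of (subtopology X (topspace X - K n))"
      using that K(1) by (auto simp: ends_def)
    then have "connectedin (subtopology X (topspace X - K n)) (\<delta> (K n))"
      by (rule connectedin_connected_components_of)
    then have conn: "connectedin X (\<delta> (K n))" "\<delta> (K n) \<subseteq> topspace X - K n"
      by (auto simp: connectedin_subtopology)
    then have sub: "\<delta> (K n) \<subseteq> U n \<union> V n"
      by (auto simp: K_def)
    have "U n \<inter> V n \<inter> \<delta> (K n) = {}"
      using disj U(4)[of 0 n] V(4)[of 0 n] by blast
    then have "U n \<inter> \<delta> (K n) = {} \<or> V n \<inter> \<delta> (K n) = {}"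
      using connectedinD[OF conn(1) U(2) V(2) sub] by blast
    moreover have "\<delta> (K n) \<noteq> {}"
      using comps nonempty_connected_components_of by blast
    ultimately show ?thesis
      using sub by blast
  qed
  have down: "\<delta> (K n) \<subseteq> \<delta> K'" if "\<delta> \<in> ends X" "compactin X K'" "K' \<inter> (U n \<union> V n) = {}" for \<delta> n K'
  proof -
    have "K' \<subseteq> K n"
      using that compactin_subset_topspace by (fastforce simp: K_def)
    then show ?thesis
      using that K(1) by (auto simp: ends_def)
  qed
  have down0: "\<delta> (K n) \<subseteq> \<delta> (K 0)" if "\<delta> \<in> ends X" for \<delta> n
    using that K(1) U(4)[of 0 n] V(4)[of 0 n] by (intro down) (auto simp: K_def)
  have "\<delta> = \<epsilon> \<or> \<delta> = \<eta>" if \<delta>: "\<delta> \<in> ends X" for \<delta>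
  proof (cases "\<delta> (K 0) \<subseteq> U 0")
    case True
    have "\<exists>n. K' \<inter> U n = {} \<and> \<delta> K' \<inter> U n \<noteq> {}" if K': "compactin X K'" for K'
    proof -
      obtain n where n: "K' \<inter> (U n \<union> V n) = {}"
        using exh[OF K'] by blast
      have "\<not> \<delta> (K n) \<subseteq> V n"
        using True down0[OF \<delta>, of n] side[OF \<delta>, of n] disj V(4)[of 0 n] by blast
      then have "\<delta> (K n) \<subseteq> U n" "\<delta> (K n) \<noteq> {}"
        using side[OF \<delta>, of n] by auto
      then show ?thesis
        using n down[OF \<delta> K' n] by (intro exI[of _ n]) blast
    qed
    then show ?thesis
      using \<epsilon>(3)[OF \<delta>] by blast
  next
    case False
    then have V0: "\<delta> (K 0) \<subseteq> V 0"
      using side[OF \<delta>, of 0] by blast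
    have "\<exists>n. K' \<inter> V n = {} \<and> \<delta> K' \<inter> V n \<noteq> {}" if K': "compactin X K'" for K'
    proof -
      obtain n where n: "K' \<inter> (U n \<union> V n) = {}"
        using exh[OF K'] by blast
      have "\<not> \<delta> (K n) \<subseteq> U n"
        using V0 down0[OF \<delta>, of n] side[OF \<delta>, of n] disj U(4)[of 0 n] by blast
      then have "\<delta> (K n) \<subseteq> V n" "\<delta> (K n) \<noteq> {}"
        using side[OF \<delta>, of n] by auto
      then show ?thesis
        using n down[OF \<delta> K' n] by (intro exI[of _ n]) blast
    qed
    then show ?thesis
      using \<eta>(3)[OF \<delta>] by blast
  qed
  then have "ends X = {\<epsilon>, \<eta>}"
    using \<epsilon>(1) \<eta>(1) by blast
  moreover have "\<epsilon> \<noteq> \<eta>"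
  proof
    assume "\<epsilon> = \<eta>"
    then have "U 0 \<subseteq> \<epsilon> (K 0)" "V 0 \<subseteq> \<epsilon> (K 0)"
      using \<epsilon>(2)[OF K(1,2)] \<eta>(2)[OF K(1,3)] by auto
    then show False
      using side[OF \<epsilon>(1), of 0] disj U(3)[of 0] V(3)[of 0] by blast
  qed
  ultimately show ?thesis
    by simp
qed

lemma homeomorphic_space_imp_homeomorphic:
  assumes "top_of_set S homeomorphic_space top_of_set T"
  shows "S homeomorphic T"
proof -
  obtain f g where fg: "homeomorphic_maps (top_of_set S) (top_of_set T) f g"
    using assms by (auto simp: homeomorphic_space_def)
  then have f: "continuous_on S f" "f ` S \<subseteq> T" "\<And>x. x \<in> S \<Longrightarrow> g (f x) = x"
    and g: "continuous_on T g" "g ` T \<subseteq> S" "\<And>y. y \<in> T \<Longrightarrow> f (g y) = y"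
    by (auto simp: homeomorphic_maps_def continuous_map_in_subtopology)
  have "homeomorphism S T f g"
    using f g by (intro homeomorphismI) auto
  then show ?thesis
    by (auto simp: homeomorphic_def)
qed

context interval_translation_map
begin

section \<open>The suspension\<close>

definition alpha :: real where "alpha = L 1"
definition beta :: real where "beta = L 2"

lemma alpha_beta: "0 < beta" "beta < alpha" "alpha < 1"
  using L_pos[of 2] L_Suc_less[of 1] L_Suc_less[of 0] L_0
  by (simp_all add: alpha_def beta_def eval_nat_numeral)

lemma F_eq: "F x = (if x < 1 - alpha then x + alpha else if x < 1 - beta then x + beta else x + beta - 1)"
  by (simp add: f_def alpha_def beta_def L_0 eval_nat_numeral)

text \<open>The three domains are moved apart by 0, 1 and 2, since the rectangles of distinct bands
  have to be disjoint; the bottom shifts undo this.\<close>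

definition band_A :: band where
  "band_A = \<lparr>lo = 0, hi = 1 - alpha, shift = (\<lambda>e. if e then alpha else 0)\<rparr>"
definition band_B :: band where
  "band_B = \<lparr>lo = 2 - alpha, hi = 2 - beta, shift = (\<lambda>e. if e then beta - 1 else -1)\<rparr>"
definition band_C :: band where
  "band_C = \<lparr>lo = 3 - beta, hi = 3, shift = (\<lambda>e. if e then beta - 3 else -2)\<rparr>"

lemmas band_defs = band_A_def band_B_def band_C_def

definition suspension :: band_union where
  "suspension = \<lparr>support = {0..1}, bands = {band_A, band_B, band_C}\<rparr>"

lemma support_suspension: "support suspension = {0..1}"
  and bands_suspension: "bands suspension = {band_A, band_B, band_C}"
  by (simp_all add: suspension_def)

lemma union_of_bands_suspension: "union_of_bands suspension"
  unfolding union_of_bands_def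
proof (intro conjI)
  have "disjoint {{0..1::real}}"
    by (simp add: disjoint_def)
  then show "multi_interval (support suspension)"
    unfolding multi_interval_def support_suspension
    by (intro exI[of _ "{{0..1}}"]) (auto intro!: exI[of _ "0::real"] exI[of _ "1::real"])
  show "finite (bands suspension)"
    by (simp add: bands_suspension)
  show "\<forall>B\<in>bands suspension. lo B \<le> hi B"
    using alpha_beta by (auto simp: bands_suspension band_defs)
  show "pairwise (\<lambda>B B'. disjnt (rect B) (rect B')) (bands suspension)"
    using alpha_beta by (auto simp: bands_suspension pairwise_def disjnt_def rect_def band_defs)
  show "\<forall>B\<in>bands suspension. \<forall>e. base B e \<subseteq> support suspension"
    using alpha_beta by (auto simp: bands_suspension support_suspension base_def band_defs)
qed

sublocale Y: band_complex suspension
  by unfold_locales (rule union_of_bands_suspension)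

definition band_of :: "real \<Rightarrow> band" where
  "band_of v = (if v < 1 - alpha then band_A else if v < 1 - beta then band_B else band_C)"

definition arc_at :: "real \<Rightarrow> real \<Rightarrow> point" where
  "arc_at v y = glue (band_of v) (v - shift (band_of v) False, y)"

lemma band_of:
  assumes "v \<in> {0..1}"
  shows "band_of v \<in> bands suspension" "v - shift (band_of v) False \<in> {lo (band_of v)..hi (band_of v)}"
  using assms alpha_beta by (auto simp: band_of_def bands_suspension band_defs)

lemma band_of_top: "v - shift (band_of v) False + shift (band_of v) True = F v"
  using alpha_beta by (simp add: band_of_def band_defs F_eq)

text \<open>At \<open>1 - alpha\<close> and \<open>1 - beta\<close> two bottoms meet, and 1 is
  outside the interval on which the dynamics is studied.\<close>

definition singular :: "real set" where "singular = {1 - alpha, 1 - beta, 1}"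

lemma band_of_unique:
  fixes B :: band
  assumes "B \<in> bands suspension" "t \<in> {lo B..hi B}" "t + shift B False \<notin> singular"
  shows "B = band_of (t + shift B False)" "t + shift B False \<in> {0..<1}"
proof -
  from assms(1) consider "B = band_A" | "B = band_B" | "B = band_C"
    by (auto simp: bands_suspension)
  then have "B = band_of (t + shift B False) \<and> t + shift B False \<in> {0..<1}"
  proof cases
    case 1
    then have "0 \<le> t" "t < 1 - alpha"
      using assms(2,3) by (auto simp: band_A_def singular_def)
    then show ?thesis
      using 1 alpha_beta by (simp add: band_of_def) (simp add: band_A_def)
  next
    case 2
    then have "1 - alpha < t - 1" "t - 1 < 1 - beta"
      using assms(2,3) by (auto simp: band_B_def singular_def)
    moreover have "shift B False = -1"
      by (simp add: 2 band_B_def)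
    ultimately show ?thesis
      using 2 alpha_beta by (simp add: band_of_def)
  next
    case 3
    then have "1 - beta < t - 2" "t - 2 < 1"
      using assms(2,3) by (auto simp: band_C_def singular_def)
    moreover have "shift B False = -2"
      by (simp add: 3 band_C_def)
    ultimately show ?thesis
      using 3 alpha_beta by (simp add: band_of_def)
  qed
  then show "B = band_of (t + shift B False)" "t + shift B False \<in> {0..<1}"
    by blast+
qed

lemma arc_at_0: "arc_at v 0 = Inl v" and arc_at_1: "arc_at v 1 = Inl (F v)"
  using band_of_top[of v] by (simp_all add: arc_at_def Y.glue_0 Y.glue_1)

lemma F_edge: "u \<in> {0..1} \<Longrightarrow> (u, F u) \<in> leaf_rel suspension"
  using leaf_rel_band[OF band_of, of u False True] band_of_top[of u] by simp

lemma F_pow_leaf_rel: "u \<in> {0..<1} \<Longrightarrow> (u, (F ^^ n) u) \<in> leaf_rel suspension"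
proof (induction n)
  case (Suc n)
  then have "((F ^^ n) u, F ((F ^^ n) u)) \<in> leaf_rel suspension"
    using F_pow_unit[of u n] by (intro F_edge) auto
  with Suc show ?case
    using leaf_rel_trans[of u "(F ^^ n) u" suspension "F ((F ^^ n) u)"] by simp
qed (simp add: leaf_rel_refl)

lemma orbit_leaf_rel:
  "u \<in> {0..<1} \<Longrightarrow> v \<in> {0..<1} \<Longrightarrow> (F ^^ m) u = (F ^^ n) v \<Longrightarrow> (u, v) \<in> leaf_rel suspension"
  using F_pow_leaf_rel[of u m] F_pow_leaf_rel[of v n] leaf_rel_trans leaf_rel_sym by metis

lemma edge_F:
  assumes "(u, v) \<in> band_edges suspension" "u \<notin> singular"
  shows "u \<in> {0..<1}" "v = F u"
proof -
  obtain B t where B: "B \<in> bands suspension" "t \<in> {lo B..hi B}" "u = t + shift B False" "v = t + shift B True"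
    using assms(1) by (auto simp: band_edges_def)
  note unique = band_of_unique[OF B(1,2), folded B(3), OF assms(2)]
  show "u \<in> {0..<1}"
    by (rule unique(2))
  have "v = u - shift B False + shift B True"
    using B by simp
  then show "v = F u"
    using band_of_top[of u] unfolding unique(1)[symmetric] by simp
qed

definition regular :: "real \<Rightarrow> bool" where
  "regular x \<longleftrightarrow> x \<in> {0..<1} \<and> leaf_rel suspension `` {x} \<inter> singular = {}"

text \<open>Off \<open>singular\<close> the edges form the graph of \<open>F\<close>, and two points
  are connected in the graph of a map if and only if they have a common iterate.\<close>

lemma regular_leaf_rel:
  assumes "regular x"
  shows "(x, y) \<in> leaf_rel suspension \<longleftrightarrow> y \<in> {0..<1} \<and> (\<exists>m n. (F ^^ m) x = (F ^^ n) y)"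
proof
  assume "(x, y) \<in> leaf_rel suspension"
  then show "y \<in> {0..<1} \<and> (\<exists>m n. (F ^^ m) x = (F ^^ n) y)"
    unfolding leaf_rel_def
  proof (induction rule: rtrancl_induct)
    case base
    show ?case
      using assms by (auto simp: regular_def intro!: exI[of _ 0])
  next
    case (step y z)
    then obtain m n where mn: "(F ^^ m) x = (F ^^ n) y" and y: "y \<in> {0..<1}"
      by blast
    have xz: "(x, z) \<in> leaf_rel suspension" "(x, y) \<in> leaf_rel suspension"
      using step.hyps(1) rtrancl_into_rtrancl[OF step.hyps] unfolding leaf_rel_def by blast+
    then have ns: "z \<notin> singular" "y \<notin> singular"
      using assms by (auto simp: regular_def)
    consider "(y, z) \<in> band_edges suspension" | "(z, y) \<in> band_edges suspension"
      using step.hyps(2) by blast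
    then show ?case
    proof cases
      case 1
      then have "z = F y"
        using edge_F ns by blast
      then have "(F ^^ Suc m) x = (F ^^ n) z"
        using mn by (simp add: funpow_swap1)
      then show ?thesis
        using \<open>z = F y\<close> F_unit[OF y] by blast
    next
      case 2
      then have "z \<in> {0..<1}" "y = F z"
        using edge_F ns by blast+
      then have "(F ^^ m) x = (F ^^ Suc n) z"
        using mn by (simp add: funpow_swap1)
      then show ?thesis
        using \<open>z \<in> {0..<1}\<close> by blast
    qed
  qed
next
  assume "y \<in> {0..<1} \<and> (\<exists>m n. (F ^^ m) x = (F ^^ n) y)"
  then show "(x, y) \<in> leaf_rel suspension"
    using assms orbit_leaf_rel unfolding regular_def by blast
qed

lemma not_regular:
  assumes "x \<in> {0..1}" "\<not> regular x"
  shows "\<exists>s\<in>singular. (s, x) \<in> leaf_rel suspension"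
proof (cases "x = 1")
  case True
  then show ?thesis
    by (auto simp: singular_def leaf_rel_refl)
next
  case False
  then show ?thesis
    using assms leaf_rel_sym unfolding regular_def by fastforce
qed

subsection \<open>Density of the leaves\<close>

lemma leaf_dense:
  assumes w: "w \<in> {0..1}"
  shows "space_of suspension closure_of (leaf_of suspension w) = points suspension"
proof -
  \<comment> \<open>Density of orbit classes is known for points below 1 only; the leaf of 1
    contains \<open>F 1 = beta\<close>.\<close>
  obtain x where x: "x \<in> {0..<1}" "(w, x) \<in> leaf_rel suspension"
  proof (cases "w < 1")
    case False
    then have "F w = beta"
      using w alpha_beta by (simp add: F_eq)
    then show ?thesis
      using F_edge[OF w] alpha_beta that[of beta] by simp
  qed (use w that[of w] leaf_rel_refl in auto)
  have dense: "\<exists>y\<in>{a<..<b}. (w, y) \<in> leaf_rel suspension" if ab: "0 \<le> a" "a < b" "b \<le> 1" for a b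
  proof -
    obtain y m n where y: "y \<in> {a<..<b}" "(F ^^ m) y = (F ^^ n) x"
      using orbit_class_dense[OF x(1) ab] by blast
    then have "(x, y) \<in> leaf_rel suspension"
      using x(1) ab by (intro orbit_leaf_rel[where m = n and n = m]) auto
    then show ?thesis
      using y(1) x(2) leaf_rel_trans by blast
  qed
  have "p \<in> space_of suspension closure_of (leaf_of suspension w)" if p: "p \<in> points suspension" for p
    unfolding in_closure_of
  proof (intro conjI allI impI)
    show "p \<in> topspace (space_of suspension)"
      using p by (simp add: Y.topspace)
    fix T
    assume T: "p \<in> T \<and> openin (space_of suspension) T"
    obtain B t y where B: "B \<in> bands suspension" "t \<in> {lo B..hi B}" "y \<in> {0..1}" "p = glue B (t, y)"
    proof (rule Y.pointsE[OF p])
      fix z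
      assume z: "z \<in> support suspension" "p = Inl z"
      then show thesis
        using that[OF band_of[of z], of 0] by (simp add: support_suspension Y.glue_0)
    next
      fix B q
      assume "B \<in> bands suspension" "q \<in> rect B" "p = glue B q"
      then show thesis
        using that[of B "fst q" "snd q"] by (auto simp: rect_def)
    qed
    have "openin (top_of_set (rect B)) {q \<in> rect B. glue B q \<in> T}"
      using T B(1) by (simp add: openin_space_of)
    moreover have "(t, y) \<in> {q \<in> rect B. glue B q \<in> T}"
      using T B by (auto simp: rect_def)
    ultimately obtain e where e: "e > 0" "\<And>q. q \<in> rect B \<Longrightarrow> dist q (t, y) < e \<Longrightarrow> glue B q \<in> T"
      unfolding openin_euclidean_subtopology_iff by blast
    define a b where "a = max (lo B) (t - e)" and "b = min (hi B) (t + e)"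
    have "lo B < hi B"
      using B(1) alpha_beta by (auto simp: bands_suspension band_defs)
    then have ab: "a < b"
      using B(2) e(1) by (auto simp: a_def b_def)
    have "a + shift B False \<in> {0..1}" "b + shift B False \<in> {0..1}"
      using Y.base_support[OF B(1), of a False] Y.base_support[OF B(1), of b False] ab B(2) e(1)
      by (auto simp: support_suspension a_def b_def)
    then obtain z where z: "z \<in> {a + shift B False<..<b + shift B False}" "(w, z) \<in> leaf_rel suspension"
      using dense[of "a + shift B False" "b + shift B False"] ab by auto
    let ?q = "(z - shift B False, y)"
    have t: "z - shift B False \<in> {lo B..hi B}" "\<bar>z - shift B False - t\<bar> < e"
      using z(1) by (auto simp: a_def b_def abs_less_iff)
    have "glue B ?q \<in> T"
      using t B(3) by (intro e(2)) (auto simp: rect_def dist_Pair_Pair dist_real_def)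
    moreover have "glue B ?q \<in> leaf_of suspension w"
      using z(2) by (intro Y.glue_leaf_of[OF B(1) t(1) B(3), where e = False]) simp
    ultimately show "\<exists>y. y \<in> leaf_of suspension w \<and> y \<in> T"
      by blast
  qed
  moreover have "space_of suspension closure_of (leaf_of suspension w) \<subseteq> points suspension"
    using closure_of_subset_topspace by (metis Y.topspace)
  ultimately show ?thesis
    by blast
qed

lemma leaves_suspension: "leaves suspension = leaf_of suspension ` {0..1}"
  using Y.leaves_eq by (simp add: support_suspension)

subsection \<open>Regular leaves contain no circle\<close>

text \<open>The cocycle of the orbit relation, which counts generations relative to
  \<open>x\<close>. It is well defined because \<open>F\<close> has no periodic points.\<close>

definition level :: "real \<Rightarrow> real \<Rightarrow> int" where
  "level x y = (THE d. \<exists>m n. (F ^^ m) x = (F ^^ n) y \<and> d = int m - int n)"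

lemma level_eq:
  assumes "x \<in> {0..<1}" "y \<in> {0..<1}" "(F ^^ m) x = (F ^^ n) y"
  shows "level x y = int m - int n"
  unfolding level_def
proof (rule the_equality)
  fix d
  assume "\<exists>m n. (F ^^ m) x = (F ^^ n) y \<and> d = int m - int n"
  then obtain m' n' where d: "(F ^^ m') x = (F ^^ n') y" "d = int m' - int n'"
    by blast
  have eq: "(F ^^ (m + n')) x = (F ^^ (m' + n)) x"
  proof -
    have "(F ^^ (n' + m)) x = (F ^^ (n' + n)) y"
      unfolding funpow_add o_apply assms(3) ..
    also have "\<dots> = (F ^^ (n + n')) y"
      by (simp only: add.commute)
    also have "\<dots> = (F ^^ (n + m')) x"
      unfolding funpow_add o_apply d(1) ..
    finally show ?thesis
      by (simp only: add.commute)
  qed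
  have "i = j" if "(F ^^ i) x = (F ^^ j) x" "i \<le> j" for i j
  proof (rule ccontr)
    assume "i \<noteq> j"
    have "(F ^^ (j - i)) ((F ^^ i) x) = (F ^^ (j - i + i)) x"
      by (simp only: funpow_add o_apply)
    then have "(F ^^ (j - i)) ((F ^^ i) x) = (F ^^ i) x" "0 < j - i"
      using that \<open>i \<noteq> j\<close> by simp_all
    then show False
      using no_periodic[OF F_pow_unit[OF assms(1)]] by blast
  qed
  then have "m + n' = m' + n"
    using eq by (metis nle_le)
  then show "d = int m - int n"
    using d(2) by linarith
qed (use assms in blast)

lemma level_F:
  assumes "regular x" "(x, y) \<in> leaf_rel suspension"
  shows "level x (F y) = level x y + 1"
proof -
  obtain m n where mn: "(F ^^ m) x = (F ^^ n) y" and y: "y \<in> {0..<1}"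
    using assms regular_leaf_rel by blast
  have x: "x \<in> {0..<1}"
    using assms(1) by (simp add: regular_def)
  have "(F ^^ Suc m) x = (F ^^ n) (F y)"
    using mn by (simp add: funpow_swap1)
  then show ?thesis
    using level_eq[OF x y mn] level_eq[OF x F_unit[OF y]] by fastforce
qed

definition height :: "point \<Rightarrow> real" where
  "height p = (case p of Inl x \<Rightarrow> 0 | Inr q \<Rightarrow> snd q)"

text \<open>Height relative to the nearer base. It is continuous across the support, where
  \<open>height\<close> jumps from 1 to 0.\<close>

definition signed_height :: "point \<Rightarrow> real" where
  "signed_height p = (case p of Inl x \<Rightarrow> 0 | Inr q \<Rightarrow> if snd q < 1/2 then snd q else snd q - 1)"

definition elevation :: "real \<Rightarrow> point \<Rightarrow> real" where
  "elevation x p = of_int (level x (vertex suspension p)) + height p"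

lemma leaf_of_regularE:
  assumes x: "regular x" and p: "p \<in> leaf_of suspension x"
  obtains v y where "(x, v) \<in> leaf_rel suspension" "v \<in> {0..<1}" "y \<in> {0..<1}" "p = arc_at v y"
    "vertex suspension p = v" "height p = y"
proof -
  let ?v = "vertex suspension p"
  have v: "(x, ?v) \<in> leaf_rel suspension" and pY: "p \<in> points suspension"
    using p by (auto simp: leaf_of_def)
  then have ns: "?v \<notin> singular"
    using x by (auto simp: regular_def)
  show thesis
  proof (rule Y.pointsE[OF pY])
    fix z
    assume z: "z \<in> support suspension" "p = Inl z"
    then have "?v = z"
      by (simp add: vertex_def)
    then show thesis
      using that[OF v, of 0] z ns by (simp add: arc_at_0 height_def support_suspension singular_def)
  next
    fix B q
    assume B: "B \<in> bands suspension" "q \<in> rect B" "0 < snd q" "snd q < 1" "p = Inr q"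
      "band_at suspension (fst q) = B" "p = glue B q"
    then have q: "?v = fst q + shift B False" "fst q \<in> {lo B..hi B}"
      by (auto simp: vertex_def rect_def)
    note u = band_of_unique[OF B(1) q(2)]
    have "B = band_of ?v" "?v \<in> {0..<1}"
      using u ns q(1) by simp_all
    moreover have "p = arc_at ?v (snd q)"
      unfolding arc_at_def using calculation(1) q(1) B(7) by simp
    ultimately show thesis
      using that[OF v, of "snd q"] B by (simp add: height_def)
  qed
qed

lemma openin_signed_height:
  assumes "(U, h) \<in> charts suspension" "h = base_position suspension" "open V"
  shows "openin (space_of suspension) {p \<in> {p \<in> points suspension. \<forall>q. p = Inr q \<longrightarrow> snd q \<noteq> 1/2}. signed_height p \<in> V}"
proof (rule openin_space_of_preimage[OF _ assms(3)])
  let ?U = "{p \<in> points suspension. \<forall>q. p = Inr q \<longrightarrow> snd q \<noteq> 1/2}"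
  have "(?U, base_position suspension) \<in> charts suspension"
    by (simp add: charts_def)
  then show "openin (space_of suspension) ?U"
    using Y.chart_dx_primitive unfolding dx_primitive_def by blast
  show "continuous_on {x \<in> support suspension. Inl x \<in> ?U} (\<lambda>x. signed_height (Inl x))"
    by (simp add: signed_height_def)
  fix B
  assume "B \<in> bands suspension"
  let ?S = "{p \<in> rect B. glue B p \<in> ?U}"
  have "signed_height (glue B p) = (if snd p < 1/2 then snd p else snd p - 1)" for p
    by (auto simp: signed_height_def glue_def)
  moreover have "continuous_on ({p. snd p < 1/2} \<union> {p. snd p > 1/2}) (\<lambda>p :: real \<times> real. if snd p < 1/2 then snd p else snd p - 1)"
  proof (rule continuous_on_open_Un)
    show "open {p :: real \<times> real. snd p < 1/2}" "open {p :: real \<times> real. snd p > 1/2}"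
      by (intro open_Collect_less continuous_intros)+
    have "continuous_on {p :: real \<times> real. snd p < 1/2} snd"
      by (intro continuous_intros)
    then show "continuous_on {p :: real \<times> real. snd p < 1/2} (\<lambda>p. if snd p < 1/2 then snd p else snd p - 1)"
      by (rule continuous_on_eq) simp
    have "continuous_on {p :: real \<times> real. snd p > 1/2} (\<lambda>p. snd p - 1)"
      by (intro continuous_intros)
    then show "continuous_on {p :: real \<times> real. snd p > 1/2} (\<lambda>p. if snd p < 1/2 then snd p else snd p - 1)"
      by (rule continuous_on_eq) simp
  qed
  moreover have "?S \<subseteq> {p. snd p < 1/2} \<union> {p. snd p > 1/2}"
  proof
    fix p
    assume p: "p \<in> ?S"
    have "snd p \<noteq> 1/2"
    proof
      assume half: "snd p = 1/2"
      then have "glue B p = Inr p"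
        by (simp add: Y.glue_eq_Inr)
      then show False
        using p half by (cases p) auto
    qed
    then show "p \<in> {p. snd p < 1/2} \<union> {p. snd p > 1/2}"
      by auto
  qed
  ultimately show "continuous_on ?S (\<lambda>p. signed_height (glue B p))"
    using continuous_on_subset by simp
qed

lemma openin_height:
  assumes "open V"
  shows "openin (space_of suspension) {p \<in> {p \<in> points suspension. \<exists>q. p = Inr q}. height p \<in> V}"
proof (rule openin_space_of_preimage[OF _ assms])
  let ?U = "{p \<in> points suspension. \<exists>q. p = Inr q}"
  have "(?U, band_position) \<in> charts suspension"
    by (simp add: charts_def)
  then show "openin (space_of suspension) ?U"
    using Y.chart_dx_primitive unfolding dx_primitive_def by blast
  show "continuous_on {x \<in> support suspension. Inl x \<in> ?U} (\<lambda>x. height (Inl x))"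
    by (simp add: height_def)
  fix B
  assume "B \<in> bands suspension"
  have "continuous_on {p \<in> rect B. glue B p \<in> ?U} snd"
    by (intro continuous_intros)
  moreover have "snd p = height (glue B p)" if "p \<in> {p \<in> rect B. glue B p \<in> ?U}" for p
    using that by (auto simp: Y.glue_eq_Inr) (simp add: height_def glue_def)
  ultimately show "continuous_on {p \<in> rect B. glue B p \<in> ?U} (\<lambda>p. height (glue B p))"
    using continuous_on_cong by (metis (mono_tags, lifting))
qed

text \<open>Along a curve in a regular leaf the elevation is locally a constant plus a continuous function
  on the complex; and since every vertex has exactly one outgoing arc, the part of the leaf above a
  given point is locally parametrised by the elevation.\<close>

lemma elevation_local:
  fixes c :: "real \<Rightarrow> point"
  assumes x: "regular x" and c: "continuous_map (top_of_set UNIV) (space_of suspension) c"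
    and leaf: "range c \<subseteq> leaf_of suspension x"
  shows "isCont (\<lambda>t. elevation x (c t)) t"
    and "\<exists>e>0. \<exists>\<phi>. \<forall>t'. \<bar>t' - t\<bar> < e \<longrightarrow> elevation x (c t) \<le> elevation x (c t') \<longrightarrow> c t' = \<phi> (elevation x (c t'))"
proof -
  have many: "Y.countably_many_leaves (c ` UNIV)"
    using leaf by (rule Y.countably_many_leaves_leaf_of)
  have key: "\<exists>e>0. \<exists>U h K \<phi>. c t \<in> U \<and> (\<forall>V. open V \<longrightarrow> openin (space_of suspension) {p \<in> U. h p \<in> V}) \<and>
      (\<forall>t'. \<bar>t' - t\<bar> < e \<longrightarrow> elevation x (c t') = K + h (c t') \<and>
        (elevation x (c t) \<le> elevation x (c t') \<longrightarrow> c t' = \<phi> (elevation x (c t'))))"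
  proof (cases "c t")
    case (Inl x0)
    let ?U = "{p \<in> points suspension. \<forall>q. p = Inr q \<longrightarrow> snd q \<noteq> 1/2}"
    have ch: "(?U, base_position suspension) \<in> charts suspension"
      by (simp add: charts_def)
    have tU: "c t \<in> ?U"
      using subsetD[OF leaf rangeI, of t] Inl by (simp add: leaf_of_def)
    obtain e where e: "e > 0" "\<And>t'. \<bar>t' - t\<bar> < e \<Longrightarrow> c t' \<in> ?U \<and> base_position suspension (c t') = x0"
      using Y.chart_constant[OF c connected_UNIV many ch _ tU] Inl by (auto simp: base_position_def)
    have ct: "elevation x (c t) = of_int (level x x0)"
      by (simp add: elevation_def Inl vertex_def height_def)
    have loc: "elevation x (c t') = of_int (level x x0) + signed_height (c t') \<and>
        (elevation x (c t) \<le> elevation x (c t') \<longrightarrow> c t' = arc_at x0 (elevation x (c t') - of_int (level x x0)))"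
      if t': "\<bar>t' - t\<bar> < e" for t'
    proof (cases "c t'")
      case (Inl z)
      then have "z = x0"
        using e(2)[OF t'] by (simp add: base_position_def)
      then show ?thesis
        by (simp add: Inl elevation_def vertex_def height_def signed_height_def arc_at_0)
    next
      case (Inr q)
      have "c t' \<in> leaf_of suspension x"
        using leaf by blast
      then obtain v y where v: "(x, v) \<in> leaf_rel suspension" "v \<in> {0..<1}" "y \<in> {0..<1}" "c t' = arc_at v y"
        "vertex suspension (c t') = v" "height (c t') = y"
        by (rule leaf_of_regularE[OF x])
      have y: "snd q = y" "0 < y" "y \<noteq> 1/2"
        using v(3,4,6) Inr e(2)[OF t'] by (auto simp: height_def arc_at_def glue_def split: if_splits)
      have bp: "base_position suspension (c t') = v - shift (band_of v) False + shift (band_of v) (y > 1/2)"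
        unfolding v(4) arc_at_def
        by (subst Y.base_position_glue) (use band_of[of v] v(2,3) in \<open>auto simp: rect_def\<close>)
      show ?thesis
      proof (cases "y > 1/2")
        case True
        then have "F v = x0"
          using bp e(2)[OF t'] band_of_top[of v] by simp
        then have "level x x0 = level x v + 1"
          using level_F[OF x v(1)] by simp
        then have el: "elevation x (c t') = of_int (level x x0) + (y - 1)"
          by (simp add: elevation_def v(5,6))
        have "signed_height (c t') = y - 1"
          using True y Inr by (simp add: signed_height_def)
        then show ?thesis
          using el ct v(3) by simp
      next
        case False
        then have "v = x0"
          using bp e(2)[OF t'] by simp
        then have el: "elevation x (c t') = of_int (level x x0) + y"
          by (simp add: elevation_def v(5,6))
        have "signed_height (c t') = y"
          using False y Inr by (simp add: signed_height_def)
        then show ?thesis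
          using el v(4) \<open>v = x0\<close> by simp
      qed
    qed
    have op: "openin (space_of suspension) {p \<in> ?U. signed_height p \<in> V}" if "open V" for V
      using that by (rule openin_signed_height[OF ch refl])
    show ?thesis
      by (rule exI[of _ e], rule conjI[OF e(1)], rule exI[of _ ?U], rule exI[of _ signed_height],
          rule exI[of _ "of_int (level x x0)"], rule exI[of _ "\<lambda>b. arc_at x0 (b - of_int (level x x0))"])
        (intro conjI allI impI tU op loc[THEN conjunct1] loc[THEN conjunct2, THEN mp])
  next
    case (Inr q0)
    let ?U = "{p \<in> points suspension. \<exists>q. p = Inr q}"
    have ch: "(?U, band_position) \<in> charts suspension"
      by (simp add: charts_def)
    have tU: "c t \<in> ?U"
      using subsetD[OF leaf rangeI, of t] Inr by (simp add: leaf_of_def)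
    obtain e where e: "e > 0" "\<And>t'. \<bar>t' - t\<bar> < e \<Longrightarrow> c t' \<in> ?U \<and> band_position (c t') = fst q0"
      using Y.chart_constant[OF c connected_UNIV many ch _ tU] Inr by (auto simp: band_position_def)
    let ?K = "of_int (level x (vertex suspension (c t))) :: real"
    have loc: "elevation x (c t') = ?K + height (c t') \<and> c t' = Inr (fst q0, elevation x (c t') - ?K)"
      if t': "\<bar>t' - t\<bar> < e" for t'
    proof -
      obtain q where q: "c t' = Inr q" "fst q = fst q0"
        using e(2)[OF t'] by (auto simp: band_position_def)
      then have "vertex suspension (c t') = vertex suspension (c t)"
        using Inr by (simp add: vertex_def)
      then show ?thesis
        using q by (auto simp: elevation_def height_def prod_eq_iff)
    qed
    show ?thesis
      by (rule exI[of _ e], rule conjI[OF e(1)], rule exI[of _ ?U], rule exI[of _ height],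
          rule exI[of _ ?K], rule exI[of _ "\<lambda>b. Inr (fst q0, b - ?K)"])
        (intro conjI allI impI tU openin_height loc[THEN conjunct1] loc[THEN conjunct2])
  qed
  from key obtain e U h K \<phi> where e1: "e > 0" "c t \<in> U" "\<forall>V. open V \<longrightarrow> openin (space_of suspension) {p \<in> U. h p \<in> V}"
    and e2: "\<forall>t'. \<bar>t' - t\<bar> < e \<longrightarrow> elevation x (c t') = K + h (c t') \<and>
        (elevation x (c t) \<le> elevation x (c t') \<longrightarrow> c t' = \<phi> (elevation x (c t')))"
    by (elim exE conjE) (rule that)
  have e: "e > 0" "c t \<in> U" "\<And>V. open V \<Longrightarrow> openin (space_of suspension) {p \<in> U. h p \<in> V}"
    "\<And>t'. \<bar>t' - t\<bar> < e \<Longrightarrow> elevation x (c t') = K + h (c t')"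
    using e1 e2 by blast+
  show "\<exists>e>0. \<exists>\<phi>. \<forall>t'. \<bar>t' - t\<bar> < e \<longrightarrow> elevation x (c t) \<le> elevation x (c t') \<longrightarrow> c t' = \<phi> (elevation x (c t'))"
    by (rule exI[of _ e], rule conjI[OF e1(1)], rule exI[of _ \<phi>]) (use e2 in blast)
  show "isCont (\<lambda>t. elevation x (c t)) t"
    unfolding continuous_at_eps_delta
  proof (intro allI impI)
    fix r :: real
    assume "r > 0"
    have op: "openin (space_of suspension) {p \<in> U. h p \<in> ball (h (c t)) r}"
      by (rule e(3)) simp
    have "c t \<in> {p \<in> U. h p \<in> ball (h (c t)) r}"
      using e(2) \<open>r > 0\<close> by simp
    from openin_curve_preimage[OF c op UNIV_I this]
    obtain d where d: "d > 0" "\<And>t'. \<bar>t' - t\<bar> < d \<Longrightarrow> h (c t') \<in> ball (h (c t)) r"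
      by auto
    have "dist (elevation x (c t')) (elevation x (c t)) < r" if "dist t' t < min d e" for t'
      using d(2)[of t'] e(4)[of t'] e(4)[of t] e(1) that by (simp add: dist_real_def abs_minus_commute)
    then show "\<exists>d>0. \<forall>t'. dist t' t < d \<longrightarrow> dist (elevation x (c t')) (elevation x (c t)) < r"
      using d(1) e(1) by (intro exI[of _ "min d e"]) simp
  qed
qed

text \<open>Parametrise the circle by an angle. Near a minimum of the elevation the curve is a
  function of the elevation, so the elevation would be injective there.\<close>

lemma no_circle_in_regular_leaf:
  fixes C :: "point set"
  assumes x: "regular x" and C: "C \<subseteq> leaf_of suspension x"
  shows "\<not> subtopology (space_of suspension) C homeomorphic_space top_of_set circle"
proof
  assume "subtopology (space_of suspension) C homeomorphic_space top_of_set circle"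
  then obtain g where "homeomorphic_map (top_of_set circle) (subtopology (space_of suspension) C) g"
    using homeomorphic_space_sym homeomorphic_space by metis
  then have g: "continuous_map (top_of_set circle) (space_of suspension) g" "g ` circle \<subseteq> C" "inj_on g circle"
    unfolding homeomorphic_eq_everything_map continuous_map_in_subtopology by auto
  let ?c = "\<lambda>t. g (cis t)"
  have "continuous_map (top_of_set UNIV) (top_of_set circle) cis"
    by (auto simp: continuous_map_in_subtopology intro!: continuous_intros)
  then have c: "continuous_map (top_of_set UNIV) (space_of suspension) ?c"
    using continuous_map_compose[OF _ g(1)] unfolding o_def by blast
  have leaf: "range ?c \<subseteq> leaf_of suspension x"
    using g(2) C by (force simp: image_subset_iff)
  show False
  proof (rule circle_minimum_not_injective[of "\<lambda>t. elevation x (?c t)"])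
    show "continuous_on UNIV (\<lambda>t. elevation x (?c t))"
      using elevation_local(1)[OF x c leaf] by (simp add: continuous_on_eq_continuous_at)
    show "elevation x (?c (t + 2 * pi)) = elevation x (?c t)" for t
      by (simp add: cis_mult[symmetric] del: cis_mult)
    fix t
    assume min: "\<And>t'. elevation x (?c t) \<le> elevation x (?c t')"
    obtain e \<phi> where e: "e > 0" "\<And>t'. \<bar>t' - t\<bar> < e \<Longrightarrow> ?c t' = \<phi> (elevation x (?c t'))"
      using elevation_local(2)[OF x c leaf, of t] min by blast
    let ?d = "min 1 (e / 2)"
    have "inj_on (\<lambda>t. elevation x (?c t)) {t - ?d..t + ?d}"
    proof (rule inj_onI)
      fix s s'
      assume s: "s \<in> {t - ?d..t + ?d}" "s' \<in> {t - ?d..t + ?d}" "elevation x (?c s) = elevation x (?c s')"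
      have d: "?d < e" "?d \<le> 1"
        using e(1) by auto
      have "\<bar>s - t\<bar> \<le> ?d" "\<bar>s' - t\<bar> \<le> ?d"
        using s(1,2) unfolding atLeastAtMost_iff abs_le_iff by linarith+
      then have "\<bar>s - t\<bar> < e" "\<bar>s' - t\<bar> < e"
        using d(1) by linarith+
      then have "?c s = ?c s'"
        using e(2)[of s] e(2)[of s'] s(3) by simp
      then have "cis s = cis s'"
        using g(3) by (auto dest!: inj_onD)
      moreover have "\<bar>s - s'\<bar> < 2 * pi"
        using s(1,2) pi_gt3 by auto
      ultimately show "s = s'"
        by (rule cis_eq_imp_eq)
    qed
    then show "\<exists>e>0. inj_on (\<lambda>t. elevation x (?c t)) {t - e..t + e}"
      using e(1) by (intro exI[of _ ?d]) simp
  qed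
qed

text \<open>If \<open>A\<close> meets a regular leaf, a path component of the intersection is a leaf
  of \<open>A\<close> that cannot be a circle. Otherwise \<open>A\<close> lies in three leaves; then
  \<open>dx\<close> vanishes along all its paths, so \<open>A\<close> itself is one leaf, and an
  annulus is no circle.\<close>

lemma annulus_free_suspension: "annulus_free suspension"
  unfolding annulus_free_def
proof (rule notI, elim exE conjE)
  fix A
  let ?X = "space_of suspension"
  assume A: "A \<subseteq> points suspension" and ann: "subtopology ?X A homeomorphic_space top_of_set (circle \<times> {0..1::real})"
    and circ: "\<forall>L\<in>leaves_in suspension A. subtopology ?X L homeomorphic_space top_of_set circle"
  have "path_connected (circle \<times> {0..1::real})"
    by (intro path_connected_Times path_connected_sphere) (auto simp: convex_imp_path_connected)
  then have "path_connected_space (top_of_set (circle \<times> {0..1::real}))"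
    by simp
  then have "path_connected_space (subtopology ?X A)"
    using homeomorphic_path_connected_space_imp homeomorphic_space_sym ann by metis
  then have pc: "path_connectedin ?X A"
    using A by (simp add: path_connectedin_def Y.topspace)
  show False
  proof (cases "\<exists>p\<in>A. regular (vertex suspension p)")
    case True
    then obtain p where p: "p \<in> A" "regular (vertex suspension p)"
      by blast
    let ?x = "vertex suspension p"
    let ?V = "A \<inter> leaf_of suspension ?x"
    let ?L = "path_component_of_set (subtopology ?X ?V) p"
    have pV: "p \<in> ?V"
      using p A by (auto simp: leaf_of_def leaf_rel_refl)
    have LV: "?L \<subseteq> ?V"
      using path_component_of_subset_topspace by fastforce
    have "path_connectedin (subtopology ?X ?V) ?L"
      by (rule path_connectedin_path_component_of)
    then have pcL: "path_connectedin ?X ?L"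
      by (simp add: path_connectedin_subtopology)
    then have vert: "vertical suspension ?L"
      using LV by (intro Y.vertical_subset) auto
    have "L' = ?L" if L': "L' \<subseteq> A" "vertical suspension L'" "?L \<subseteq> L'" for L'
    proof -
      have "p \<in> topspace (subtopology ?X ?V)"
        using pV A by (auto simp: Y.topspace)
      then have pL: "p \<in> L'"
        using L'(3) path_component_of_refl by fastforce
      have L'V: "L' \<subseteq> ?V"
        using Y.vertical_subset_leaf_of[OF L'(2) pL] L'(1) by blast
      have "path_connectedin (subtopology ?X ?V) L'"
        using L'(2) L'V by (auto simp: vertical_def path_connectedin_subtopology)
      then have "L' \<subseteq> ?L"
        using pL by (intro path_component_of_maximal)
      with L'(3) show ?thesis
        by blast
    qed
    then have "?L \<in> leaves_in suspension A"
      using LV vert by (auto simp: leaves_in_def)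
    then have "subtopology ?X ?L homeomorphic_space top_of_set circle"
      using circ by blast
    moreover have "?L \<subseteq> leaf_of suspension ?x"
      using LV by blast
    ultimately show False
      using no_circle_in_regular_leaf[OF p(2)] by blast
  next
    case False
    have sub: "A \<subseteq> (\<Union>s\<in>singular. leaf_of suspension s)"
    proof
      fix p
      assume p: "p \<in> A"
      then have "vertex suspension p \<in> {0..1}"
        using A Y.vertex_support[of p] by (auto simp: support_suspension)
      then obtain s where "s \<in> singular" "(s, vertex suspension p) \<in> leaf_rel suspension"
        using False p not_regular by blast
      then show "p \<in> (\<Union>s\<in>singular. leaf_of suspension s)"
        using p A by (auto simp: leaf_of_def)
    qed
    have countable: "countable singular"
      by (simp add: singular_def)
    have vert: "vertical suspension A"
      unfolding vertical_def
    proof (intro conjI allI impI pc)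
      fix g
      assume g: "pathin ?X g \<and> inj_on g {0..1} \<and> g ` {0..1} \<subseteq> A"
      then have "Y.countably_many_leaves (g ` {0..1})"
        unfolding Y.countably_many_leaves_def using sub countable by blast
      then show "dx_zero_along suspension g"
        using g Y.dx_zero_along_leaves by blast
    qed
    then have "A \<in> leaves_in suspension A"
      by (auto simp: leaves_in_def)
    then have "subtopology ?X A homeomorphic_space top_of_set circle"
      using circ by blast
    then have "top_of_set (circle \<times> {0..1::real}) homeomorphic_space top_of_set circle"
      using ann homeomorphic_space_sym homeomorphic_space_trans by metis
    then have "(circle \<times> {0..1::real}) homeomorphic circle"
      by (rule homeomorphic_space_imp_homeomorphic)
    then show False
      using circle_not_homeomorphic_annulus by blast
  qed
qed

end

section \<open>Collapses\<close>

text \<open>The components of the union are disjoint closed intervals, and finitely many, since each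
  contains one of the given nonempty intervals. The intervals may be empty, as cutting produces such
  pieces.\<close>

lemma multi_interval_Union:
  assumes fin: "finite \<F>" and int: "\<And>I. I \<in> \<F> \<Longrightarrow> \<exists>u v. I = {u..v :: real}"
  shows "multi_interval (\<Union>\<F>)"
proof -
  let ?D = "\<Union>\<F>"
  have "components ?D \<subseteq> (\<lambda>I. connected_component_set ?D (SOME x. x \<in> I)) ` \<F>"
  proof
    fix C
    assume "C \<in> components ?D"
    then obtain x where x: "x \<in> ?D" "C = connected_component_set ?D x"
      by (auto simp: components_def)
    then obtain I where I: "I \<in> \<F>" "x \<in> I"
      by blast
    let ?y = "SOME x. x \<in> I"
    have "?y \<in> I"
      using I(2) by (rule someI)
    moreover have "connected I"
      using int[OF I(1)] by auto
    ultimately have "connected_component ?D x ?y"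
      using I by (intro connected_componentI[of I]) auto
    then have "C = connected_component_set ?D ?y"
      unfolding x(2) by (rule connected_component_eq[OF CollectI, symmetric])
    then show "C \<in> (\<lambda>I. connected_component_set ?D (SOME x. x \<in> I)) ` \<F>"
      using I(1) by blast
  qed
  then have "finite (components ?D)"
    using fin finite_surj by blast
  moreover have "\<exists>u v. u \<le> v \<and> C = {u..v}" if C: "C \<in> components ?D" for C
  proof -
    have "compact ?D"
      using int fin by (intro compact_Union) auto
    then have "compact C" "connected C" "C \<noteq> {}"
      using C compact_components in_components_connected in_components_nonempty by blast+
    then show ?thesis
      using connected_compact_interval_1[of C] by (metis atLeastatMost_empty_iff2)
  qed
  moreover have "disjoint (components ?D)"
    using pairwise_disjoint_components[of ?D] by (simp add: disjoint_def pairwise_def disjnt_def)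
  ultimately show ?thesis
    unfolding multi_interval_def by (intro exI[of _ "components ?D"]) (simp add: Union_components)
qed

lemma isolated_in_interval:
  assumes "z isolated_in D" "{a..b} \<subseteq> D" "z \<in> {a..b :: real}"
  shows "a = b"
proof (rule ccontr)
  assume "a \<noteq> b"
  then have "z islimpt {a..b}"
    using assms(3) by (simp add: islimpt_Icc)
  then have "z islimpt D"
    using assms(2) by (rule islimpt_subset)
  then show False
    using assms(1) isolated_in_islimpt_iff by blast
qed

text \<open>Cutting every interval at \<open>u\<close> and \<open>v\<close> leaves closed intervals.
  An isolated point can only be a whole interval of length zero, so removing \<open>N\<close> just
  drops some of them.\<close>

lemma multi_interval_collapse:
  assumes "multi_interval D" "u < v" and N: "\<And>z. z \<in> N \<Longrightarrow> z isolated_in (D - {u<..<v})"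
  shows "multi_interval (D - {u<..<v} - N)"
proof -
  obtain \<F> where F0: "finite \<F>" "\<forall>I\<in>\<F>. \<exists>a b. a \<le> b \<and> I = {a..b}" "D = \<Union>\<F>"
    using assms(1) unfolding multi_interval_def by (elim exE conjE) (rule that)
  have F: "finite \<F>" "\<exists>a b. I = {a..b}" if "I \<in> \<F>" for I
    using F0(1) bspec[OF F0(2) that] by (simp, elim exE conjE, intro exI)
  let ?G = "(\<lambda>I. I \<inter> {..u}) ` \<F> \<union> (\<lambda>I. I \<inter> {v..}) ` \<F>"
  let ?H = "{I \<in> ?G. I \<inter> N = {}}"
  have D: "D - {u<..<v} = \<Union>?G"
  proof (rule set_eqI)
    fix x
    have "x \<in> \<Union>?G \<longleftrightarrow> (\<exists>I\<in>\<F>. x \<in> I \<and> (x \<le> u \<or> v \<le> x))"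
      by blast
    then show "x \<in> D - {u<..<v} \<longleftrightarrow> x \<in> \<Union>?G"
      unfolding F0(3) by (auto simp: not_less)
  qed
  have int: "\<exists>a b. I = {a..b}" if I: "I \<in> ?G" for I
  proof -
    obtain J where J: "J \<in> \<F>" "I = J \<inter> {..u} \<or> I = J \<inter> {v..}"
      using I by blast
    moreover obtain a b where "J = {a..b}"
      using F(2)[OF J(1)] by blast
    ultimately have "I = {a..min b u} \<or> I = {max a v..b}"
      by auto
    then show ?thesis
      by blast
  qed
  have "D - {u<..<v} - N = \<Union>?H"
  proof
    show "D - {u<..<v} - N \<subseteq> \<Union>?H"
    proof
      fix x
      assume x: "x \<in> D - {u<..<v} - N"
      then obtain I where I: "I \<in> ?G" "x \<in> I"
        unfolding D by blast
      obtain a b where ab: "I = {a..b}"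
        using int[OF I(1)] by blast
      have "I \<inter> N = {}"
      proof (rule ccontr)
        assume "I \<inter> N \<noteq> {}"
        then obtain z where z: "z \<in> I" "z \<in> N"
          by blast
        have "{a..b} \<subseteq> D - {u<..<v}"
          unfolding D ab[symmetric] using I(1) by blast
        then have "a = b"
          using isolated_in_interval[OF N[OF z(2)]] z(1) ab by blast
        then have "x = z"
          using I(2) z(1) ab by simp
        then show False
          using x z(2) by blast
      qed
      then show "x \<in> \<Union>?H"
        using I by blast
    qed
    show "\<Union>?H \<subseteq> D - {u<..<v} - N"
      unfolding D by blast
  qed
  moreover have "multi_interval (\<Union>?H)"
  proof (rule multi_interval_Union)
    have "finite ?G"
      using F0(1) by simp
    then show "finite ?H"
      by (rule finite_subset[rotated]) blast
    show "\<exists>a b. I = {a..b}" if "I \<in> ?H" for I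
      by (rule int) (rule CollectD[OF that, THEN conjunct1])
  qed
  ultimately show ?thesis
    by simp
qed

text \<open>This and the next three definitions give names to the local abbreviations in
  \<open>collapse\<close> and to its result.\<close>

definition split_bands :: "band_union \<Rightarrow> real \<Rightarrow> real \<Rightarrow> band \<Rightarrow> bool \<Rightarrow> band set" where
  "split_bands Y u v B e = (bands Y - {B}) \<union> {B\<lparr>hi := u - shift B e\<rparr>, B\<lparr>lo := v - shift B e\<rparr>}"

definition attached :: "band set \<Rightarrow> real \<Rightarrow> band set" where
  "attached \<B> z = {B' \<in> \<B>. \<exists>e'. z \<in> base B' e'}"

definition loose :: "band_union \<Rightarrow> real \<Rightarrow> real \<Rightarrow> band \<Rightarrow> bool \<Rightarrow> real set" where
  "loose Y u v B e = {z \<in> {u, v}. z isolated_in (support Y - {u<..<v}) \<and>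
     (\<exists>B'. attached (split_bands Y u v B e) z = {B'} \<and> degenerate B')}"

definition collapsed :: "band_union \<Rightarrow> real \<Rightarrow> real \<Rightarrow> band \<Rightarrow> bool \<Rightarrow> band_union" where
  "collapsed Y u v B e = \<lparr>support = support Y - {u<..<v} - loose Y u v B e,
     bands = split_bands Y u v B e - (\<Union>z\<in>loose Y u v B e. attached (split_bands Y u v B e) z)\<rparr>"

lemma support_collapsed: "support (collapsed Y u v B e) = support Y - {u<..<v} - loose Y u v B e"
  and bands_collapsed: "bands (collapsed Y u v B e) =
    split_bands Y u v B e - (\<Union>z\<in>loose Y u v B e. attached (split_bands Y u v B e) z)"
  by (simp_all add: collapsed_def)

lemma collapse_collapsed:
  assumes "u < v" "free_arc Y {u<..<v} B e"
  shows "collapse Y (collapsed Y u v B e)"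
  unfolding collapse_def Let_def
  by (rule exI[of _ u], rule exI[of _ v], rule exI[of _ B], rule exI[of _ e])
    (simp add: assms support_collapsed bands_collapsed split_bands_def attached_def loose_def)

context
  fixes Y :: band_union and u v :: real and B :: band and e :: bool
  assumes Y: "union_of_bands Y" and uv: "u < v" and once: "covered_once Y {u<..<v} B e"
begin

lemma free_arc_closure: "{u..v} \<subseteq> base B e"
proof -
  have "closure {u<..<v} \<subseteq> base B e"
    using once by (intro closure_minimal) (auto simp: covered_once_def base_def)
  then show ?thesis
    using uv by simp
qed

lemma base_mono:
  assumes "shift B' = shift B0" "lo B0 \<le> lo B'" "hi B' \<le> hi (B0 :: band)"
  shows "base B' e' \<subseteq> base B0 e'" "rect B' \<subseteq> rect B0"
  using assms by (auto simp: base_def rect_def)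

lemma split_bandsE:
  assumes "B' \<in> split_bands Y u v B e"
  obtains B0 where "B0 \<in> bands Y" "shift B' = shift B0" "lo B0 \<le> lo B'" "hi B' \<le> hi B0" "lo B' \<le> hi B'"
    "\<And>e'. base B' e' \<inter> {u<..<v} = {}" "B' \<in> bands Y - {B} \<and> B0 = B' \<or> B' \<notin> bands Y - {B} \<and> B0 = B"
proof (cases "B' \<in> bands Y - {B}")
  case True
  then have "base B' e' \<inter> {u<..<v} = {}" for e'
    using once unfolding covered_once_def disjnt_def by blast
  then show ?thesis
    using True Y by (intro that[of B']) (auto simp: union_of_bands_def)
next
  case False
  have uv': "lo B + shift B e \<le> u" "v \<le> hi B + shift B e"
    using free_arc_closure uv by (auto simp: base_def)
  have other: "base B e' \<inter> {u<..<v} = {}" if "e' \<noteq> e" for e'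
    using once that unfolding covered_once_def disjnt_def by blast
  have B': "B' = B\<lparr>hi := u - shift B e\<rparr> \<or> B' = B\<lparr>lo := v - shift B e\<rparr>"
    using False assms by (auto simp: split_bands_def)
  then have s: "shift B' = shift B" "lo B \<le> lo B'" "hi B' \<le> hi B" "lo B' \<le> hi B'"
    using uv' uv by auto
  have "base B' e' \<inter> {u<..<v} = {}" for e'
  proof (cases "e' = e")
    case True
    then show ?thesis
      using B' by (auto simp: base_def)
  next
    case False
    then show ?thesis
      using other[OF False] base_mono(1)[OF s(1-3), of e'] by blast
  qed
  then show ?thesis
    by (intro that[of B]) (use False once s in \<open>auto simp: covered_once_def\<close>)
qed

lemma bands_collapsedD:
  "B' \<in> bands (collapsed Y u v B e) \<Longrightarrow> B' \<in> split_bands Y u v B e"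
  by (simp add: bands_collapsed)

lemma union_of_bands_collapsed: "union_of_bands (collapsed Y u v B e)"
  unfolding union_of_bands_def
proof (intro conjI ballI allI)
  show "multi_interval (support (collapsed Y u v B e))"
    unfolding support_collapsed using Y uv
    by (intro multi_interval_collapse) (auto simp: union_of_bands_def loose_def)
  show "finite (bands (collapsed Y u v B e))"
    using Y by (simp add: bands_collapsed split_bands_def union_of_bands_def)
  show "lo B' \<le> hi B'" if "B' \<in> bands (collapsed Y u v B e)" for B'
    using bands_collapsedD[OF that] by (rule split_bandsE)
  show "pairwise (\<lambda>B B'. disjnt (rect B) (rect B')) (bands (collapsed Y u v B e))"
  proof (rule pairwiseI)
    fix B1 B2
    assume B12: "B1 \<in> bands (collapsed Y u v B e)" "B2 \<in> bands (collapsed Y u v B e)" "B1 \<noteq> B2"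
    obtain C1 where C1: "C1 \<in> bands Y" "shift B1 = shift C1" "lo C1 \<le> lo B1" "hi B1 \<le> hi C1"  "B1 \<in> bands Y - {B} \<and> C1 = B1 \<or> B1 \<notin> bands Y - {B} \<and> C1 = B"
      using bands_collapsedD[OF B12(1)] by (rule split_bandsE)
    obtain C2 where C2: "C2 \<in> bands Y" "shift B2 = shift C2" "lo C2 \<le> lo B2" "hi B2 \<le> hi C2"  "B2 \<in> bands Y - {B} \<and> C2 = B2 \<or> B2 \<notin> bands Y - {B} \<and> C2 = B"
      using bands_collapsedD[OF B12(2)] by (rule split_bandsE)
    have sub: "rect B1 \<subseteq> rect C1" "rect B2 \<subseteq> rect C2"
      using base_mono(2) C1(2-4) C2(2-4) by blast+
    show "disjnt (rect B1) (rect B2)"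
    proof (cases "C1 = C2")
      case False
      then have "disjnt (rect C1) (rect C2)"
        using Y C1(1) C2(1) by (auto simp: union_of_bands_def pairwise_def)
      then show ?thesis
        using sub by (meson disjnt_subset1 disjnt_subset2)
    next
      case True
      have "B1 \<notin> bands Y - {B}" "B2 \<notin> bands Y - {B}"
        using True C1(5) C2(5) B12(3) by blast+
      then have "B1 = B\<lparr>hi := u - shift B e\<rparr> \<or> B1 = B\<lparr>lo := v - shift B e\<rparr>"
        "B2 = B\<lparr>hi := u - shift B e\<rparr> \<or> B2 = B\<lparr>lo := v - shift B e\<rparr>"
        using bands_collapsedD[OF B12(1)] bands_collapsedD[OF B12(2)] unfolding split_bands_def by blast+
      then show ?thesis
        using B12(3) uv by (auto simp: rect_def disjnt_def)
    qed
  qed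
  show "base B' e' \<subseteq> support (collapsed Y u v B e)" if B': "B' \<in> bands (collapsed Y u v B e)" for B' e'
  proof -
    obtain B0 where B0: "B0 \<in> bands Y" "shift B' = shift B0" "lo B0 \<le> lo B'" "hi B' \<le> hi B0"
      "\<And>e'. base B' e' \<inter> {u<..<v} = {}"
      using bands_collapsedD[OF B'] by (rule split_bandsE) blast
    have "base B' e' \<subseteq> support Y"
      using base_mono(1)[OF B0(2-4)] Y B0(1) unfolding union_of_bands_def by blast
    moreover have "base B' e' \<inter> loose Y u v B e = {}"
      using B' unfolding bands_collapsed attached_def by blast
    ultimately show ?thesis
      using B0(5) unfolding support_collapsed by blast
  qed
qed

text \<open>A removed band is one of the two degenerate remainders of the split band, attached to the removed point.\<close>

lemma removed_band:
  assumes "B' \<in> split_bands Y u v B e" "B' \<notin> bands (collapsed Y u v B e)"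
  obtains z where "z \<in> loose Y u v B e" "base B' e = {z}"
proof -
  obtain z where z: "z \<in> loose Y u v B e" "B' \<in> attached (split_bands Y u v B e) z"
    using assms by (auto simp: bands_collapsed)
  then obtain B1 where B1: "attached (split_bands Y u v B e) z = {B1}" "degenerate B1" and zuv: "z = u \<or> z = v"
    by (auto simp: loose_def)
  have uv': "lo B + shift B e \<le> u" "v \<le> hi B + shift B e"
    using free_arc_closure uv by (auto simp: base_def)
  have "\<exists>B2. B2 \<in> attached (split_bands Y u v B e) z \<and> z \<in> base B2 e"
  proof (cases "z = u")
    case True
    then have "z \<in> base (B\<lparr>hi := u - shift B e\<rparr>) e"
      using uv' by (simp add: base_def)
    then show ?thesis
      by (intro exI[of _ "B\<lparr>hi := u - shift B e\<rparr>"]) (auto simp: attached_def split_bands_def)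
  next
    case False
    then have "z \<in> base (B\<lparr>lo := v - shift B e\<rparr>) e"
      using uv' zuv by (simp add: base_def)
    then show ?thesis
      by (intro exI[of _ "B\<lparr>lo := v - shift B e\<rparr>"]) (auto simp: attached_def split_bands_def)
  qed
  then have "z \<in> base B' e" "degenerate B'"
    using B1 z(2) by auto
  then have "base B' e = {z}"
    by (auto simp: base_def degenerate_def)
  then show ?thesis
    using that z(1) by blast
qed

text \<open>A remainder of a band disappears only together with the point that its base consists of,
  so surviving points keep their bands.\<close>

lemma covering_collapsed:
  assumes x: "x \<in> support (collapsed Y u v B e)" and B0: "B0 \<in> bands Y" "x \<in> base B0 e"
  shows "\<exists>B'\<in>bands (collapsed Y u v B e). x \<in> base B' e \<and> shift B' = shift B0"
proof -
  have "\<exists>B'\<in>split_bands Y u v B e. x \<in> base B' e \<and> shift B' = shift B0"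
  proof (cases "B0 = B")
    case False
    then show ?thesis
      using B0 by (intro bexI[of _ B0]) (auto simp: split_bands_def)
  next
    case True
    show ?thesis
    proof (cases "x \<le> u")
      case True
      then show ?thesis
        using B0 \<open>B0 = B\<close> by (intro bexI[of _ "B\<lparr>hi := u - shift B e\<rparr>"]) (auto simp: split_bands_def base_def)
    next
      case False
      then have "v \<le> x"
        using x by (auto simp: support_collapsed)
      then show ?thesis
        using B0 \<open>B0 = B\<close> by (intro bexI[of _ "B\<lparr>lo := v - shift B e\<rparr>"]) (auto simp: split_bands_def base_def)
    qed
  qed
  then obtain B' where B': "B' \<in> split_bands Y u v B e" "x \<in> base B' e" "shift B' = shift B0"
    by blast
  have "B' \<in> bands (collapsed Y u v B e)"
  proof (rule ccontr)
    assume "B' \<notin> bands (collapsed Y u v B e)"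
    with B'(1) obtain z where z: "z \<in> loose Y u v B e" "base B' e = {z}"
      by (rule removed_band)
    then show False
      using x B'(2) by (auto simp: support_collapsed)
  qed
  then show ?thesis
    using B' by blast
qed

end

text \<open>The arc extends to the nearest endpoints of other bases or to the ends of the covering
  base. It is maximal since bases are closed and contain these endpoints.\<close>

lemma free_arc_around:
  assumes Y: "union_of_bands Y" and B: "B \<in> bands Y"
    and x: "lo B + shift B e < x" "x < hi B + shift B e"
    and single: "\<And>B' e'. B' \<in> bands Y \<Longrightarrow> x \<in> base B' e' \<Longrightarrow> B' = B \<and> e' = e"
  obtains u v where "u < x" "x < v" "free_arc Y {u<..<v} B e"
proof -
  let ?O = "bands Y \<times> UNIV - {(B, e)}"
  let ?r = "\<lambda>(B', e'). hi B' + shift B' e'" and ?l = "\<lambda>(B', e'). lo B' + shift B' e'"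
  define P where "P = insert (lo B + shift B e) {q \<in> ?r ` ?O. q < x}"
  define Q where "Q = insert (hi B + shift B e) {q \<in> ?l ` ?O. x < q}"
  define u where "u = Max P"
  define v where "v = Min Q"
  have fin: "finite P" "finite Q"
    using Y by (auto simp: P_def Q_def union_of_bands_def)
  have ne: "P \<noteq> {}" "Q \<noteq> {}"
    by (auto simp: P_def Q_def)
  have mem: "u \<in> P" "v \<in> Q"
    unfolding u_def v_def by (rule Max_in[OF fin(1) ne(1)], rule Min_in[OF fin(2) ne(2)])
  have ux: "u < x" "x < v"
    using mem x by (auto simp: P_def Q_def)
  have bound: "lo B + shift B e \<le> u" "v \<le> hi B + shift B e"
    unfolding u_def v_def using fin by (auto simp: P_def Q_def intro!: Max_ge Min_le)
  have disj: "disjnt (base B' e') {u<..<v}" if B': "B' \<in> bands Y" "(B', e') \<noteq> (B, e)" for B' e'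
  proof -
    have O: "(B', e') \<in> ?O"
      using B' by blast
    have "x \<notin> base B' e'"
      using single[OF B'(1)] B'(2) by blast
    then consider "hi B' + shift B' e' < x" | "x < lo B' + shift B' e'"
      by (auto simp: base_def not_le)
    then show ?thesis
    proof cases
      case 1
      then have "hi B' + shift B' e' \<in> P"
        using imageI[OF O, of ?r] by (simp add: P_def)
      then have "hi B' + shift B' e' \<le> u"
        unfolding u_def using fin(1) by (intro Max_ge)
      then show ?thesis
        by (auto simp: disjnt_def base_def)
    next
      case 2
      then have "lo B' + shift B' e' \<in> Q"
        using imageI[OF O, of ?l] by (simp add: Q_def)
      then have "v \<le> lo B' + shift B' e'"
        unfolding v_def using fin(2) by (intro Min_le)
      then show ?thesis
        by (auto simp: disjnt_def base_def)
    qed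
  qed
  have sub: "{u<..<v} \<subseteq> base B e"
    using bound by (auto simp: base_def)
  have "base B e \<subseteq> support Y"
    using Y B by (auto simp: union_of_bands_def)
  then have "covered_once Y {u<..<v} B e"
    unfolding covered_once_def using sub B disj ux by (intro conjI exI[of _ u] exI[of _ v]) auto
  moreover have "J' = {u<..<v}" if J': "covered_once Y J' B' e'" "{u<..<v} \<subseteq> J'" for J' B' e'
  proof -
    obtain a b where ab: "J' = {a<..<b}"
      using J'(1) by (auto simp: covered_once_def)
    have xJ: "x \<in> J'"
      using J'(2) ux by auto
    then have "x \<in> base B' e'" "B' \<in> bands Y"
      using J'(1) by (auto simp: covered_once_def)
    then have eq: "B' = B" "e' = e"
      using single by blast+
    have Jsub: "J' \<subseteq> base B e" and Jdis: "\<And>B1 e1. B1 \<in> bands Y \<Longrightarrow> (B1, e1) \<noteq> (B, e) \<Longrightarrow> disjnt (base B1 e1) J'"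
      using J'(1) by (auto simp: covered_once_def eq)
    have le: "a \<le> u" "v \<le> b"
      using J'(2) ux by (simp_all add: ab greaterThanLessThan_subseteq_greaterThanLessThan)
    have "\<not> a < u"
    proof
      assume "a < u"
      then have uJ: "u \<in> J'" "(a + u) / 2 \<in> J'"
        using ux le by (auto simp: ab)
      show False
      proof (cases "u = lo B + shift B e")
        case True
        then show False
          using subsetD[OF Jsub uJ(2)] \<open>a < u\<close> by (simp add: base_def)
      next
        case False
        then obtain B1 e1 where B1: "B1 \<in> bands Y" "(B1, e1) \<noteq> (B, e)" "u = hi B1 + shift B1 e1"
          using mem(1) by (auto simp: P_def)
        then have "u \<in> base B1 e1"
          using Y by (auto simp: base_def union_of_bands_def)
        then show False
          using Jdis[OF B1(1,2)] uJ(1) by (auto simp: disjnt_def)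
      qed
    qed
    moreover have "\<not> v < b"
    proof
      assume "v < b"
      then have vJ: "v \<in> J'" "(v + b) / 2 \<in> J'"
        using ux le by (auto simp: ab)
      show False
      proof (cases "v = hi B + shift B e")
        case True
        then show False
          using subsetD[OF Jsub vJ(2)] \<open>v < b\<close> by (simp add: base_def)
      next
        case False
        then obtain B1 e1 where B1: "B1 \<in> bands Y" "(B1, e1) \<noteq> (B, e)" "v = lo B1 + shift B1 e1"
          using mem(2) by (auto simp: Q_def)
        then have "v \<in> base B1 e1"
          using Y by (auto simp: base_def union_of_bands_def)
        then show False
          using Jdis[OF B1(1,2)] vJ(1) by (auto simp: disjnt_def)
      qed
    qed
    ultimately show ?thesis
      using le by (simp add: ab)
  qed
  ultimately have "free_arc Y {u<..<v} B e"
    unfolding free_arc_def by blast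
  then show ?thesis
    using that ux by blast
qed

context interval_translation_map
begin

text \<open>The invariant of the collapsing sequence. Countable loss of \<open>Om\<close> keeps the
  support large, and the last two clauses say that the bottoms still cover it and act on it as
  \<open>F\<close> does.\<close>

definition partially_collapsed :: "band_union \<Rightarrow> bool" where
  "partially_collapsed Z \<longleftrightarrow> union_of_bands Z \<and> support Z \<subseteq> {0..1} \<and> countable (Om - support Z) \<and>
     (\<forall>B\<in>bands Z. \<exists>T\<in>bands suspension. shift B = shift T \<and> lo T \<le> lo B \<and> hi B \<le> hi T) \<and>
     (\<forall>x\<in>support Z. \<forall>T\<in>bands suspension. x \<in> base T False \<longrightarrow> (\<exists>B\<in>bands Z. x \<in> base B False \<and> shift B = shift T))"

lemma partially_collapsed_suspension: "partially_collapsed suspension"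
  unfolding partially_collapsed_def
proof (intro conjI)
  have "Om - support suspension = {}"
    using Om_subset by (auto simp: support_suspension)
  then show "countable (Om - support suspension)"
    by (simp only: countable_empty)
qed (use union_of_bands_suspension in \<open>auto simp: support_suspension\<close>)

context
  fixes Z :: band_union
  assumes Z: "partially_collapsed Z"
begin

lemma Z_facts:
  shows "union_of_bands Z" "support Z \<subseteq> {0..1}" "countable (Om - support Z)"
    "\<And>B'. B' \<in> bands Z \<Longrightarrow> \<exists>T\<in>bands suspension. shift B' = shift T \<and> lo T \<le> lo B' \<and> hi B' \<le> hi T"
    "\<And>x T. x \<in> support Z \<Longrightarrow> T \<in> bands suspension \<Longrightarrow> x \<in> base T False \<Longrightarrow> \<exists>B'\<in>bands Z. x \<in> base B' False \<and> shift B' = shift T"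
  using Z unfolding partially_collapsed_def by blast+

lemma Z_base: "B' \<in> bands Z \<Longrightarrow> base B' e \<subseteq> support Z"
  using Z_facts(1) by (auto simp: union_of_bands_def)

lemma shift_band:
  assumes "B' \<in> bands Z" "x \<in> base B' False" "x \<notin> singular"
  shows "shift B' = shift (band_of x)" "x \<in> {0..<1}"
proof -
  obtain T where T: "T \<in> bands suspension" "shift B' = shift T" "lo T \<le> lo B'" "hi B' \<le> hi T"
    using Z_facts(4)[OF assms(1)] by blast
  then have t: "x - shift T False \<in> {lo T..hi T}"
    using assms(2) by (auto simp: base_def)
  have "x - shift T False + shift T False \<notin> singular"
    using assms(3) by simp
  from band_of_unique[OF T(1) t this] have "T = band_of x" "x \<in> {0..<1}"
    by simp_all
  then show "shift B' = shift (band_of x)" "x \<in> {0..<1}"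
    using T(2) by simp_all
qed

lemma base_False_imp_top:
  assumes "B' \<in> bands Z" "x \<in> base B' False" "shift B' = shift (band_of x)"
  shows "F x \<in> base B' True"
  using assms(2,3) band_of_top[of x] by (auto simp: base_def)

lemma base_band_of: "x \<in> {0..1} \<Longrightarrow> x \<in> base (band_of x) False"
  using band_of(2)[of x] by (auto simp: base_def)

text \<open>Otherwise the support would be finite, although it contains the uncountable set
  \<open>Om\<close> up to countably many points.\<close>

lemma support_contains_interval: "\<exists>a b. a < b \<and> {a..b} \<subseteq> support Z"
proof (rule ccontr)
  assume no: "\<nexists>a b. a < b \<and> {a..b} \<subseteq> support Z"
  obtain \<F> where F: "finite \<F>" "\<forall>I\<in>\<F>. \<exists>u v. u \<le> v \<and> I = {u..v}" "support Z = \<Union>\<F>"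
    using Z_facts(1) unfolding union_of_bands_def multi_interval_def by blast
  have "finite S" if S: "S \<in> \<F>" for S
  proof -
    obtain a b where ab: "a \<le> b" "S = {a..b}"
      using F(2) S by blast
    moreover have "S \<subseteq> support Z"
      using F(3) S by blast
    ultimately have "a = b"
      using no by (metis order_le_less)
    then show ?thesis
      using ab by simp
  qed
  then have "finite (support Z)"
    using F(1,3) by simp
  then have "countable (support Z \<union> (Om - support Z))"
    by (rule countable_Un[OF countable_finite Z_facts(3)])
  then have "countable Om"
    by (rule countable_subset[rotated]) blast
  then show False
    using uncountable_Om by blast
qed

text \<open>If all but countably many points of the support were covered by tops, all but countably many of
  them would lie in every image of the map, and \<open>Om\<close> would have interior.\<close>

lemma uncovered_by_tops: "uncountable (support Z - (\<Union>B\<in>bands Z. base B True))"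
proof
  let ?T = "\<Union>B\<in>bands Z. base B True"
  let ?D = "support Z \<inter> {0..<1}"
  assume c: "countable (support Z - ?T)"
  \<comment> \<open>Also excluded are the tops of arcs with singular bottom; every other point
    covered by a top is the image under \<open>F\<close> of a point of the support.\<close>
  let ?N = "(support Z - ?T) \<union> (\<lambda>(B', x). x - shift B' False + shift B' True) ` (bands Z \<times> singular)"
  have "finite (bands Z)"
    using Z_facts(1) by (simp add: union_of_bands_def)
  then have N: "countable ?N"
    using c by (intro countable_Un countable_image) (auto simp: singular_def countable_finite)
  have pre: "\<exists>x\<in>?D. y = F x" if y: "y \<in> ?D" "y \<notin> ?N" for y
  proof -
    obtain B' where B': "B' \<in> bands Z" "y \<in> base B' True"
      using y by blast
    let ?x = "y - shift B' True + shift B' False"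
    have x: "?x \<in> base B' False"
      using B'(2) by (auto simp: base_def)
    have "?x \<notin> singular"
    proof
      assume "?x \<in> singular"
      then have "y \<in> (\<lambda>(B', x). x - shift B' False + shift B' True) ` (bands Z \<times> singular)"
        using B'(1) by (intro image_eqI[of _ _ "(B', ?x)"]) auto
      then show False
        using y(2) by blast
    qed
    note s = shift_band[OF B'(1) x this]
    have "F ?x = y"
      using band_of_top[of ?x] unfolding s(1)[symmetric] by simp
    then show ?thesis
      using s(2) x Z_base[OF B'(1)] by (intro bexI[of _ ?x]) auto
  qed
  have "countable (?D - (F ^^ n) ` {0..<1})" for n
  proof (induction n)
    case (Suc n)
    have "?D - (F ^^ Suc n) ` {0..<1} \<subseteq> ?N \<union> F ` (?D - (F ^^ n) ` {0..<1})"
    proof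
      fix y
      assume y: "y \<in> ?D - (F ^^ Suc n) ` {0..<1}"
      show "y \<in> ?N \<union> F ` (?D - (F ^^ n) ` {0..<1})"
      proof (cases "y \<in> ?N")
        case False
        then obtain x where x: "x \<in> ?D" "y = F x"
          using pre y by blast
        have "x \<notin> (F ^^ n) ` {0..<1}"
        proof
          assume "x \<in> (F ^^ n) ` {0..<1}"
          then have "y \<in> (F ^^ Suc n) ` {0..<1}"
            unfolding x(2) by auto
          then show False
            using y by blast
        qed
        then show ?thesis
          using x by blast
      qed blast
    qed
    moreover have "countable (?N \<union> F ` (?D - (F ^^ n) ` {0..<1}))"
      by (rule countable_Un[OF N countable_image[OF Suc.IH]])
    ultimately show ?case
      by (rule countable_subset)
  next
    case 0
    have "?D - (F ^^ 0) ` {0..<1} = {}"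
      by auto
    then show ?case
      by (simp only: countable_empty)
  qed
  then have "countable (\<Union>n. ?D - (F ^^ n) ` {0..<1})"
    by (intro countable_UN) auto
  moreover have "?D - Om \<subseteq> (\<Union>n. ?D - (F ^^ n) ` {0..<1})"
    by (auto simp: Om_def)
  ultimately have D: "countable (?D - Om)"
    by (rule countable_subset[rotated])
  obtain a b where ab: "a < b" "{a..b} \<subseteq> support Z"
    using support_contains_interval by blast
  then have "{a..b} \<subseteq> {0..1}"
    using Z_facts(2) by (rule_tac order_trans)
  then have ab01: "0 \<le> a" "b \<le> 1"
    using ab(1) by auto
  obtain c d where cd: "c < d" "{c<..<d} \<subseteq> {a<..<b} - Om"
    using Om_nowhere_dense[OF ab01(1) ab(1) ab01(2)] by blast
  have "{a<..<b} \<subseteq> ?D"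
    using ab(2) ab01 by fastforce
  then have "{c<..<d} \<subseteq> ?D - Om"
    using cd(2) by blast
  then have "countable {c<..<d}"
    using D by (rule countable_subset)
  then show False
    using cd(1) uncountable_open_interval by blast
qed

text \<open>Uncountably many points are in no top. One that is neither singular nor an endpoint of a
  bottom lies inside exactly one base, a bottom, and hence in a free arc.\<close>

lemma collapse_exists: "\<exists>Z'. collapse Z Z' \<and> partially_collapsed Z'"
proof -
  let ?W = "singular \<union> (\<lambda>B. lo B + shift B False) ` bands Z \<union> (\<lambda>B. hi B + shift B False) ` bands Z"
  have "finite (bands Z)"
    using Z_facts(1) by (simp add: union_of_bands_def)
  then have "countable ?W"
    by (intro countable_finite) (auto simp: singular_def)
  then have "uncountable (support Z - (\<Union>B\<in>bands Z. base B True) - ?W)"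
    using uncovered_by_tops uncountable_minus_countable by blast
  then have "support Z - (\<Union>B\<in>bands Z. base B True) - ?W \<noteq> {}"
    by force
  then obtain x where x: "x \<in> support Z" "x \<notin> (\<Union>B\<in>bands Z. base B True)" "x \<notin> ?W"
    by blast
  have xs: "x \<notin> singular" and x01: "x \<in> {0..1}"
    using x Z_facts(2) by blast+
  obtain B' where B': "B' \<in> bands Z" "x \<in> base B' False" "shift B' = shift (band_of x)"
    using Z_facts(5)[OF x(1) band_of(1)[OF x01] base_band_of[OF x01]] by blast
  have "x \<noteq> lo B' + shift B' False" "x \<noteq> hi B' + shift B' False"
    using x(3) B'(1) by auto
  then have lx: "lo B' + shift B' False < x" "x < hi B' + shift B' False"
    using B'(2) by (auto simp: base_def)
  have single: "B1 = B' \<and> e1 = False" if B1: "B1 \<in> bands Z" "x \<in> base B1 e1" for B1 e1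
  proof -
    have e1: "e1 = False"
      using x(2) B1 by (cases e1) auto
    then have "shift B1 = shift B'"
      using shift_band(1)[OF B1(1) _ xs] B1(2) B'(3) by simp
    then have "(x - shift B' False, 0) \<in> rect B1 \<inter> rect B'"
      using B1(2) B'(2) e1 by (auto simp: rect_def base_def)
    moreover have "B1 \<noteq> B' \<Longrightarrow> disjnt (rect B1) (rect B')"
      using Z_facts(1) B1(1) B'(1) by (auto simp: union_of_bands_def pairwise_def)
    ultimately show ?thesis
      using e1 by (auto simp: disjnt_def)
  qed
  obtain u v where uv: "u < x" "x < v" "free_arc Z {u<..<v} B' False"
    using free_arc_around[OF Z_facts(1) B'(1) lx single] by blast
  then have u_v: "u < v" and once: "covered_once Z {u<..<v} B' False"
    by (auto simp: free_arc_def)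
  let ?Z = "collapsed Z u v B' False"
  have sup: "support ?Z \<subseteq> support Z"
    by (auto simp: support_collapsed)
  have "partially_collapsed ?Z"
    unfolding partially_collapsed_def
  proof (intro conjI)
    show "union_of_bands ?Z"
      by (rule union_of_bands_collapsed[OF Z_facts(1) u_v once])
    show "support ?Z \<subseteq> {0..1}"
      using sup Z_facts(2) by blast
    \<comment> \<open>A point of \<open>Om\<close> in the removed arc has a preimage in
      \<open>Om\<close>. This preimage was already missing, since otherwise a top would meet the
      free arc.\<close>
    have "Om - support ?Z \<subseteq> (Om - support Z) \<union> F ` (Om - support Z) \<union> {u, v}"
    proof
      fix y
      assume y: "y \<in> Om - support ?Z"
      show "y \<in> (Om - support Z) \<union> F ` (Om - support Z) \<union> {u, v}"
      proof (cases "y \<in> {u<..<v}")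
        case False
        then show ?thesis
          using y by (auto simp: support_collapsed loose_def)
      next
        case True
        obtain z where z: "z \<in> Om" "F z = y"
          using Om_preimage y by blast
        have "z \<notin> support Z"
        proof
          assume zs: "z \<in> support Z"
          then have z01: "z \<in> {0..1}"
            using Z_facts(2) by blast
          obtain B1 where B1: "B1 \<in> bands Z" "z \<in> base B1 False" "shift B1 = shift (band_of z)"
            using Z_facts(5)[OF zs band_of(1)[OF z01] base_band_of[OF z01]] by blast
          then have "y \<in> base B1 True"
            using base_False_imp_top z(2) by blast
          moreover have "disjnt (base B1 True) {u<..<v}"
            using once B1(1) by (auto simp: covered_once_def)
          ultimately show False
            using True by (auto simp: disjnt_def)
        qed
        then show ?thesis
          using z by blast
      qed
    qed
    moreover have "countable ((Om - support Z) \<union> F ` (Om - support Z) \<union> {u, v})"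
      using Z_facts(3) by (intro countable_Un countable_image) auto
    ultimately show "countable (Om - support ?Z)"
      by (rule countable_subset)
    show "\<forall>B1\<in>bands ?Z. \<exists>T\<in>bands suspension. shift B1 = shift T \<and> lo T \<le> lo B1 \<and> hi B1 \<le> hi T"
    proof
      fix B1
      assume "B1 \<in> bands ?Z"
      then have "B1 \<in> split_bands Z u v B' False"
        by (simp add: bands_collapsed)
      then obtain B0 where B0: "B0 \<in> bands Z" "shift B1 = shift B0" "lo B0 \<le> lo B1" "hi B1 \<le> hi B0"
        by (rule split_bandsE[OF Z_facts(1) u_v once])
      then obtain T where T: "T \<in> bands suspension" "shift B0 = shift T" "lo T \<le> lo B0" "hi B0 \<le> hi T"
        using Z_facts(4) by blast
      then show "\<exists>T\<in>bands suspension. shift B1 = shift T \<and> lo T \<le> lo B1 \<and> hi B1 \<le> hi T"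
        using B0 by (intro bexI[of _ T]) auto
    qed
    show "\<forall>x\<in>support ?Z. \<forall>T\<in>bands suspension. x \<in> base T False \<longrightarrow>
        (\<exists>B1\<in>bands ?Z. x \<in> base B1 False \<and> shift B1 = shift T)"
    proof (intro ballI impI)
      fix z T
      assume z: "z \<in> support ?Z" "T \<in> bands suspension" "z \<in> base T False"
      then obtain B0 where "B0 \<in> bands Z" "z \<in> base B0 False" "shift B0 = shift T"
        using Z_facts(5) sup by blast
      then show "\<exists>B1\<in>bands ?Z. z \<in> base B1 False \<and> shift B1 = shift T"
        using covering_collapsed[OF Z_facts(1) u_v once z(1)] by metis
    qed
  qed
  then show ?thesis
    using collapse_collapsed[OF u_v uv(3)] by blast
qed

end

lemma thin_type_suspension: "thin_type suspension"
  unfolding thin_type_def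
proof (intro conjI union_of_bands_suspension annulus_free_suspension ballI)
  show "space_of suspension closure_of K = points suspension" if "K \<in> leaves suspension" for K
    using that leaf_dense unfolding leaves_suspension by blast
  have "\<forall>Z. partially_collapsed Z \<longrightarrow> (\<exists>Z'. collapse Z Z' \<and> partially_collapsed Z')"
    using collapse_exists by blast
  then obtain next_collapse where n: "\<forall>Z. partially_collapsed Z \<longrightarrow> collapse Z (next_collapse Z) \<and> partially_collapsed (next_collapse Z)"
    by metis
  let ?Ys = "\<lambda>n. (next_collapse ^^ n) suspension"
  have inv: "partially_collapsed (?Ys n)" for n
    using n partially_collapsed_suspension by (induction n) simp_all
  show "\<exists>Ys. Ys 0 = suspension \<and> (\<forall>i::nat. collapse (Ys i) (Ys (Suc i)))"
    using n inv by (intro exI[of _ ?Ys]) simp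
qed

end

context interval_translation_map
begin

section \<open>Two-ended leaves\<close>

text \<open>Covers sets that contain all or nothing of the open arc, with an endpoint only if they
  contain the open arc; in this form openness in a leaf is checked arc by arc.\<close>

lemma openin_unit:
  assumes "\<And>y. y \<in> {0<..<1} \<Longrightarrow> Q y = c" "Q 0 \<Longrightarrow> c" "Q 1 \<Longrightarrow> c"
  shows "openin (top_of_set {0..1::real}) {y \<in> {0..1}. Q y}"
proof (cases c)
  case True
  have "{y \<in> {0..1}. Q y} = {0..1} \<inter> - ((if Q 0 then {} else {0}) \<union> (if Q 1 then {} else {1}))"
  proof (intro set_eqI)
    fix y :: real
    consider "y = 0" | "y = 1" | "y \<in> {0<..<1}" | "y \<notin> {0..1}"
      by force
    then show "y \<in> {y \<in> {0..1}. Q y} \<longleftrightarrow> y \<in> {0..1} \<inter> - ((if Q 0 then {} else {0}) \<union> (if Q 1 then {} else {1}))"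
      using assms(1)[of y] True by cases auto
  qed
  moreover have "open (- ((if Q 0 then {} else {0}) \<union> (if Q 1 then {} else {1 :: real})))"
    by (intro open_Compl closed_Un) auto
  ultimately show ?thesis
    by (simp only: openin_open_Int)
next
  case False
  have "\<not> Q y" if "y \<in> {0..1}" for y
  proof (cases "y = 0 \<or> y = 1")
    case False
    then have "y \<in> {0<..<1}"
      using that by auto
    then show ?thesis
      using assms(1) \<open>\<not> c\<close> by blast
  qed (use assms(2,3) False in blast)
  then have "{y \<in> {0..1}. Q y} = {}"
    by blast
  then show ?thesis
    by (simp only: openin_empty)
qed

lemma vertex_arc:
  assumes "v \<in> {0..<1}" "y \<in> {0..<1}"
  shows "vertex suspension (arc_at v y) = v" "height (arc_at v y) = y"
proof -
  have v: "v \<in> {0..1}"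
    using assms by simp
  show "vertex suspension (arc_at v y) = v"
    using Y.band_at[OF band_of[OF v]] assms(2) by (auto simp: arc_at_def glue_def vertex_def)
  show "height (arc_at v y) = y"
    using assms(2) by (auto simp: arc_at_def glue_def height_def)
qed

lemma arc_at_inject:
  assumes "arc_at v y = arc_at v' y'" "v \<in> {0..<1}" "v' \<in> {0..<1}" "y \<in> {0..<1}" "y' \<in> {0..<1}"
  shows "v = v'" "y = y'"
  using vertex_arc[OF assms(2,4)] vertex_arc[OF assms(3,5)] assms(1) by auto

context
  fixes x :: real
  assumes x: "regular x"
begin

abbreviation cls :: "real \<Rightarrow> bool" where "cls v \<equiv> (x, v) \<in> leaf_rel suspension"

abbreviation X :: "point topology" where "X \<equiv> leaf_space suspension (leaf_of suspension x)"

lemma cls_unit: "cls v \<Longrightarrow> v \<in> {0..<1}"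
  using regular_leaf_rel[OF x] by blast

lemma cls_F_pow: "cls v \<Longrightarrow> cls ((F ^^ n) v)"
  using F_pow_leaf_rel cls_unit leaf_rel_trans by blast

lemma cls_F: "cls v \<Longrightarrow> cls (F v)"
  using cls_F_pow[of v 1] by simp

lemma cls_preimage: "cls ((F ^^ n) u) \<Longrightarrow> u \<in> {0..<1} \<Longrightarrow> cls u"
  using F_pow_leaf_rel leaf_rel_trans leaf_rel_sym by blast

lemma cls_merge: "cls u \<Longrightarrow> cls v \<Longrightarrow> \<exists>a b. (F ^^ a) u = (F ^^ b) v"
proof -
  assume "cls u" "cls v"
  then obtain m n m' n' where e: "(F ^^ m) x = (F ^^ n) u" "(F ^^ m') x = (F ^^ n') v"
    using regular_leaf_rel[OF x] by blast
  have "(F ^^ (m' + n)) u = (F ^^ (m' + m)) x"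
    unfolding funpow_add o_apply e(1) ..
  also have "\<dots> = (F ^^ (m + m')) x"
    by (simp only: add.commute)
  also have "\<dots> = (F ^^ (m + n')) v"
    unfolding funpow_add o_apply e(2) ..
  finally show ?thesis
    by blast
qed

lemma arc_in_leaf: "cls v \<Longrightarrow> y \<in> {0..1} \<Longrightarrow> arc_at v y \<in> leaf_of suspension x"
proof -
  assume v: "cls v" and y: "y \<in> {0..1}"
  have "v \<in> {0..1}"
    using cls_unit[OF v] by simp
  note b = band_of[OF this]
  show ?thesis
    unfolding arc_at_def by (rule Y.glue_leaf_of[OF b y, where e = False]) (use v in simp)
qed

lemma leafE:
  assumes "p \<in> leaf_of suspension x"
  obtains v y where "cls v" "v \<in> {0..<1}" "y \<in> {0..<1}" "p = arc_at v y"
  using leaf_of_regularE[OF x assms] by metis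

lemma openin_leafI:
  assumes U: "U \<subseteq> leaf_of suspension x"
    and arcs: "\<And>v. cls v \<Longrightarrow> openin (top_of_set {0..1}) {y \<in> {0..1}. arc_at v y \<in> U}"
  shows "openin X U"
  unfolding openin_leaf_space
proof (intro conjI U ballI)
  fix B t
  assume B: "B \<in> bands suspension" "t \<in> {lo B..hi B}"
  let ?v = "t + shift B False"
  show "openin (top_of_set {0..1}) {y \<in> {0..1}. glue B (t, y) \<in> U}"
  proof (cases "cls ?v")
    case True
    then have "?v \<notin> singular"
      using x by (auto simp: regular_def)
    then have "B = band_of ?v"
      using band_of_unique(1)[OF B] by simp
    then have "arc_at ?v y = glue B (t, y)" for y
      unfolding arc_at_def by (metis add_diff_cancel_right')
    then show ?thesis
      using arcs[OF True] by simp
  next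
    case False
    have "glue B (t, y) \<notin> U" if y: "y \<in> {0..1}" for y
    proof
      assume "glue B (t, y) \<in> U"
      then have "cls (vertex suspension (glue B (t, y)))"
        using U by (auto simp: leaf_of_def)
      then show False
        using Y.vertex_glue[OF B y] False leaf_rel_trans leaf_rel_sym by blast
    qed
    then have "{y \<in> {0..1}. glue B (t, y) \<in> U} = {}"
      by blast
    then show ?thesis
      by (simp only: openin_empty)
  qed
qed

lemma topspace_leaf: "topspace X = leaf_of suspension x"
proof
  show "topspace X \<subseteq> leaf_of suspension x"
    using openin_topspace[of X] openin_leaf_space by blast
  have "openin X (leaf_of suspension x)"
  proof (rule openin_leafI)
    fix v
    assume "cls v"
    then have "{y \<in> {0..1}. arc_at v y \<in> leaf_of suspension x} = {0..1}"
      using arc_in_leaf by blast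
    then show "openin (top_of_set {0..1}) {y \<in> {0..1}. arc_at v y \<in> leaf_of suspension x}"
      by simp
  qed simp
  then show "leaf_of suspension x \<subseteq> topspace X"
    by (rule openin_subset)
qed

lemma continuous_map_arc: "cls v \<Longrightarrow> continuous_map (top_of_set {0..1}) X (arc_at v)"
  unfolding continuous_map_def
proof (intro conjI allI impI)
  assume v: "cls v"
  show "arc_at v \<in> topspace (top_of_set {0..1}) \<rightarrow> topspace X"
    using arc_in_leaf[OF v] by (simp add: topspace_leaf)
  fix U
  assume "openin X U"
  moreover have "v \<in> {0..1}"
    using cls_unit[OF v] by simp
  ultimately show "openin (top_of_set {0..1}) {y \<in> topspace (top_of_set {0..1}). arc_at v y \<in> U}"
    using band_of[of v] unfolding openin_leaf_space arc_at_def by simp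
qed

lemma connectedin_arc: "cls v \<Longrightarrow> connectedin X (arc_at v ` T)" if "connected T" "T \<subseteq> {0..1}"
proof (rule connectedin_continuous_map_image[OF continuous_map_arc])
  show "connectedin (top_of_set {0..1}) T"
    using that by (simp add: connectedin_subtopology)
qed

lemma compactin_arc: "cls v \<Longrightarrow> compactin X (arc_at v ` {0..1})"
  by (rule image_compactin[OF _ continuous_map_arc]) (simp_all add: compactin_subtopology)

text \<open>The arcs along the orbit of \<open>u\<close> up to its \<open>i\<close>-th point; the
  inserted point matters for \<open>i = 0\<close>.\<close>

definition chain :: "real \<Rightarrow> nat \<Rightarrow> point set" where
  "chain u i = insert (Inl u) (\<Union>j<i. arc_at ((F ^^ j) u) ` {0..1})"

lemma chain:
  assumes "cls u"
  shows "connectedin X (chain u i)" "Inl ((F ^^ i) u) \<in> chain u i" "Inl u \<in> chain u i"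
proof -
  have "connectedin X (chain u i) \<and> Inl ((F ^^ i) u) \<in> chain u i"
  proof (induction i)
    case 0
    have "Inl u \<in> topspace X"
      using arc_in_leaf[OF assms, of 0] by (simp add: topspace_leaf arc_at_0)
    then show ?case
      by (simp add: chain_def connectedin_sing)
  next
    case (Suc i)
    let ?v = "(F ^^ i) u"
    have eq: "chain u (Suc i) = chain u i \<union> arc_at ?v ` {0..1}"
      by (auto simp: chain_def lessThan_Suc)
    have start: "Inl ?v \<in> arc_at ?v ` {0..1}" and stop: "Inl (F ?v) \<in> arc_at ?v ` {0..1}"
      using arc_at_0[of ?v] arc_at_1[of ?v] by (metis atLeastAtMost_iff imageI order_refl zero_le_one)+
    have "connectedin X (chain u i \<union> arc_at ?v ` {0..1})"
      using Suc start cls_F_pow[OF assms] by (intro connectedin_Un connectedin_arc) auto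
    then show ?case
      using eq stop by simp
  qed
  then show "connectedin X (chain u i)" "Inl ((F ^^ i) u) \<in> chain u i"
    by blast+
  show "Inl u \<in> chain u i"
    by (simp add: chain_def)
qed

lemma join:
  assumes "cls u" "cls v" "(F ^^ a) u = (F ^^ b) v"
  shows "connectedin X (arc_at u ` {0..1} \<union> chain u a \<union> chain v b)" "Inl v \<in> arc_at u ` {0..1} \<union> chain u a \<union> chain v b"
proof -
  have "Inl u \<in> arc_at u ` {0..1}"
    using arc_at_0[of u] by (metis atLeastAtMost_iff imageI order_refl zero_le_one)
  then have "connectedin X (arc_at u ` {0..1} \<union> chain u a)"
    using assms(1) chain[OF assms(1)] by (intro connectedin_Un connectedin_arc) auto
  moreover have "Inl ((F ^^ b) v) \<in> chain v b" "Inl ((F ^^ b) v) \<in> chain u a"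
    using chain(2)[OF assms(2), of b] chain(2)[OF assms(1), of a] assms(3) by simp_all
  ultimately show "connectedin X (arc_at u ` {0..1} \<union> chain u a \<union> chain v b)"
    using chain(1)[OF assms(2)] by (intro connectedin_Un[of X "arc_at u ` {0..1} \<union> chain u a"]) blast+
  show "Inl v \<in> arc_at u ` {0..1} \<union> chain u a \<union> chain v b"
    using chain(3)[OF assms(2)] by blast
qed

lemma connectedin_star:
  assumes "\<And>p. p \<in> S \<Longrightarrow> \<exists>T. connectedin X T \<and> a \<in> T \<and> p \<in> T \<and> T \<subseteq> S"
  shows "connectedin X S"
proof -
  have "\<forall>p\<in>S. \<exists>T. connectedin X T \<and> a \<in> T \<and> p \<in> T \<and> T \<subseteq> S"
    by (intro ballI assms)
  from bchoice[OF this] obtain T where T: "\<forall>p\<in>S. connectedin X (T p) \<and> a \<in> T p \<and> p \<in> T p \<and> T p \<subseteq> S"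
    by (elim exE) (rule that)
  show ?thesis
  proof (cases "S = {}")
    case False
    have "S = \<Union>(T ` S)"
    proof (rule set_eqI)
      fix p
      show "p \<in> S \<longleftrightarrow> p \<in> \<Union>(T ` S)"
        using bspec[OF T] by blast
    qed
    moreover have "a \<in> \<Inter>(T ` S)"
      using T by simp
    then have "connectedin X (\<Union>(T ` S))"
      using T by (intro connectedin_Union) auto
    ultimately show ?thesis
      by simp
  qed simp
qed

text \<open>Any two vertices have a common iterate, which gives connectedness. The leaf topology is
  finer than the induced one, so a circle in it is compact and maps homeomorphically into the
  Hausdorff complex, where regular leaves contain no circle.\<close>

lemma is_tree_leaf: "is_tree X"
  unfolding is_tree_def
proof (intro conjI notI)
  have cx: "cls x"
    by (rule leaf_rel_refl)
  have "connectedin X (topspace X)"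
  proof (rule connectedin_star[where a = "Inl x"])
    fix p
    assume "p \<in> topspace X"
    then obtain u y where u: "cls u" "y \<in> {0..<1}" "p = arc_at u y"
      unfolding topspace_leaf by (rule leafE)
    then obtain a b where ab: "(F ^^ a) u = (F ^^ b) x"
      using cls_merge[OF _ cx] by blast
    let ?T = "arc_at u ` {0..1} \<union> chain u a \<union> chain x b"
    have "p \<in> ?T"
      using u by auto
    then show "\<exists>T. connectedin X T \<and> Inl x \<in> T \<and> p \<in> T \<and> T \<subseteq> topspace X"
      using join[OF u(1) cx ab] connectedin_subset_topspace by blast
  qed
  then show "connected_space X"
    by (simp only: connectedin_topspace)
next
  assume "\<exists>C\<subseteq>topspace X. subtopology X C homeomorphic_space top_of_set circle"
  then obtain C where C: "C \<subseteq> leaf_of suspension x" "subtopology X C homeomorphic_space top_of_set circle"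
    by (auto simp: topspace_leaf)
  have CY: "C \<subseteq> points suspension"
    using C(1) by (auto simp: leaf_of_def)
  have "continuous_map X (space_of suspension) id"
    unfolding continuous_map_def
  proof (intro conjI allI impI)
    show "id \<in> topspace X \<rightarrow> topspace (space_of suspension)"
      unfolding topspace_leaf Y.topspace by (auto simp: leaf_of_def)
    fix U
    assume U: "openin (space_of suspension) U"
    show "openin X {p \<in> topspace X. id p \<in> U}"
    proof (rule openin_leafI)
      fix v
      assume v: "cls v"
      then have "v \<in> {0..1}"
        using cls_unit by fastforce
      note b = band_of[OF this]
      have "continuous_map (top_of_set {0..1}) (top_of_set (rect (band_of v))) (\<lambda>y. (v - shift (band_of v) False, y))"
        using b(2) by (auto simp: continuous_map_in_subtopology rect_def intro!: continuous_intros)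
      then have "continuous_map (top_of_set {0..1}) (space_of suspension) (arc_at v)"
        using continuous_map_compose[OF _ Y.continuous_map_glue[OF b(1)]] unfolding o_def arc_at_def by blast
      from openin_continuous_map_preimage[OF this U]
      have "openin (top_of_set {0..1}) {y \<in> {0..1}. arc_at v y \<in> U}"
        by simp
      moreover have "{y \<in> {0..1}. arc_at v y \<in> U} = {y \<in> {0..1}. arc_at v y \<in> {p \<in> topspace X. id p \<in> U}}"
        using arc_in_leaf[OF v] by (auto simp: topspace_leaf)
      ultimately show "openin (top_of_set {0..1}) {y \<in> {0..1}. arc_at v y \<in> {p \<in> topspace X. id p \<in> U}}"
        by simp
    qed (auto simp: topspace_leaf)
  qed
  then have "continuous_map (subtopology X C) (subtopology (space_of suspension) C) id"
    using C(1) by (simp add: continuous_map_in_subtopology continuous_map_from_subtopology)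
  moreover have "compact_space (subtopology X C)"
  proof -
    have "compact_space (top_of_set circle)"
      by (simp add: compact_space_subtopology)
    then show ?thesis
      using homeomorphic_compact_space[OF C(2)] by blast
  qed
  moreover have "Hausdorff_space (subtopology (space_of suspension) C)"
    using Y.Hausdorff by (rule Hausdorff_space_subtopology)
  moreover have "id ` topspace (subtopology X C) = topspace (subtopology (space_of suspension) C)"
    using C(1) CY by (auto simp: topspace_leaf Y.topspace)
  ultimately have "homeomorphic_map (subtopology X C) (subtopology (space_of suspension) C) id"
    by (intro continuous_imp_homeomorphic_map) auto
  then have "subtopology (space_of suspension) C homeomorphic_space subtopology X C"
    using homeomorphic_space homeomorphic_space_sym by blast
  then have "subtopology (space_of suspension) C homeomorphic_space top_of_set circle"
    using C(2) homeomorphic_space_trans by blast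
  then show False
    using no_circle_in_regular_leaf[OF x C(1)] by blast
qed

lemma level_F_pow: "cls u \<Longrightarrow> level x ((F ^^ j) u) = level x u + int j"
proof (induction j)
  case (Suc j)
  then show ?case
    using level_F[OF x cls_F_pow[OF Suc.prems, of j]] by simp
qed simp

definition ancestors :: "real \<Rightarrow> real set" where
  "ancestors v = {u \<in> {0..<1}. \<exists>n. (F ^^ n) u = v}"

lemma ancestors_refl: "v \<in> {0..<1} \<Longrightarrow> v \<in> ancestors v"
  by (auto simp: ancestors_def intro: exI[of _ 0])

lemma ancestors_F: "u \<in> ancestors v \<Longrightarrow> u \<noteq> v \<Longrightarrow> F u \<in> ancestors v"
proof -
  assume "u \<in> ancestors v" "u \<noteq> v"
  then obtain n where n: "u \<in> {0..<1}" "(F ^^ n) u = v"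
    by (auto simp: ancestors_def)
  then obtain m where "n = Suc m"
    using \<open>u \<noteq> v\<close> by (cases n) auto
  then have "(F ^^ m) (F u) = v"
    using n(2) by (simp add: funpow_swap1)
  then show ?thesis
    using F_unit[OF n(1)] unfolding ancestors_def by blast
qed

lemma ancestors_pre: "F u \<in> ancestors v \<Longrightarrow> u \<in> {0..<1} \<Longrightarrow> u \<in> ancestors v"
proof -
  assume "F u \<in> ancestors v" "u \<in> {0..<1}"
  then obtain n where "(F ^^ n) (F u) = v"
    by (auto simp: ancestors_def)
  then have "(F ^^ Suc n) u = v"
    by (simp add: funpow_swap1)
  then show ?thesis
    using \<open>u \<in> {0..<1}\<close> unfolding ancestors_def by blast
qed

lemma ancestors_F_pow: "(F ^^ n) u \<in> ancestors v \<Longrightarrow> u \<in> {0..<1} \<Longrightarrow> u \<in> ancestors v"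
proof (induction n)
  case (Suc n)
  then show ?case
    using ancestors_pre[of "(F ^^ n) u" v] F_pow_unit[of u n] by simp
qed simp

lemma ancestors_trans: "u \<in> ancestors v \<Longrightarrow> v \<in> ancestors z \<Longrightarrow> u \<in> ancestors z"
  using ancestors_F_pow unfolding ancestors_def by blast

lemma F_not_ancestor: "v \<in> {0..<1} \<Longrightarrow> F v \<notin> ancestors v"
proof
  assume v: "v \<in> {0..<1}" "F v \<in> ancestors v"
  then obtain n where "(F ^^ n) (F v) = v"
    by (auto simp: ancestors_def)
  then have "(F ^^ Suc n) v = v"
    by (simp add: funpow_swap1)
  then show False
    using no_periodic[OF v(1), of "Suc n"] by blast
qed

lemma ancestors_cls: "u \<in> ancestors v \<Longrightarrow> cls v \<Longrightarrow> cls u"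
  using cls_preimage by (auto simp: ancestors_def)

text \<open>A point outside the \<open>N\<close>-th image has only backward orbits with fewer than
  \<open>N\<close> steps, and all fibres are finite.\<close>

lemma finite_ancestors:
  assumes "u \<in> {0..<1}" "u \<notin> Om"
  shows "finite (ancestors u)"
proof -
  obtain N where N: "u \<notin> (F ^^ N) ` {0..<1}"
    using assms by (auto simp: Om_def)
  have "ancestors u \<subseteq> (\<Union>j<N. {v. (F ^^ j) v = u})"
  proof
    fix v
    assume "v \<in> ancestors u"
    then obtain j where j: "v \<in> {0..<1}" "(F ^^ j) v = u"
      by (auto simp: ancestors_def)
    have "j < N"
    proof (rule ccontr)
      assume "\<not> j < N"
      then have "u \<in> (F ^^ N) ` {0..<1}"
        using decreasing[of N j] j by fastforce
      then show False
        using N by blast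
    qed
    then show "v \<in> (\<Union>j<N. {v. (F ^^ j) v = u})"
      using j(2) by blast
  qed
  moreover have "finite (\<Union>j<N. {v. (F ^^ j) v = u})"
    using finite_F_pow_fibre by simp
  ultimately show ?thesis
    by (rule finite_subset)
qed

section \<open>The two ends of a leaf along a bi-infinite orbit in the attractor\<close>

context
  fixes w :: "int \<Rightarrow> real"
  assumes wF: "\<And>n. F (w n) = w (n + 1)" and wOm: "\<And>n. w n \<in> Om" and wx: "\<And>n. cls (w n)"
    and unique: "\<And>y u v. cls y \<Longrightarrow> u \<in> Om \<Longrightarrow> v \<in> Om \<Longrightarrow> F u = y \<Longrightarrow> F v = y \<Longrightarrow> u = v"
begin

lemma w_unit: "w n \<in> {0..<1}"
  using wx by (rule cls_unit)

lemma wF_pow: "(F ^^ j) (w n) = w (n + int j)"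
  by (induction j) (simp_all add: wF algebra_simps)

lemma ancestors_w_mono: "m \<le> n \<Longrightarrow> ancestors (w m) \<subseteq> ancestors (w n)"
proof
  fix u
  assume "m \<le> n" "u \<in> ancestors (w m)"
  moreover from \<open>m \<le> n\<close> have "(F ^^ nat (n - m)) (w m) = w n"
    by (simp add: wF_pow)
  then have "w m \<in> ancestors (w n)"
    using w_unit unfolding ancestors_def by blast
  ultimately show "u \<in> ancestors (w n)"
    using ancestors_trans by blast
qed

text \<open>Passing to \<open>w (n + 1)\<close> adds this vertex and the finite trees behind those
  of its preimages that are not in \<open>Om\<close>; by \<open>unique\<close>, the only preimage in
  \<open>Om\<close> is \<open>w n\<close>.\<close>

lemma finite_ancestors_diff: "m \<le> n \<Longrightarrow> finite (ancestors (w n) - ancestors (w m))"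
proof (induction n rule: int_ge_induct)
  case (step n)
  have "ancestors (w (n + 1)) - ancestors (w m) \<subseteq>
      insert (w (n + 1)) ((ancestors (w n) - ancestors (w m)) \<union> (\<Union>u\<in>{u. F u = w (n + 1)} \<inter> ({0..<1} - Om). ancestors u))"
  proof
    fix v
    assume v: "v \<in> ancestors (w (n + 1)) - ancestors (w m)"
    then obtain j where j: "v \<in> {0..<1}" "(F ^^ j) v = w (n + 1)"
      by (auto simp: ancestors_def)
    show "v \<in> insert (w (n + 1)) ((ancestors (w n) - ancestors (w m)) \<union> (\<Union>u\<in>{u. F u = w (n + 1)} \<inter> ({0..<1} - Om). ancestors u))"
    proof (cases j)
      case 0
      then show ?thesis
        using j by simp
    next
      case (Suc i)
      let ?u = "(F ^^ i) v"
      have u: "F ?u = w (n + 1)" "?u \<in> {0..<1}" "v \<in> ancestors ?u"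
        using j Suc F_pow_unit[OF j(1), of i] unfolding ancestors_def by auto
      show ?thesis
      proof (cases "?u \<in> Om")
        case True
        then have "?u = w n"
          using unique[OF wx[of "n + 1"] True wOm[of n] u(1) wF] by simp
        then show ?thesis
          using u(3) v by auto
      next
        case False
        then show ?thesis
          using u by blast
      qed
    qed
  qed
  moreover have "finite (\<Union>u\<in>{u. F u = w (n + 1)} \<inter> ({0..<1} - Om). ancestors u)"
    using finite_F_fibre finite_ancestors by (intro finite_UN_I) auto
  ultimately show ?case
    using step.IH finite_subset by (metis (no_types, lifting) finite_Un finite_insert)
qed simp

lemma eventually_ancestor: "cls u \<Longrightarrow> \<exists>N::nat. \<forall>n\<ge>N. u \<in> ancestors (w (int n))"
proof -
  assume u: "cls u"
  obtain a b where "(F ^^ a) u = (F ^^ b) (w 0)"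
    using cls_merge[OF u wx[of 0]] by blast
  then have "(F ^^ a) u = w (int b)"
    by (simp add: wF_pow)
  then have "u \<in> ancestors (w (int b))"
    using cls_unit[OF u] unfolding ancestors_def by blast
  moreover have "ancestors (w (int b)) \<subseteq> ancestors (w (int n))" if "n \<ge> b" for n
    using that by (intro ancestors_w_mono) simp
  ultimately show ?thesis
    by blast
qed

text \<open>The level of an ancestor is at most that of its descendant, and the level of
  \<open>w (- int n)\<close> decreases without bound.\<close>

lemma eventually_not_ancestor: "cls u \<Longrightarrow> \<exists>N::nat. \<forall>n\<ge>N. u \<notin> ancestors (w (- int n))"
proof -
  assume u: "cls u"
  have "level x u + int n \<le> level x (w 0)" if "u \<in> ancestors (w (- int n))" for n
  proof -
    obtain j where "(F ^^ j) u = w (- int n)"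
      using \<open>u \<in> ancestors (w (- int n))\<close> by (auto simp: ancestors_def)
    then have "level x u + int j = level x (w (- int n))"
      using level_F_pow[OF u, of j] by simp
    moreover have "level x (w 0) = level x (w (- int n)) + int n"
      using level_F_pow[OF wx[of "- int n"], of n] by (simp add: wF_pow)
    ultimately show ?thesis
      by simp
  qed
  then have "u \<notin> ancestors (w (- int n))" if "n \<ge> nat (level x (w 0) - level x u) + 1" for n
    using that by fastforce
  then show ?thesis
    by blast
qed

text \<open>Neighbourhoods of the forward and of the backward end of the line through the points \<open>w n\<close>. The
  sets \<open>middle n\<close> are disjoint from them, open and exhaust the leaf, so every compact set lies in one
  of them.\<close>

definition upper :: "nat \<Rightarrow> point set" where
  "upper n = {arc_at u y |u y. cls u \<and> y \<in> {0..<1} \<and> (u \<notin> ancestors (w (int n)) \<or> u = w (int n) \<and> 0 < y)}"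

definition lower :: "nat \<Rightarrow> point set" where
  "lower n = {arc_at u y |u y. cls u \<and> y \<in> {0..<1} \<and> u \<in> ancestors (w (- int n))}"

definition middle :: "nat \<Rightarrow> point set" where
  "middle n = {arc_at u y |u y. cls u \<and> y \<in> {0..<1} \<and> u \<in> ancestors (w (int n)) \<and> u \<noteq> w (int n) \<and>
     u \<notin> ancestors (w (- int n)) \<and> \<not> (u = w (1 - int n) \<and> y = 0)}"

lemma arc_mem_iff:
  assumes "cls v" "y \<in> {0..<1}" "S = {arc_at u y |u y. cls u \<and> y \<in> {0..<1} \<and> R u y}"
  shows "arc_at v y \<in> S \<longleftrightarrow> R v y"
proof
  assume "arc_at v y \<in> S"
  then obtain u y' where u: "arc_at v y = arc_at u y'" "cls u" "y' \<in> {0..<1}" "R u y'"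
    using assms(3) by blast
  then show "R v y"
    using arc_at_inject[OF u(1) cls_unit[OF assms(1)] cls_unit[OF u(2)] assms(2) u(3)] by simp
qed (use assms in blast)

lemma upper_iff: "cls v \<Longrightarrow> y \<in> {0..<1} \<Longrightarrow> arc_at v y \<in> upper n \<longleftrightarrow> v \<notin> ancestors (w (int n)) \<or> v = w (int n) \<and> 0 < y"
  by (rule arc_mem_iff[OF _ _ upper_def])

lemma lower_iff: "cls v \<Longrightarrow> y \<in> {0..<1} \<Longrightarrow> arc_at v y \<in> lower n \<longleftrightarrow> v \<in> ancestors (w (- int n))"
  by (rule arc_mem_iff[OF _ _ lower_def])

lemma middle_iff: "cls v \<Longrightarrow> y \<in> {0..<1} \<Longrightarrow> arc_at v y \<in> middle n \<longleftrightarrow> v \<in> ancestors (w (int n)) \<and> v \<noteq> w (int n) \<and>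
     v \<notin> ancestors (w (- int n)) \<and> \<not> (v = w (1 - int n) \<and> y = 0)"
  by (rule arc_mem_iff[OF _ _ middle_def])

lemma arc_at_1_0: "arc_at v 1 = arc_at (F v) 0"
  by (simp add: arc_at_0 arc_at_1)

lemma subset_leaf: "upper n \<subseteq> leaf_of suspension x" "lower n \<subseteq> leaf_of suspension x" "middle n \<subseteq> leaf_of suspension x"
  using arc_in_leaf by (auto simp: upper_def lower_def middle_def)

lemma openin_upper: "openin X (upper n)"
proof (rule openin_leafI[OF subset_leaf(1)])
  fix v
  assume v: "cls v"
  show "openin (top_of_set {0..1}) {y \<in> {0..1}. arc_at v y \<in> upper n}"
  proof (rule openin_unit[where c = "v \<notin> ancestors (w (int n)) \<or> v = w (int n)"])
    show "(arc_at v y \<in> upper n) = (v \<notin> ancestors (w (int n)) \<or> v = w (int n))" if "y \<in> {0<..<1}" for y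
      using upper_iff[OF v, of y n] that by auto
    show "v \<notin> ancestors (w (int n)) \<or> v = w (int n)" if "arc_at v 0 \<in> upper n"
      using upper_iff[OF v, of 0 n] that by auto
    show "v \<notin> ancestors (w (int n)) \<or> v = w (int n)" if "arc_at v 1 \<in> upper n"
      using upper_iff[OF cls_F[OF v], of 0 n] that ancestors_F[of v "w (int n)"] by (auto simp: arc_at_1_0)
  qed
qed

lemma openin_lower: "openin X (lower n)"
proof (rule openin_leafI[OF subset_leaf(2)])
  fix v
  assume v: "cls v"
  show "openin (top_of_set {0..1}) {y \<in> {0..1}. arc_at v y \<in> lower n}"
  proof (rule openin_unit[where c = "v \<in> ancestors (w (- int n))"])
    show "(arc_at v y \<in> lower n) = (v \<in> ancestors (w (- int n)))" if "y \<in> {0<..<1}" for y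
      using lower_iff[OF v, of y n] that by auto
    show "v \<in> ancestors (w (- int n))" if "arc_at v 0 \<in> lower n"
      using lower_iff[OF v, of 0 n] that by auto
    show "v \<in> ancestors (w (- int n))" if "arc_at v 1 \<in> lower n"
      using lower_iff[OF cls_F[OF v], of 0 n] that ancestors_pre[OF _ cls_unit[OF v]] by (auto simp: arc_at_1_0)
  qed
qed

lemma openin_middle: "openin X (middle n)"
proof (rule openin_leafI[OF subset_leaf(3)])
  fix v
  assume v: "cls v"
  let ?c = "v \<in> ancestors (w (int n)) \<and> v \<noteq> w (int n) \<and> v \<notin> ancestors (w (- int n))"
  show "openin (top_of_set {0..1}) {y \<in> {0..1}. arc_at v y \<in> middle n}"
  proof (rule openin_unit[where c = ?c])
    show "(arc_at v y \<in> middle n) = ?c" if "y \<in> {0<..<1}" for y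
      using middle_iff[OF v, of y n] that by auto
    show ?c if "arc_at v 0 \<in> middle n"
      using middle_iff[OF v, of 0 n] that by auto
    show ?c if m: "arc_at v 1 \<in> middle n"
    proof -
      have Fv: "F v \<in> ancestors (w (int n))" "F v \<noteq> w (int n)" "F v \<notin> ancestors (w (- int n))" "F v \<noteq> w (1 - int n)"
        using middle_iff[OF cls_F[OF v], of 0 n] m by (auto simp: arc_at_1_0)
      have "v \<in> ancestors (w (int n))"
        using ancestors_pre[OF Fv(1) cls_unit[OF v]] .
      moreover have "v \<noteq> w (int n)"
        using F_not_ancestor[OF w_unit[of "int n"]] Fv(1) by auto
      moreover have "v \<notin> ancestors (w (- int n))"
      proof
        assume "v \<in> ancestors (w (- int n))"
        moreover have "v \<noteq> w (- int n)"
          using Fv(4) wF[of "- int n"] by auto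
        ultimately show False
          using ancestors_F Fv(3) by blast
      qed
      ultimately show ?c
        by blast
    qed
  qed
qed

lemma chain_subset:
  assumes "\<And>j. j < i \<Longrightarrow> arc_at ((F ^^ j) u) ` {0..1} \<subseteq> S" "Inl u \<in> S"
  shows "chain u i \<subseteq> S"
  using assms by (auto simp: chain_def)

lemma arc_image_subset:
  assumes "cls v" "\<And>y. y \<in> {0..<1} \<Longrightarrow> arc_at v y \<in> S" "arc_at (F v) 0 \<in> S"
  shows "arc_at v ` {0..1} \<subseteq> S"
proof
  fix p
  assume "p \<in> arc_at v ` {0..1}"
  then obtain y where y: "y \<in> {0..1}" "p = arc_at v y"
    by blast
  then show "p \<in> S"
    using assms(2)[of y] assms(3) by (cases "y = 1") (auto simp: arc_at_1_0)
qed

lemma connectedin_lower: "connectedin X (lower n)"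
proof (rule connectedin_star[where a = "Inl (w (- int n))"])
  fix p
  let ?w = "w (- int n)"
  assume "p \<in> lower n"
  then obtain u y where u: "cls u" "y \<in> {0..<1}" "u \<in> ancestors ?w" "p = arc_at u y"
    by (auto simp: lower_def)
  obtain k where k: "(F ^^ k) u = ?w"
    using u(3) by (auto simp: ancestors_def)
  have wl: "Inl ?w \<in> lower n"
    using lower_iff[OF wx, of 0 "- int n" n] ancestors_refl[OF w_unit] by (simp add: arc_at_0)
  show "\<exists>T. connectedin X T \<and> Inl ?w \<in> T \<and> p \<in> T \<and> T \<subseteq> lower n"
  proof (cases "u = ?w")
    case True
    have "arc_at u ` {0..y} \<subseteq> lower n"
    proof
      fix q
      assume "q \<in> arc_at u ` {0..y}"
      then obtain z where "z \<in> {0..y}" "q = arc_at u z"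
        by blast
      then show "q \<in> lower n"
        using lower_iff[OF u(1), of z n] u(2,3) by auto
    qed
    moreover have "connectedin X (arc_at u ` {0..y})"
      using u(1,2) by (intro connectedin_arc) auto
    moreover have "Inl ?w \<in> arc_at u ` {0..y}"
      using u(2) True arc_at_0[of u] by (intro image_eqI[of _ _ 0]) auto
    moreover have "p \<in> arc_at u ` {0..y}"
      using u by auto
    ultimately show ?thesis
      by blast
  next
    case False
    have mem: "v \<in> ancestors ?w \<Longrightarrow> cls v \<Longrightarrow> v \<noteq> ?w \<Longrightarrow> arc_at v ` {0..1} \<subseteq> lower n" for v
      using ancestors_F[of v ?w] lower_iff[OF cls_F, of v 0 n] lower_iff[of v _ n]
      by (intro arc_image_subset) auto
    have "(F ^^ j) u \<in> ancestors ?w \<and> (F ^^ j) u \<noteq> ?w" if "j < k" for j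
    proof
      have eq: "(F ^^ (k - j)) ((F ^^ j) u) = ?w"
        using k that by (simp flip: funpow_add[THEN fun_cong, unfolded o_apply])
      then show "(F ^^ j) u \<in> ancestors ?w"
        using F_pow_unit[OF cls_unit[OF u(1)]] unfolding ancestors_def by blast
      show "(F ^^ j) u \<noteq> ?w"
        using eq no_periodic[OF w_unit, of "k - j"] that by auto
    qed
    then have "chain u k \<subseteq> lower n"
      using mem cls_F_pow[OF u(1)] lower_iff[OF u(1), of 0 n] u(3)
      by (intro chain_subset) (auto simp: arc_at_0)
    moreover have "arc_at u ` {0..1} \<subseteq> lower n"
      using mem[OF u(3,1) False] .
    moreover have "chain ?w 0 \<subseteq> lower n"
      using wl by (simp add: chain_def)
    ultimately have "arc_at u ` {0..1} \<union> chain u k \<union> chain ?w 0 \<subseteq> lower n"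
      by blast
    moreover have "p \<in> arc_at u ` {0..1} \<union> chain u k \<union> chain ?w 0"
      using u by auto
    moreover have kw: "(F ^^ k) u = (F ^^ 0) ?w"
      using k by simp
    ultimately show ?thesis
      by (intro exI[of _ "arc_at u ` {0..1} \<union> chain u k \<union> chain ?w 0"] conjI join[OF u(1) wx kw])
  qed
qed

lemma connectedin_upper: "connectedin X (upper n)"
proof (rule connectedin_star[where a = "Inl (w (int n + 1))"])
  fix p
  let ?w = "w (int n)" and ?w' = "w (int n + 1)"
  assume "p \<in> upper n"
  then obtain u y where u: "cls u" "y \<in> {0..<1}" "u \<notin> ancestors ?w \<or> u = ?w \<and> 0 < y" "p = arc_at u y"
    by (auto simp: upper_def)
  have mem: "arc_at v ` {0..1} \<subseteq> upper n" if "v \<notin> ancestors ?w" "cls v" for v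
    using that ancestors_pre[of v ?w] cls_unit[OF that(2)] upper_iff[OF cls_F, of v 0 n] upper_iff[of v _ n]
    by (intro arc_image_subset) auto
  have not_anc: "(F ^^ j) v \<notin> ancestors ?w" if "v \<notin> ancestors ?w" "cls v" for v j
    using ancestors_F_pow cls_unit that by blast
  have w': "?w' \<notin> ancestors ?w"
    using F_not_ancestor[OF w_unit] wF by metis
  show "\<exists>T. connectedin X T \<and> Inl ?w' \<in> T \<and> p \<in> T \<and> T \<subseteq> upper n"
  proof (cases "u \<notin> ancestors ?w")
    case True
    obtain a b where ab: "(F ^^ a) u = (F ^^ b) ?w'"
      using cls_merge[OF u(1) wx] by blast
    have sub: "chain v k \<subseteq> upper n" if "v \<notin> ancestors ?w" "cls v" for v k
      using that mem not_anc cls_F_pow upper_iff[OF that(2), of 0 n] by (intro chain_subset) (auto simp: arc_at_0)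
    have "arc_at u ` {0..1} \<union> chain u a \<union> chain ?w' b \<subseteq> upper n"
      using sub[OF True u(1)] sub[OF w' wx] mem[OF True u(1)] by blast
    moreover have "p \<in> arc_at u ` {0..1} \<union> chain u a \<union> chain ?w' b"
      using u by auto
    ultimately show ?thesis
      by (intro exI[of _ "arc_at u ` {0..1} \<union> chain u a \<union> chain ?w' b"] conjI join[OF u(1) wx ab])
  next
    case False
    then have uw: "u = ?w" "0 < y"
      using u(3) by auto
    have "arc_at u ` {y..1} \<subseteq> upper n"
    proof
      fix q
      assume "q \<in> arc_at u ` {y..1}"
      then obtain z where z: "z \<in> {y..1}" "q = arc_at u z"
        by blast
      show "q \<in> upper n"
      proof (cases "z = 1")
        case True
        then have "q = arc_at ?w' 0"
          using z(2) uw(1) wF by (simp add: arc_at_1_0)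
        then show ?thesis
          using upper_iff[OF wx, of 0 _ n] w' by simp
      next
        case False
        then show ?thesis
          using z uw upper_iff[OF u(1), of z n] by auto
      qed
    qed
    moreover have "connectedin X (arc_at u ` {y..1})"
      using u(1) uw by (intro connectedin_arc) auto
    moreover have "Inl ?w' \<in> arc_at u ` {y..1}"
      using u(2) uw(1) arc_at_1[of u] wF by (intro image_eqI[of _ _ 1]) auto
    moreover have "p \<in> arc_at u ` {y..1}"
      using u by auto
    ultimately show ?thesis
      by blast
  qed
qed

text \<open>The index starts at \<open>Suc n\<close> because \<open>upper 0\<close> and
  \<open>lower 0\<close> share the open arc starting at \<open>w 0\<close>. What lies outside both
  neighbourhoods is covered by the finitely many arcs of
  \<open>finite_ancestors_diff\<close>.\<close>

lemma card_ends_leaf: "card (ends X) = 2"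
proof (rule card_ends_eq_2[where U = "\<lambda>n. upper (Suc n)" and V = "\<lambda>n. lower (Suc n)"])
  show "upper (Suc n) \<noteq> {}" for n
    using upper_iff[OF wx, of 0 "int (Suc n) + 1" "Suc n"] F_not_ancestor[OF w_unit, of "int (Suc n)"] wF[of "int (Suc n)"] by auto
  show "lower (Suc n) \<noteq> {}" for n
    using lower_iff[OF wx, of 0 "- int (Suc n)" "Suc n"] ancestors_refl[OF w_unit] by auto
  show "upper (Suc n) \<subseteq> upper (Suc m)" if "m \<le> n" for m n
  proof
    fix p
    assume "p \<in> upper (Suc n)"
    then obtain u y where u: "cls u" "y \<in> {0..<1}" "u \<notin> ancestors (w (int (Suc n))) \<or> u = w (int (Suc n)) \<and> 0 < y" "p = arc_at u y"
      by (auto simp: upper_def)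
    have "u \<notin> ancestors (w (int (Suc m))) \<or> u = w (int (Suc m)) \<and> 0 < y"
    proof (cases "m = n")
      case False
      have "w (int (Suc n)) \<notin> ancestors (w (int (Suc m)))"
      proof
        assume a: "w (int (Suc n)) \<in> ancestors (w (int (Suc m)))"
        have "w (int (Suc m) + 1) \<in> ancestors (w (int (Suc n)))"
          using ancestors_w_mono[of "int (Suc m) + 1" "int (Suc n)"] ancestors_refl[OF w_unit] that False by auto
        then have "F (w (int (Suc m))) \<in> ancestors (w (int (Suc m)))"
          using a ancestors_trans wF by metis
        then show False
          using F_not_ancestor[OF w_unit] by blast
      qed
      then show ?thesis
        using u(3) ancestors_w_mono[of "int (Suc m)" "int (Suc n)"] that by auto
    qed (use u(3) in simp)
    then show "p \<in> upper (Suc m)"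
      using upper_iff[OF u(1,2)] u(4) by blast
  qed
  show "lower (Suc n) \<subseteq> lower (Suc m)" if "m \<le> n" for m n
    using ancestors_w_mono[of "- int (Suc n)" "- int (Suc m)"] that unfolding lower_def by auto
  have sub: "ancestors (w (- int n)) \<subseteq> ancestors (w (int n))" for n
    by (rule ancestors_w_mono) simp
  have not_low: "w (int (Suc n)) \<notin> ancestors (w (- int (Suc n)))" for n
  proof
    assume a: "w (int (Suc n)) \<in> ancestors (w (- int (Suc n)))"
    have "w (- int (Suc n) + 1) \<in> ancestors (w (int (Suc n)))"
      using ancestors_w_mono[of "- int (Suc n) + 1" "int (Suc n)"] ancestors_refl[OF w_unit] by auto
    then have "F (w (- int (Suc n))) \<in> ancestors (w (- int (Suc n)))"
      using a ancestors_trans wF by metis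
    then show False
      using F_not_ancestor[OF w_unit] by blast
  qed
  have disj: "upper (Suc n) \<inter> lower (Suc n) = {}" for n
  proof (rule ccontr)
    assume "upper (Suc n) \<inter> lower (Suc n) \<noteq> {}"
    then obtain p where p: "p \<in> upper (Suc n)" "p \<in> lower (Suc n)"
      by blast
    then obtain u y where u: "cls u" "y \<in> {0..<1}" "u \<in> ancestors (w (- int (Suc n)))" "p = arc_at u y"
      by (auto simp: lower_def)
    then show False
      using p(1) upper_iff[OF u(1,2)] sub[of "Suc n"] not_low[of n] by auto
  qed
  then show "upper (Suc 0) \<inter> lower (Suc 0) = {}" .
  show "compactin X (topspace X - (upper (Suc n) \<union> lower (Suc n)))" for n
  proof -
    let ?D = "ancestors (w (int (Suc n))) - ancestors (w (- int (Suc n)))"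
    have "compactin X (\<Union>u\<in>?D. arc_at u ` {0..1})"
    proof (rule compactin_Union)
      show "finite ((\<lambda>u. arc_at u ` {0..1}) ` ?D)"
        by (intro finite_imageI finite_ancestors_diff) simp
      fix S
      assume "S \<in> (\<lambda>u. arc_at u ` {0..1}) ` ?D"
      then show "compactin X S"
        using compactin_arc ancestors_cls wx by blast
    qed
    moreover have "topspace X - (upper (Suc n) \<union> lower (Suc n)) \<subseteq> (\<Union>u\<in>?D. arc_at u ` {0..1})"
    proof
      fix p
      assume p: "p \<in> topspace X - (upper (Suc n) \<union> lower (Suc n))"
      then have "p \<in> leaf_of suspension x"
        by (simp add: topspace_leaf)
      then obtain u y where u: "cls u" "y \<in> {0..<1}" "p = arc_at u y"
        by (rule leafE)
      then have "u \<in> ?D"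
        using p upper_iff[OF u(1,2)] lower_iff[OF u(1,2)] by blast
      then show "p \<in> (\<Union>u\<in>?D. arc_at u ` {0..1})"
        unfolding u(3) by (rule UN_I) (use u(2) in auto)
    qed
    moreover have "closedin X (topspace X - (upper (Suc n) \<union> lower (Suc n)))"
      by (intro closedin_diff openin_Un openin_upper openin_lower closedin_topspace)
    ultimately show ?thesis
      by (rule closed_compactin)
  qed
  show "\<exists>n. K \<inter> (upper (Suc n) \<union> lower (Suc n)) = {}" if K: "compactin X K" for K
  proof -
    have mono: "middle m \<subseteq> middle n" if "m \<le> n" for m n
    proof
      fix p
      assume "p \<in> middle m"
      then obtain u y where u: "cls u" "y \<in> {0..<1}" "p = arc_at u y"
        and m: "u \<in> ancestors (w (int m))" "u \<noteq> w (int m)" "u \<notin> ancestors (w (- int m))" "\<not> (u = w (1 - int m) \<and> y = 0)"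
        by (auto simp: middle_def)
      have 1: "u \<in> ancestors (w (int n))"
        using m(1) ancestors_w_mono[of "int m" "int n"] that by auto
      have 2: "u \<noteq> w (int n)"
      proof
        assume un: "u = w (int n)"
        then have "m < n"
          using m(2) that by (cases "m = n") auto
        then have "w (int m + 1) \<in> ancestors u"
          unfolding un using ancestors_w_mono[of "int m + 1" "int n"] ancestors_refl[OF w_unit] by auto
        then have "F (w (int m)) \<in> ancestors (w (int m))"
          using m(1) ancestors_trans wF by metis
        then show False
          using F_not_ancestor[OF w_unit] by blast
      qed
      have 3: "u \<notin> ancestors (w (- int n))"
        using m(3) ancestors_w_mono[of "- int n" "- int m"] that by auto
      have 4: "\<not> (u = w (1 - int n) \<and> y = 0)"
      proof
        assume a: "u = w (1 - int n) \<and> y = 0"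
        then have "m < n"
          using m(4) that by (cases "m = n") auto
        then have "u \<in> ancestors (w (- int m))"
          using a ancestors_w_mono[of "1 - int n" "- int m"] ancestors_refl[OF w_unit] by auto
        then show False
          using m(3) by blast
      qed
      show "p \<in> middle n"
        unfolding u(3) middle_iff[OF u(1,2)] using 1 2 3 4 by blast
    qed
    have cover: "leaf_of suspension x \<subseteq> (\<Union>n. middle n)"
    proof
      fix p
      assume "p \<in> leaf_of suspension x"
      then obtain u y where u: "cls u" "y \<in> {0..<1}" "p = arc_at u y"
        by (rule leafE)
      obtain N1 N2 N3 N4 where N: "\<And>n. n \<ge> N1 \<Longrightarrow> u \<in> ancestors (w (int n))"
        "\<And>n. n \<ge> N2 \<Longrightarrow> u \<notin> ancestors (w (- int n))" "\<And>n. n \<ge> N3 \<Longrightarrow> F u \<in> ancestors (w (int n))"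
        using eventually_ancestor[OF u(1)] eventually_ancestor[OF cls_F[OF u(1)]] eventually_not_ancestor[OF u(1)] by metis
      \<comment> \<open>One more than the bounds, so that \<open>u\<close> is still no ancestor of
        \<open>w (1 - int ?n)\<close> and thus differs from this excluded vertex.\<close>
      let ?n = "Suc (max N1 (max N2 N3))"
      have "F u \<in> ancestors (w (int ?n))"
        by (rule N(3)) simp
      then have "u \<noteq> w (int ?n)"
        using F_not_ancestor[OF w_unit[of "int ?n"]] by (intro notI) (simp only: simp_thms)
      moreover have "u \<noteq> w (1 - int ?n)"
      proof
        assume "u = w (1 - int ?n)"
        then have "u = w (- int (max N1 (max N2 N3)))"
          by simp
        moreover have "u \<notin> ancestors (w (- int (max N1 (max N2 N3))))"
          by (rule N(2)) simp
        ultimately show False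
          using ancestors_refl[OF w_unit[of "- int (max N1 (max N2 N3))"]] by (simp only: simp_thms)
      qed
      ultimately have "p \<in> middle ?n"
        unfolding u(3) middle_iff[OF u(1,2)] using N(1)[of ?n] N(2)[of ?n] by auto
      then show "p \<in> (\<Union>n. middle n)"
        by blast
    qed
    have "K \<subseteq> \<Union>(range middle)"
      using K cover compactin_subset_topspace by (fastforce simp: topspace_leaf)
    then obtain G where G: "finite G" "G \<subseteq> range middle" "K \<subseteq> \<Union>G"
      using compactinD[OF K, of "range middle"] openin_middle by blast
    obtain I where I: "finite I" "G = middle ` I"
      using G(1,2) by (meson finite_subset_image)
    let ?n = "Max (insert 1 I)"
    have "K \<subseteq> middle ?n"
    proof
      fix p
      assume "p \<in> K"
      then obtain i where "i \<in> I" "p \<in> middle i"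
        using G(3) I(2) by blast
      moreover have "i \<le> ?n"
        using I(1) \<open>i \<in> I\<close> by (intro Max_ge) auto
      ultimately show "p \<in> middle ?n"
        using mono by blast
    qed
    moreover have "?n \<ge> 1"
      using I(1) by (intro Max_ge) auto
    then obtain m where m: "?n = Suc m"
      by (cases ?n) auto
    moreover have "middle (Suc m) \<inter> (upper (Suc m) \<union> lower (Suc m)) = {}"
    proof (rule ccontr)
      assume "middle (Suc m) \<inter> (upper (Suc m) \<union> lower (Suc m)) \<noteq> {}"
      then obtain p where p: "p \<in> middle (Suc m)" "p \<in> upper (Suc m) \<or> p \<in> lower (Suc m)"
        by blast
      then obtain u y where u: "cls u" "y \<in> {0..<1}" "p = arc_at u y"
        by (auto simp: middle_def)
      show False
        using p unfolding u(3) middle_iff[OF u(1,2)] upper_iff[OF u(1,2)] lower_iff[OF u(1,2)] by blast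
    qed
    ultimately show ?thesis
      by (intro exI[of _ m]) auto
  qed
qed (intro connectedin_upper connectedin_lower openin_upper openin_lower)+

end

end

end

context interval_translation_map
begin

definition doubly_covered :: "real set" where
  "doubly_covered = {y. \<exists>u\<in>Om. \<exists>v\<in>Om. u \<noteq> v \<and> F u = y \<and> F v = y}"

text \<open>The line starts at a point of the orbit in \<open>Om\<close> and continues forward by
  \<open>F\<close> and backward by choosing preimages in \<open>Om\<close>; \<open>single\<close>
  gives each vertex of the leaf at most one preimage in \<open>Om\<close>.\<close>

lemma two_ended_leaf:
  fixes i :: nat
  assumes x: "regular x" and enter: "(F ^^ i) x \<in> Om"
    and single: "\<And>m n y. y \<in> doubly_covered \<Longrightarrow> (F ^^ m) x \<noteq> (F ^^ n) y"
  shows "two_ended suspension (leaf_of suspension x)"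
proof -
  have xu: "x \<in> {0..<1}"
    using x by (simp add: regular_def)
  have "\<forall>y\<in>Om. \<exists>u. u \<in> Om \<and> F u = y"
    using Om_preimage by blast
  from bchoice[OF this] obtain g where g: "\<forall>y\<in>Om. g y \<in> Om \<and> F (g y) = y"
    by (elim exE) (rule that)
  define z where "z = (F ^^ i) x"
  have backward: "(g ^^ i) z \<in> Om \<and> (F ^^ i) ((g ^^ i) z) = z" for i
  proof (induction i)
    case (Suc i)
    then show ?case
      using g by (simp add: funpow_swap1[of F])
  qed (simp add: enter z_def)
  have forward: "(F ^^ i) z \<in> Om" for i
    using enter F_Om by (induction i) (simp_all add: z_def)
  define w :: "int \<Rightarrow> real" where "w n = (if n \<ge> 0 then (F ^^ nat n) z else (g ^^ nat (- n)) z)" for n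
  have wF: "F (w n) = w (n + 1)" for n
  proof (cases "n \<ge> 0")
    case True
    then show ?thesis
      by (simp add: w_def nat_add_distrib)
  next
    case False
    define i where "i = nat (- n - 1)"
    have n: "n = - int (Suc i)"
      using False by (simp add: i_def)
    have "w n = g ((g ^^ i) z)"
      by (simp add: w_def n nat_add_distrib)
    then have "F (w n) = (g ^^ i) z"
      using g backward by simp
    also have "\<dots> = w (n + 1)"
      by (cases i) (simp_all add: w_def n nat_add_distrib)
    finally show ?thesis .
  qed
  have wOm: "w n \<in> Om" for n
    using backward forward by (simp add: w_def)
  have wx: "(x, w n) \<in> leaf_rel suspension" for n
  proof (cases "n \<ge> 0")
    case True
    then have "w n = (F ^^ (nat n + i)) x"
      by (simp add: w_def z_def funpow_add)
    then show ?thesis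
      using F_pow_leaf_rel[OF xu] by simp
  next
    case False
    then have "(F ^^ i) x = (F ^^ nat (- n)) (w n)"
      using backward by (simp add: w_def z_def)
    then show ?thesis
      using orbit_leaf_rel[OF xu] wOm[of n] Om_subset by blast
  qed
  have unique: "u = v" if uv: "(x, y) \<in> leaf_rel suspension" "u \<in> Om" "v \<in> Om" "F u = y" "F v = y" for y u v
  proof (rule ccontr)
    assume "u \<noteq> v"
    then have "y \<in> doubly_covered"
      using uv unfolding doubly_covered_def by blast
    then show False
      using single regular_leaf_rel[OF x] uv(1) by blast
  qed
  show ?thesis
    unfolding two_ended_def
    by (intro conjI is_tree_leaf[OF x] card_ends_leaf[where w = w, OF x wF wOm wx unique])
qed

definition bad :: "real set" where
  "bad = {x \<in> {0..1}. \<not> (regular x \<and> (\<exists>k. (F ^^ k) x \<in> Om) \<and>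
     (\<forall>m n. \<forall>y\<in>doubly_covered. (F ^^ m) x \<noteq> (F ^^ n) y))}"

lemma negligible_bad: "negligible bad"
proof -
  let ?S = "\<Union>s\<in>singular. leaf_rel suspension `` {s}"
  let ?N = "{x \<in> {0..<1}. \<forall>n. (F ^^ n) x \<notin> Om}"
  let ?D = "{x. \<exists>m n. (F ^^ m) x \<in> (F ^^ n) ` doubly_covered}"
  have "countable ?S"
    using countable_leaf_rel[OF Y.finite_bands] by (intro countable_UN) (auto simp: singular_def)
  then have "negligible ?S"
    by (simp add: negligible_iff_null_sets countable_imp_null_set_lborel null_sets_completionI)
  moreover have "negligible ?D"
    using negligible_saturation[OF negligible_double_preimage] unfolding doubly_covered_def .
  ultimately have "negligible (?S \<union> (?N \<union> ?D))"
    using negligible_never_enters_Om by (intro negligible_Un)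
  moreover have "bad \<subseteq> ?S \<union> (?N \<union> ?D)"
  proof
    fix x
    assume x: "x \<in> bad"
    show "x \<in> ?S \<union> (?N \<union> ?D)"
    proof (cases "regular x")
      case False
      have "x \<in> {0..1}"
        using x by (simp add: bad_def)
      then show ?thesis
        using not_regular[OF _ False] by blast
    next
      case True
      then have "x \<in> {0..<1}"
        by (simp add: regular_def)
      then show ?thesis
        using x True unfolding bad_def by blast
    qed
  qed
  ultimately show ?thesis
    by (rule negligible_subset)
qed

lemma full_measure_suspension: "full_measure suspension (\<Union>{L \<in> leaves suspension. two_ended suspension L})"
  unfolding full_measure_def
proof
  fix B :: band
  assume B: "B \<in> bands suspension"
  let ?G = "\<Union>{L \<in> leaves suspension. two_ended suspension L}"
  let ?T = "(\<lambda>x. x - shift B False) ` bad"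
  have "negligible ?T"
    using negligible_translation[OF negligible_bad, of "- shift B False"] by simp
  then have "?T \<in> null_sets lebesgue"
    by (simp add: negligible_iff_null_sets)
  \<comment> \<open>A Borel null set, so that its product with the line is null for the product of
    the two Borel measures.\<close>
  then obtain T where T: "T \<in> null_sets lborel" "?T \<subseteq> T"
    by (auto simp: null_sets_completion_iff2)
  have "T \<times> UNIV \<in> null_sets (lborel \<Otimes>\<^sub>M (lborel :: real measure))"
    using T(1) by (intro lborel.times_in_null_sets1) simp_all
  then have "T \<times> (UNIV :: real set) \<in> null_sets lborel"
    by (simp add: lborel_prod)
  then have "T \<times> (UNIV :: real set) \<in> null_sets lebesgue"
    by (rule null_sets_completionI)
  moreover have "{p \<in> rect B. glue B p \<notin> ?G} \<subseteq> T \<times> UNIV"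
  proof
    fix p
    assume p: "p \<in> {p \<in> rect B. glue B p \<notin> ?G}"
    obtain t y where ty: "p = (t, y)" "t \<in> {lo B..hi B}" "y \<in> {0..1}"
      using p by (cases p) (auto simp: rect_def)
    let ?x = "t + shift B False"
    have xu: "?x \<in> {0..1}"
      using Y.base_support[OF B ty(2), of False] by (simp add: support_suspension)
    have "?x \<in> bad"
    proof (rule ccontr)
      assume "?x \<notin> bad"
      then have "regular ?x" "\<exists>k. (F ^^ k) ?x \<in> Om" "\<forall>m n. \<forall>y\<in>doubly_covered. (F ^^ m) ?x \<noteq> (F ^^ n) y"
        using xu unfolding bad_def by blast+
      then have "two_ended suspension (leaf_of suspension ?x)"
        using two_ended_leaf by blast
      moreover have "leaf_of suspension ?x \<in> leaves suspension"
        using xu by (simp add: leaves_suspension)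
      moreover have "glue B p \<in> leaf_of suspension ?x"
        unfolding ty(1) by (rule Y.glue_leaf_of[OF B ty(2,3) leaf_rel_refl])
      ultimately show False
        using p by blast
    qed
    then have "t \<in> ?T"
      by (intro image_eqI[of _ _ ?x]) auto
    then show "p \<in> T \<times> UNIV"
      using T(2) ty(1) by blast
  qed
  ultimately show "{p \<in> rect B. glue B p \<notin> ?G} \<in> null_sets lebesgue"
    by (rule null_sets_completion_subset[rotated])
qed

end

section \<open>Isomorphism invariants\<close>

lemma locally_constant_onE:
  assumes "locally_constant_on S f" "p \<in> S"
  obtains T where "open T" "p \<in> T" "\<And>q. q \<in> T \<Longrightarrow> q \<in> S \<Longrightarrow> f q = f p"
  using assms unfolding locally_constant_on_iff by (meson IntI)

text \<open>Being a primitive is a local property that ignores constants, so a function need only be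
  compared with known primitives near each point.\<close>

lemma dx_primitive_local:
  assumes U: "openin (space_of Y) U"
    and local: "\<And>p. p \<in> U \<Longrightarrow> \<exists>W h K. p \<in> W \<and> W \<subseteq> U \<and> dx_primitive Y W h \<and> (\<forall>q\<in>W. f q = h q + K)"
  shows "dx_primitive Y U f"
proof -
  have gen: "locally_constant_on {z \<in> S. e z \<in> U} (\<lambda>z. f (e z) - \<xi> z)"
    if lc: "\<And>W h. dx_primitive Y W h \<Longrightarrow> locally_constant_on {z \<in> S. e z \<in> W} (\<lambda>z. h (e z) - \<xi> z)"
      and op: "\<And>W. openin (space_of Y) W \<Longrightarrow> openin (top_of_set S) {z \<in> S. e z \<in> W}"
    for S :: "'a::topological_space set" and e \<xi>
    unfolding locally_constant_on_iff
  proof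
    fix z
    assume z: "z \<in> {z \<in> S. e z \<in> U}"
    then have "\<exists>W h K. e z \<in> W \<and> W \<subseteq> U \<and> dx_primitive Y W h \<and> (\<forall>q\<in>W. f q = h q + K)"
      by (intro local) simp
    then obtain W h K where W: "e z \<in> W" "W \<subseteq> U" "dx_primitive Y W h" "\<forall>q\<in>W. f q = h q + K"
      by (elim exE conjE) (rule that)
    have zW: "z \<in> {z \<in> S. e z \<in> W}"
      using z W(1) by simp
    obtain T where T: "open T" "z \<in> T" "\<And>q. q \<in> T \<Longrightarrow> q \<in> {z \<in> S. e z \<in> W} \<Longrightarrow> h (e q) - \<xi> q = h (e z) - \<xi> z"
      by (rule locally_constant_onE[OF lc[OF W(3)] zW]) (rule that)
    have "openin (space_of Y) W"
      using W(3) by (simp add: dx_primitive_def)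
    then have "openin (top_of_set S) {z \<in> S. e z \<in> W}"
      by (rule op)
    then obtain N where N: "open N" "{z \<in> S. e z \<in> W} = S \<inter> N"
      unfolding openin_open by (elim exE conjE) (rule that)
    have "f (e q) - \<xi> q = f (e z) - \<xi> z" if "q \<in> (T \<inter> N) \<inter> {z \<in> S. e z \<in> U}" for q
    proof -
      have "q \<in> {z \<in> S. e z \<in> W}"
        using that N(2) by blast
      then have "e q \<in> W" "h (e q) - \<xi> q = h (e z) - \<xi> z"
        using T(3)[of q] that by simp_all
      then show ?thesis
        using bspec[OF W(4), of "e q"] bspec[OF W(4) W(1)] by simp
    qed
    moreover have "z \<in> N"
      using N(2) z W(1) by blast
    ultimately show "\<exists>T. open T \<and> z \<in> T \<and> (\<forall>q\<in>T \<inter> {z \<in> S. e z \<in> U}. f (e q) - \<xi> q = f (e z) - \<xi> z)"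
      using T(1,2) N(1) by (intro exI[of _ "T \<inter> N"]) (simp add: open_Int)
  qed
  have "locally_constant_on {x \<in> support Y. Inl x \<in> U} (\<lambda>x. f (Inl x) - x)"
    by (rule gen) (simp_all add: dx_primitive_def openin_space_of)
  moreover have "locally_constant_on {p \<in> rect B. glue B p \<in> U} (\<lambda>p. f (glue B p) - fst p)" if "B \<in> bands Y" for B
    by (rule gen) (use that in \<open>simp_all add: dx_primitive_def openin_space_of\<close>)
  ultimately show ?thesis
    using U by (simp add: dx_primitive_def)
qed

lemma dx_primitive_subset:
  assumes "dx_primitive Y V h" "openin (space_of Y) W" "W \<subseteq> V"
  shows "dx_primitive Y W h"
  unfolding dx_primitive_def
proof (intro conjI ballI)
  show "locally_constant_on {x \<in> support Y. Inl x \<in> W} (\<lambda>x. h (Inl x) - x)"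
    by (rule locally_constant_on_subset[of "{x \<in> support Y. Inl x \<in> V}"]) (use assms in \<open>auto simp: dx_primitive_def\<close>)
  fix B
  assume "B \<in> bands Y"
  then have "locally_constant_on {p \<in> rect B. glue B p \<in> V} (\<lambda>p. h (glue B p) - fst p)"
    using assms(1) by (simp add: dx_primitive_def)
  then show "locally_constant_on {p \<in> rect B. glue B p \<in> W} (\<lambda>p. h (glue B p) - fst p)"
    by (rule locally_constant_on_subset) (use assms(3) in blast)
qed (rule assms)

text \<open>The definition controls only pullbacks from \<open>Y'\<close>. A primitive
  \<open>f\<close> of \<open>Y\<close> is therefore compared locally with the pullback of a chart
  \<open>g\<close> of \<open>Y'\<close>; they differ by a constant, so \<open>c * f\<close>
  transported by the inverse is \<open>g\<close> plus a constant.\<close>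

lemma isomorphic_upto_scale_sym:
  assumes Y: "union_of_bands Y" and Y': "union_of_bands Y'" and iso: "isomorphic_upto_scale Y Y'"
  shows "isomorphic_upto_scale Y' Y"
proof -
  interpret Y: band_complex Y by unfold_locales (rule Y)
  interpret Y': band_complex Y' by unfold_locales (rule Y')
  obtain h c where h: "homeomorphic_map (space_of Y) (space_of Y') h" and c: "c \<noteq> 0"
    and pull: "\<And>U f. dx_primitive Y' U f \<Longrightarrow> dx_primitive Y {p \<in> points Y. h p \<in> U} (\<lambda>p. f (h p) / c)"
    using iso unfolding isomorphic_upto_scale_def by blast
  obtain h' where hh': "homeomorphic_maps (space_of Y) (space_of Y') h h'"
    using h homeomorphic_map_maps by blast
  then have h': "homeomorphic_map (space_of Y') (space_of Y) h'"
    using homeomorphic_maps_sym homeomorphic_map_maps by blast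
  have cont': "continuous_map (space_of Y') (space_of Y) h'" and inv: "\<And>p. p \<in> points Y' \<Longrightarrow> h (h' p) = p"
    using hh' by (auto simp: homeomorphic_maps_def Y'.topspace)
  have h'Y: "h' p \<in> points Y" if "p \<in> points Y'" for p
    using cont' that by (auto simp: continuous_map_def Y.topspace Y'.topspace)
  have open': "openin (space_of Y') {p \<in> points Y'. h' p \<in> W}" if "openin (space_of Y) W" for W
    using openin_continuous_map_preimage[OF cont' that] by (simp add: Y'.topspace)
  have "dx_primitive Y' {p \<in> points Y'. h' p \<in> U} (\<lambda>p. f (h' p) / (1 / c))" if f: "dx_primitive Y U f" for U f
  proof (rule dx_primitive_local)
    show "openin (space_of Y') {p \<in> points Y'. h' p \<in> U}"
      using f by (intro open') (simp add: dx_primitive_def)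
    fix p
    assume p: "p \<in> {p \<in> points Y'. h' p \<in> U}"
    then obtain V g where g: "(V, g) \<in> charts Y'" "p \<in> V"
      using Y'.chart_exists by blast
    note primg = Y'.chart_dx_primitive[OF g(1)]
    have "h' p \<in> U \<inter> {p \<in> points Y. h p \<in> V}"
      using p g(2) inv h'Y by auto
    from dx_primitive_diff[OF f pull[OF primg] this]
    obtain W where W: "openin (space_of Y) W" "h' p \<in> W" "W \<subseteq> U \<inter> {p \<in> points Y. h p \<in> V}"
      "\<forall>q\<in>W. f q - g (h q) / c = f (h' p) - g (h (h' p)) / c"
      by (elim exE conjE) (rule that)
    let ?W = "{p \<in> points Y'. h' p \<in> W}"
    have WV: "?W \<subseteq> V"
    proof
      fix q
      assume q: "q \<in> ?W"
      then have "h (h' q) \<in> V"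
        using W(3) by blast
      then show "q \<in> V"
        using q inv by simp
    qed
    have "dx_primitive Y' ?W g"
      using primg open'[OF W(1)] WV by (rule dx_primitive_subset)
    moreover have "f (h' q) / (1 / c) = g q + (c * f (h' p) - g p)" if "q \<in> ?W" for q
    proof -
      have "f (h' q) - g q / c = f (h' p) - g p / c"
        using bspec[OF W(4), of "h' q"] that inv p by simp
      then have "c * (f (h' q) - g q / c) = c * (f (h' p) - g p / c)"
        by simp
      then show ?thesis
        using c by (simp add: right_diff_distrib mult.commute)
    qed
    ultimately show "\<exists>W g K. p \<in> W \<and> W \<subseteq> {p \<in> points Y'. h' p \<in> U} \<and> dx_primitive Y' W g \<and> (\<forall>q\<in>W. f (h' q) / (1 / c) = g q + K)"
      using p W(2,3) by (intro exI[of _ ?W] exI[of _ g] exI[of _ "c * f (h' p) - g p"] conjI ballI) auto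
  qed
  then show ?thesis
    unfolding isomorphic_upto_scale_def using h' c
    by (intro exI[of _ h'] exI[of _ "1 / c"]) simp
qed

definition position :: "point \<Rightarrow> real" where
  "position p = (case p of Inl x \<Rightarrow> x | Inr q \<Rightarrow> fst q)"

lemma (in band_complex) chart_position:
  assumes "(U, h) \<in> charts Y" "p \<in> U" "0 \<in> G" "\<And>B e. B \<in> bands Y \<Longrightarrow> shift B e \<in> G"
  shows "h p - position p \<in> G"
proof -
  have "p \<in> points Y"
    using assms by (auto simp: charts_def)
  then show ?thesis
  proof (rule pointsE)
    fix x
    assume "p = Inl x"
    then show ?thesis
      using assms by (auto simp: charts_def position_def base_position_def)
  next
    fix B q
    assume "B \<in> bands Y" "p = Inr q" "band_at Y (fst q) = B"
    then show ?thesis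
      using assms by (auto simp: charts_def position_def base_position_def band_position_def)
  qed
qed

text \<open>Modulo the group generated by the shifts, the first coordinate is well defined on the whole
  complex; so an isomorphism multiplies the periods of \<open>dx\<close> by \<open>c\<close> and maps them into that group.\<close>

lemma isomorphic_upto_scale_periods:
  assumes Y: "union_of_bands Y" and Y': "union_of_bands Y'" and iso: "isomorphic_upto_scale Y Y'"
    and conn: "connected (support Y)"
    and G0: "0 \<in> G" and G_diff: "\<And>a b. a \<in> G \<Longrightarrow> b \<in> G \<Longrightarrow> a - b \<in> G"
    and G_shift: "\<And>B e. B \<in> bands Y' \<Longrightarrow> shift B e \<in> G"
  shows "\<exists>c. c \<noteq> 0 \<and> (\<forall>B\<in>bands Y. c * (shift B True - shift B False) \<in> G)"
proof -
  interpret Y: band_complex Y by unfold_locales (rule Y)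
  interpret Y': band_complex Y' by unfold_locales (rule Y')
  have G_minus: "- a \<in> G" if "a \<in> G" for a
    using G_diff[OF G0 that] by simp
  have G_add: "a + b \<in> G" if "a \<in> G" "b \<in> G" for a b
    using G_diff[OF that(1) G_minus[OF that(2)]] by simp
  obtain h c where h: "homeomorphic_map (space_of Y) (space_of Y') h" and c: "c \<noteq> 0"
    and pull: "\<And>U f. dx_primitive Y' U f \<Longrightarrow> dx_primitive Y {p \<in> points Y. h p \<in> U} (\<lambda>p. f (h p) / c)"
    using iso unfolding isomorphic_upto_scale_def by blast
  have hY: "h p \<in> points Y'" if "p \<in> points Y" for p
    using h that by (auto simp: homeomorphic_eq_everything_map Y.topspace Y'.topspace)
  \<comment> \<open>Here \<open>\<xi>\<close> is a primitive of \<open>dx\<close> along the curve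
    \<open>g\<close>. The claim is an equivalence relation in \<open>t\<close> and \<open>t'\<close>
    that holds locally by the charts of \<open>Y'\<close>.\<close>
  have gen: "position (h (g t')) - position (h (g t)) - c * (\<xi> t' - \<xi> t) \<in> G"
    if S: "connected S" "t \<in> S" "t' \<in> S" "continuous_map (top_of_set S) (space_of Y) g"
      and \<xi>: "\<And>U f. dx_primitive Y U f \<Longrightarrow> locally_constant_on {t \<in> S. g t \<in> U} (\<lambda>t. f (g t) - \<xi> t)"
    for S :: "real set" and t t' g \<xi>
  proof (rule connected_equivalence_relation[OF S(1-3), where R = "\<lambda>t t'. position (h (g t')) - position (h (g t)) - c * (\<xi> t' - \<xi> t) \<in> G"])
    fix t t'
    assume "position (h (g t')) - position (h (g t)) - c * (\<xi> t' - \<xi> t) \<in> G"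
    from G_minus[OF this] show "position (h (g t)) - position (h (g t')) - c * (\<xi> t - \<xi> t') \<in> G"
      by (simp add: algebra_simps)
  next
    fix t t' t''
    assume "position (h (g t')) - position (h (g t)) - c * (\<xi> t' - \<xi> t) \<in> G"
      "position (h (g t'')) - position (h (g t')) - c * (\<xi> t'' - \<xi> t') \<in> G"
    from G_add[OF this] show "position (h (g t'')) - position (h (g t)) - c * (\<xi> t'' - \<xi> t) \<in> G"
      by (simp add: algebra_simps)
  next
    fix t
    assume t: "t \<in> S"
    then have gt: "g t \<in> points Y"
      using S(4) by (auto simp: continuous_map_def Y.topspace)
    then obtain U k where Uk: "(U, k) \<in> charts Y'" "h (g t) \<in> U"
      using Y'.chart_exists hY by blast
    let ?V = "{p \<in> points Y. h p \<in> U}"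
    have prim: "dx_primitive Y ?V (\<lambda>p. k (h p) / c)"
      by (rule pull[OF Y'.chart_dx_primitive[OF Uk(1)]])
    let ?T = "{t \<in> S. g t \<in> ?V}"
    have tT: "t \<in> ?T"
      using t gt Uk(2) by simp
    obtain N where N: "open N" "t \<in> N" "\<And>q. q \<in> N \<Longrightarrow> q \<in> ?T \<Longrightarrow> k (h (g q)) / c - \<xi> q = k (h (g t)) / c - \<xi> t"
      by (rule locally_constant_onE[OF \<xi>[OF prim] tT]) (rule that)
    have "openin (top_of_set S) ?T"
      using openin_continuous_map_preimage[OF S(4), of ?V] prim by (simp add: dx_primitive_def)
    moreover have "openin (top_of_set S) (S \<inter> N)"
      using N(1) by (rule openin_open_Int)
    ultimately have "openin (top_of_set S) (?T \<inter> (S \<inter> N))"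
      by (rule openin_Int)
    moreover have "position (h (g q)) - position (h (g t)) - c * (\<xi> q - \<xi> t) \<in> G" if q: "q \<in> ?T \<inter> (S \<inter> N)" for q
    proof -
      have "k (h (g q)) / c - \<xi> q = k (h (g t)) / c - \<xi> t"
        using N(3)[of q] q by simp
      then have "c * (k (h (g q)) / c - \<xi> q) = c * (k (h (g t)) / c - \<xi> t)"
        by simp
      then have "k (h (g q)) - k (h (g t)) = c * (\<xi> q - \<xi> t)"
        using c by (simp add: algebra_simps)
      moreover have "h (g q) \<in> U"
        using q by blast
      then have "k (h (g t)) - position (h (g t)) - (k (h (g q)) - position (h (g q))) \<in> G"
        using Uk(2) by (intro G_diff Y'.chart_position[OF Uk(1) _ G0 G_shift])
      moreover have "position (h (g q)) - position (h (g t)) - c * (\<xi> q - \<xi> t)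
          = k (h (g t)) - position (h (g t)) - (k (h (g q)) - position (h (g q)))"
        using calculation(1) by linarith
      ultimately show ?thesis
        by (simp only:)
    qed
    ultimately show "\<exists>T. openin (top_of_set S) T \<and> t \<in> T \<and> (\<forall>t'\<in>T. position (h (g t')) - position (h (g t)) - c * (\<xi> t' - \<xi> t) \<in> G)"
      using tT t N(2) by (intro exI[of _ "?T \<inter> (S \<inter> N)"] conjI ballI) simp_all
  qed
  have horizontal: "position (h (Inl t')) - position (h (Inl t)) - c * (t' - t) \<in> G" if "t \<in> support Y" "t' \<in> support Y" for t t'
    using conn that Y.continuous_map_Inl by (rule gen) (simp add: dx_primitive_def)
  have "c * (shift B True - shift B False) \<in> G" if B: "B \<in> bands Y" for B
  proof -
    have lo: "lo B \<in> {lo B..hi B}"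
      using Y B by (auto simp: union_of_bands_def)
    have "continuous_map (top_of_set {0..1}) (top_of_set (rect B)) (\<lambda>y. (lo B, y))"
      using lo by (auto simp: continuous_map_in_subtopology rect_def intro!: continuous_intros)
    then have g: "continuous_map (top_of_set {0..1}) (space_of Y) (\<lambda>y. glue B (lo B, y))"
      using continuous_map_compose[OF _ Y.continuous_map_glue[OF B]] unfolding o_def by blast
    \<comment> \<open>The loop goes up a side of the band, where \<open>dx\<close> vanishes, and
      back along the support, where it integrates to the displacement. Comparing the two paths
      yields the period.\<close>
    have "position (h (glue B (lo B, 1))) - position (h (glue B (lo B, 0))) - c * (lo B - lo B) \<in> G"
    proof (rule gen[OF _ _ _ g, where \<xi> = "\<lambda>_. lo B"])
      fix U f
      assume "dx_primitive Y U f"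
      then have lc: "locally_constant_on {p \<in> rect B. glue B p \<in> U} (\<lambda>p. f (glue B p) - fst p)"
        using B by (simp add: dx_primitive_def)
      show "locally_constant_on {t \<in> {0..1}. glue B (lo B, t) \<in> U} (\<lambda>t. f (glue B (lo B, t)) - lo B)"
        unfolding locally_constant_on_iff
      proof
        fix y
        assume y: "y \<in> {t \<in> {0..1}. glue B (lo B, t) \<in> U}"
        then have mem: "(lo B, y) \<in> {p \<in> rect B. glue B p \<in> U}"
          using lo by (simp add: rect_def)
        obtain T where T: "open T" "(lo B, y) \<in> T"
          "\<And>q. q \<in> T \<Longrightarrow> q \<in> {p \<in> rect B. glue B p \<in> U} \<Longrightarrow> f (glue B q) - fst q = f (glue B (lo B, y)) - fst (lo B, y)"
          by (rule locally_constant_onE[OF lc mem]) (rule that)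
        have "open ((\<lambda>y. (lo B, y)) -` T)"
          using T(1) by (rule open_vimage) (intro continuous_intros)
        moreover have "f (glue B (lo B, q)) - lo B = f (glue B (lo B, y)) - lo B"
          if "q \<in> (\<lambda>y. (lo B, y)) -` T \<inter> {t \<in> {0..1}. glue B (lo B, t) \<in> U}" for q
          using T(3)[of "(lo B, q)"] that lo by (simp add: rect_def)
        ultimately show "\<exists>T. open T \<and> y \<in> T \<and> (\<forall>q\<in>T \<inter> {t \<in> {0..1}. glue B (lo B, t) \<in> U}.
            f (glue B (lo B, q)) - lo B = f (glue B (lo B, y)) - lo B)"
          using T(2) by (intro exI[of _ "(\<lambda>y. (lo B, y)) -` T"] conjI ballI) simp_all
      qed
    qed auto
    then have v: "position (h (Inl (lo B + shift B True))) - position (h (Inl (lo B + shift B False))) \<in> G"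
      by (simp add: Y.glue_0 Y.glue_1)
    have "position (h (Inl (lo B + shift B True))) - position (h (Inl (lo B + shift B False)))
        - c * (lo B + shift B True - (lo B + shift B False)) \<in> G"
      using Y.base_support[OF B lo] by (intro horizontal)
    from G_diff[OF v this] show ?thesis
      by (simp add: algebra_simps)
  qed
  then show ?thesis
    using c by blast
qed

text \<open>A countable maximal antichain, together with the countably many elements related to its
  members, would exhaust \<open>P\<close>.\<close>

lemma uncountable_antichain:
  assumes P: "uncountable P" and countable: "\<And>x. x \<in> P \<Longrightarrow> countable {y \<in> P. R x y \<or> R y x}"
  shows "\<exists>M\<subseteq>P. uncountable M \<and> pairwise (\<lambda>x y. \<not> R x y) M"
proof -
  let ?A = "{M. M \<subseteq> P \<and> pairwise (\<lambda>x y. \<not> R x y) M}"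
  have "\<exists>M\<in>?A. \<forall>X\<in>?A. M \<subseteq> X \<longrightarrow> X = M"
  proof (rule subset_Zorn')
    fix C
    assume "subset.chain ?A C"
    then have C: "C \<subseteq> ?A" "\<And>X Z. X \<in> C \<Longrightarrow> Z \<in> C \<Longrightarrow> X \<subseteq> Z \<or> Z \<subseteq> X"
      by (auto simp: subset_chain_def)
    have "\<not> R x y" if xy: "x \<in> \<Union>C" "y \<in> \<Union>C" "x \<noteq> y" for x y
    proof -
      obtain X Z where "X \<in> C" "Z \<in> C" "x \<in> X" "y \<in> Z"
        using xy by blast
      then obtain W where "W \<in> C" "x \<in> W" "y \<in> W"
        using C(2)[of X Z] by blast
      then show ?thesis
        using C(1) xy(3) by (auto simp: pairwise_def)
    qed
    then show "\<Union>C \<in> ?A"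
      using C(1) by (auto simp: pairwise_def)
  qed
  then obtain M where MA: "M \<in> ?A" and maxA: "\<forall>X\<in>?A. M \<subseteq> X \<longrightarrow> X = M"
    by (rule bexE)
  have M: "M \<subseteq> P" "pairwise (\<lambda>x y. \<not> R x y) M"
    using MA by simp_all
  have max: "X = M" if "X \<subseteq> P" "pairwise (\<lambda>x y. \<not> R x y) X" "M \<subseteq> X" for X
    using maxA that by simp
  have "uncountable M"
  proof
    assume "countable M"
    have "P \<subseteq> M \<union> (\<Union>x\<in>M. {y \<in> P. R x y \<or> R y x})"
    proof
      fix y
      assume y: "y \<in> P"
      show "y \<in> M \<union> (\<Union>x\<in>M. {y \<in> P. R x y \<or> R y x})"
      proof (rule ccontr)
        assume no: "y \<notin> M \<union> (\<Union>x\<in>M. {y \<in> P. R x y \<or> R y x})"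
        then have "pairwise (\<lambda>x y. \<not> R x y) (insert y M)"
          using M(2) y by (auto simp: pairwise_insert)
        then have "insert y M = M"
          using y M(1) by (intro max) auto
        then show False
          using no by blast
      qed
    qed
    moreover have "countable (M \<union> (\<Union>x\<in>M. {y \<in> P. R x y \<or> R y x}))"
      using \<open>countable M\<close> M(1) countable by (intro countable_Un countable_UN) auto
    ultimately show False
      using P countable_subset by blast
  qed
  then show ?thesis
    using M by blast
qed

section \<open>Uncountably many suspensions\<close>

context interval_translation_map
begin

lemma displacements_suspension:
  "(\<lambda>B. shift B True - shift B False) ` bands suspension = {L 1, L 2, L 2 - 1}"
  by (auto simp: bands_suspension band_defs alpha_def beta_def)

lemma shift_suspension:
  fixes B :: band
  assumes "B \<in> bands suspension"
  shows "shift B e \<in> {L 1, 0, L 2 - 1, -1, L 2 - 3, -2}"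
  using assms by (auto simp: bands_suspension band_defs alpha_def beta_def)

lemma suspension_cong:
  assumes "interval_translation_map L' k' loss'" "L' 1 = L 1" "L' 2 = L 2"
  shows "interval_translation_map.suspension L' = suspension"
proof -
  interpret other: interval_translation_map L' k' loss'
    by (rule assms(1))
  have "other.alpha = alpha" "other.beta = beta"
    by (simp_all only: other.alpha_def other.beta_def alpha_def beta_def assms(2,3))
  then show ?thesis
    by (simp only: other.suspension_def other.band_defs suspension_def band_defs)
qed

lemma L_1_L_2: "L 2 - 1 < L 2" "L 2 < L 1"
  using alpha_beta by (simp_all add: alpha_def beta_def)

end

definition displacements :: "band_union \<Rightarrow> real set" where
  "displacements Y = (\<lambda>B. shift B True - shift B False) ` bands Y"

abbreviation surface :: "(nat \<Rightarrow> bool) \<Rightarrow> band_union" where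
  "surface s \<equiv> interval_translation_map.suspension (len s)"

lemma displacements_surface: "displacements (surface s) = {len s 1, len s 2, len s 2 - 1}"
  unfolding displacements_def by (rule interval_translation_map.displacements_suspension[OF interval_translation_map])

text \<open>Reads the parameters off the complex itself, so that uncountably many parameters give
  uncountably many complexes.\<close>

lemma parameters_surface: "(Max (displacements (surface s)), Min (displacements (surface s)) + 1) = (len s 1, len s 2)"
  using interval_translation_map.L_1_L_2[OF interval_translation_map, of s] by (simp add: displacements_surface)

lemma uncountable_surfaces: "uncountable (range surface)"
proof
  assume "countable (range surface)"
  then have "countable ((\<lambda>Y. (Max (displacements Y), Min (displacements Y) + 1)) ` range surface)"
    by (rule countable_image)
  then have "countable (range (\<lambda>s. (Max (displacements (surface s)), Min (displacements (surface s)) + 1)))"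
    by (simp only: image_image)
  then show False
    using uncountable_parameters unfolding parameters_surface by blast
qed

lemma union_of_bands_surface: "union_of_bands (surface s)"
  by (rule interval_translation_map.union_of_bands_suspension[OF interval_translation_map])

definition periods :: "real \<Rightarrow> real \<Rightarrow> real set" where
  "periods a b = range (\<lambda>(p, q, r). of_int p + of_int q * a + of_int r * b)"

lemma countable_periods: "countable (periods a b)"
  unfolding periods_def by (rule countable_image) (rule countableI_type)

lemma periodsI: "of_int p + of_int q * a + of_int r * b \<in> periods a b"
  unfolding periods_def by (rule image_eqI[of _ _ "(p, q, r)"]) simp_all

lemma periods_diff:
  assumes "x \<in> periods a b" "y \<in> periods a b"
  shows "x - y \<in> periods a b"
proof -
  obtain p q r p' q' r' where "x = of_int p + of_int q * a + of_int r * b" "y = of_int p' + of_int q' * a + of_int r' * b"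
    using assms by (auto simp: periods_def)
  then have "x - y = of_int (p - p') + of_int (q - q') * a + of_int (r - r') * b"
    by (simp add: algebra_simps)
  then show ?thesis
    by (simp only: periodsI)
qed

lemma shift_surface:
  assumes "B \<in> bands (surface s)"
  shows "shift B e \<in> periods (len s 1) (len s 2)"
proof -
  let ?P = "periods (len s 1) (len s 2)"
  note p = periodsI[where a = "len s 1" and b = "len s 2"]
  have "len s 1 \<in> ?P" "0 \<in> ?P" "len s 2 - 1 \<in> ?P" "-1 \<in> ?P" "len s 2 - 3 \<in> ?P" "-2 \<in> ?P"
    using p[of 0 1 0] p[of 0 0 0] p[of "-1" 0 1] p[of "-1" 0 0] p[of "-3" 0 1] p[of "-2" 0 0] by simp_all
  then show ?thesis
    using interval_translation_map.shift_suspension[OF interval_translation_map assms, of e] by auto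
qed

text \<open>The displacements \<open>len t 2\<close> and \<open>len t 2 - 1\<close> differ by 1, so
  the scale \<open>c\<close> itself lies in the countable group \<open>?P\<close>, and both
  parameters of \<open>t\<close> are quotients of elements of \<open>?P\<close> by
  \<open>c\<close>.\<close>

lemma countable_isomorphism_class: "countable {Y \<in> range surface. isomorphic_upto_scale Y (surface s)}"
proof -
  let ?P = "periods (len s 1) (len s 2)"
  let ?Q = "(\<lambda>(u, v, w). (u / w, v / w)) ` (?P \<times> ?P \<times> ?P)"
  let ?S = "{t. isomorphic_upto_scale (surface t) (surface s)}"
  have "(len t 1, len t 2) \<in> ?Q" if "t \<in> ?S" for t
  proof -
    have iso: "isomorphic_upto_scale (surface t) (surface s)"
      using that by simp
    have conn: "connected (support (surface t))"
      by (simp add: interval_translation_map.support_suspension[OF interval_translation_map])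
    have zero: "0 \<in> ?P"
      using periodsI[of 0 0 _ 0] by simp
    obtain c where c: "c \<noteq> 0" "\<forall>B\<in>bands (surface t). c * (shift B True - shift B False) \<in> ?P"
      using isomorphic_upto_scale_periods[OF union_of_bands_surface union_of_bands_surface iso conn zero periods_diff shift_surface]
      by blast
    have tr: "c * x \<in> ?P" if "x \<in> displacements (surface t)" for x
      using c(2) that by (auto simp: displacements_def)
    have uvw: "c * len t 1 \<in> ?P" "c * len t 2 \<in> ?P" "c * (len t 2 - 1) \<in> ?P"
      by (rule tr, simp add: displacements_surface)+
    then have "c \<in> ?P"
      using periods_diff[OF uvw(2,3)] by (simp add: algebra_simps)
    then show ?thesis
      using uvw(1,2) c(1) by (intro image_eqI[of _ _ "(c * len t 1, c * len t 2, c)"]) simp_all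
  qed
  then have "(\<lambda>t. (len t 1, len t 2)) ` ?S \<subseteq> ?Q"
    by blast
  moreover have "countable ?Q"
    using countable_periods by (intro countable_image countable_SIGMA)
  ultimately have countable: "countable ((\<lambda>t. (len t 1, len t 2)) ` ?S)"
    by (rule countable_subset)
  \<comment> \<open>The complex depends on the pair of parameters only, so countability passes from
    the parameters to the complexes.\<close>
  define pick where "pick ab = surface (SOME t. (len t 1, len t 2) = ab)" for ab
  have "surface t = pick (len t 1, len t 2)" for t
  proof -
    have "(len (SOME t'. (len t' 1, len t' 2) = (len t 1, len t 2)) 1, len (SOME t'. (len t' 1, len t' 2) = (len t 1, len t 2)) 2)
        = (len t 1, len t 2)"
      by (rule someI[of "\<lambda>t'. (len t' 1, len t' 2) = (len t 1, len t 2)"]) (rule refl)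
    then show ?thesis
      unfolding pick_def
      by (intro interval_translation_map.suspension_cong[OF interval_translation_map interval_translation_map]) simp_all
  qed
  then have "{Y \<in> range surface. isomorphic_upto_scale Y (surface s)} \<subseteq> pick ` (\<lambda>t. (len t 1, len t 2)) ` ?S"
    by (auto simp only: image_iff mem_Collect_eq)
  then show ?thesis
    using countable_image[OF countable] by (rule countable_subset)
qed

theorem theorem2:
  shows "\<exists>\<Y> :: band_union set. uncountable \<Y> \<and>
    pairwise (\<lambda>Y Y'. \<not> isomorphic_upto_scale Y Y') \<Y> \<and>
    (\<forall>Y\<in>\<Y>. thin_type Y \<and> full_measure Y (\<Union>{L \<in> leaves Y. two_ended Y L}))"
proof -
  have "countable {Y' \<in> range surface. isomorphic_upto_scale Y Y' \<or> isomorphic_upto_scale Y' Y}"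
    if "Y \<in> range surface" for Y
  proof -
    obtain s where s: "Y = surface s"
      using \<open>Y \<in> range surface\<close> by blast
    have "{Y' \<in> range surface. isomorphic_upto_scale Y Y' \<or> isomorphic_upto_scale Y' Y}
        \<subseteq> {Y' \<in> range surface. isomorphic_upto_scale Y' (surface s)}"
      unfolding s using isomorphic_upto_scale_sym[OF union_of_bands_surface union_of_bands_surface] by blast
    then show ?thesis
      using countable_isomorphism_class by (rule countable_subset)
  qed
  from uncountable_antichain[OF uncountable_surfaces this] obtain M
    where M: "M \<subseteq> range surface" "uncountable M" "pairwise (\<lambda>Y Y'. \<not> isomorphic_upto_scale Y Y') M"
    by blast
  have "thin_type Y \<and> full_measure Y (\<Union>{L \<in> leaves Y. two_ended Y L})" if Y: "Y \<in> M" for Y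
  proof -
    obtain s where s: "Y = surface s"
      using Y M(1) by blast
    show ?thesis
      unfolding s
      using interval_translation_map.thin_type_suspension[OF interval_translation_map]
        interval_translation_map.full_measure_suspension[OF interval_translation_map] by blast
  qed
  then have "\<forall>Y\<in>M. thin_type Y \<and> full_measure Y (\<Union>{L \<in> leaves Y. two_ended Y L})"
    by (intro ballI)
  then show ?thesis
    by (intro exI[of _ M] conjI M(2,3))
qed

end
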